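(* Let $W$ be an arbitrary exceptional Weyl group (of type $G_2,F_4,E_6,E_7$ or $E_8$), and let $N$ be the number of reflections in $W$. Then for every simple $\mathbb{C}W^-$-character $\chi$, the spin fake degree satisfies $$P_W^-(\chi,t)=t^N P_W^-(\chi,t^{-1}).$$
   Context: Let $W$ be a Weyl group with Coxeter presentation $\langle s_1,\dots,s_n\mid (s_is_j)^{m_{ij}}=1\rangle$ ($m_{ii}=1$, $m_{ij}=m_{ji}\ge 2$ for $i\ne j$), and let $V$ be its (complex, $n$-dimensional) irreducible reflection representation, with a $W$-invariant nondegenerate symmetric bilinear form $(\cdot,\cdot)$ (positive definite on the real span of the roots). Spin Weyl group algebra: $\mathbb{C}W^-$ is the algebra generated by $t_1,\dots,t_n$ subject to $(t_it_j)^{m_{ij}}=(-1)^{m_{ij}+1}$ for all $i,j$ (so $t_i^2=1$). It is a superalgebra with each $t_i$ odd. Modules over a superalgebra $A$ are $\mathbb{Z}_2$-graded, $M=M_{\bar0}\oplus M_{\bar1}$ with $A_iM_j\subseteq M_{i+j}$; homomorphisms may be even or odd (or sums of these), so $\dim\mathrm{Hom}_A(M,N)$ equals the dimension of the space of $A$-linear maps between the underlying ungraded modules. A simple $\mathbb{C}W^-$-character is the (ordinary trace) character of a simple $\mathbb Z_2$-graded module, and is identified with that module. Basic spin module: let $\mathcal{C}l_V$ be the Clifford algebra of $(V,(\cdot,\cdot))$, with $v^2=(v,v)$ for $v\in V$ and $V$ odd. The assignment $t_i\mapsto \alpha_i/\sqrt{(\alpha_i,\alpha_i)}$, $\alpha_i$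 the simple root of $s_i$, is a superalgebra homomorphism $\mathbb{C}W^-\to\mathcal{C}l_V$; the basic spin module $\mathcal B_W$ is the pullback of the unique simple $\mathcal{C}l_V$-module, of dimension $2^{\lceil n/2\rceil}$. If $M$ is a $\mathbb{C}W^-$-module and $U$ a $\mathbb{C}W$-module, $M\otimes U$ is a $\mathbb{C}W^-$-module via $t_i(m\otimes u)=t_im\otimes s_iu$. Let $(S^*V)_W=S^*V/\langle (S^*V)^W_+\rangle$ be the coinvariant algebra, $\langle (S^*V)^W_+\rangle$ being the ideal generated by homogeneous $W$-invariants of positive degree, and $(S^kV)_W$ its degree-$k$ component. The spin fake degree of $\chi$ is $$P_W^-(\chi,t)=\sum_k\dim\mathrm{Hom}_{\mathbb{C}W^-}\big(\chi,\mathcal B_W\otimes(S^kV)_W\big)\,t^k .$$ *)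

theory Defs
  imports
    "HOL-Library.Poly_Mapping"
    "HOL-Library.Z2"
    "HOL-Algebra.QuotRing"
    "HOL-Algebra.Generated_Groups"
    "HOL-Computational_Algebra.Polynomial"
    "Jordan_Normal_Form.VS_Connect"
    "Jordan_Normal_Form.Matrix_Kernel"
begin

section \<open>Complex algebras, supermodules and quotients\<close>

abbreviation \<C> :: "complex ring"
  where "\<C> \<equiv> class_ring"

text \<open>
  An associative algebra over the complex numbers is represented by a record of type
  \<^typ>\<open>(complex, 'a) module\<close>, whose inherited field \<open>mult\<close> is the product of the algebra.
  For a mere vector space the fields \<open>mult\<close> and \<open>one\<close> are irrelevant.
  Parities are elements of the two-element field \<^typ>\<open>bit\<close>.
\<close>

record 'a superalgebra = "(complex, 'a) module" +
  part :: "bit \<Rightarrow> 'a set"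

record ('a, 'm) alg_module = "(complex, 'm) module" +
  act :: "'a \<Rightarrow> 'm \<Rightarrow> 'm"

record ('a, 'm) supermodule = "('a, 'm) alg_module" +
  mpart :: "bit \<Rightarrow> 'm set"

locale alg_module = vectorspace \<C> M
  for A :: "(complex, 'a, 'x) module_scheme" and M :: "('a, 'm, 'y) alg_module_scheme" +
  assumes act_closed: "a \<in> carrier A \<Longrightarrow> m \<in> carrier M \<Longrightarrow> act M a m \<in> carrier M"
    and act_add_left: "a \<in> carrier A \<Longrightarrow> b \<in> carrier A \<Longrightarrow> m \<in> carrier M \<Longrightarrow>
      act M (a \<oplus>\<^bsub>A\<^esub> b) m = act M a m \<oplus>\<^bsub>M\<^esub> act M b m"
    and act_add_right: "a \<in> carrier A \<Longrightarrow> m \<in> carrier M \<Longrightarrow> m' \<in> carrier M \<Longrightarrow>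
      act M a (m \<oplus>\<^bsub>M\<^esub> m') = act M a m \<oplus>\<^bsub>M\<^esub> act M a m'"
    and act_smult_left: "a \<in> carrier A \<Longrightarrow> m \<in> carrier M \<Longrightarrow>
      act M (c \<odot>\<^bsub>A\<^esub> a) m = c \<odot>\<^bsub>M\<^esub> act M a m"
    and act_smult_right: "a \<in> carrier A \<Longrightarrow> m \<in> carrier M \<Longrightarrow>
      act M a (c \<odot>\<^bsub>M\<^esub> m) = c \<odot>\<^bsub>M\<^esub> act M a m"
    and act_mult: "a \<in> carrier A \<Longrightarrow> b \<in> carrier A \<Longrightarrow> m \<in> carrier M \<Longrightarrow>
      act M (a \<otimes>\<^bsub>A\<^esub> b) m = act M a (act M b m)"
    and act_one: "m \<in> carrier M \<Longrightarrow> act M \<one>\<^bsub>A\<^esub> m = m"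

locale supermodule = alg_module A M
  for A :: "('a, 'x) superalgebra_scheme" and M :: "('a, 'm, 'y) supermodule_scheme" +
  assumes mpart_submodule: "LinearCombinations.submodule \<C> (mpart M i) M"
    and mpart_disjoint: "mpart M 0 \<inter> mpart M 1 = {\<zero>\<^bsub>M\<^esub>}"
    and mpart_sum: "mpart M 0 <+>\<^bsub>M\<^esub> mpart M 1 = carrier M"
    and act_mpart: "a \<in> part A i \<Longrightarrow> m \<in> mpart M j \<Longrightarrow> act M a m \<in> mpart M (i + j)"

definition graded_submodule ::
    "('a, 'x) superalgebra_scheme \<Rightarrow> 'm set \<Rightarrow> ('a, 'm, 'y) supermodule_scheme \<Rightarrow> bool"
  where "graded_submodule A N M \<longleftrightarrow>
    LinearCombinations.submodule \<C> N M \<and>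
    (\<forall>a\<in>carrier A. \<forall>m\<in>N. act M a m \<in> N) \<and>
    N = (N \<inter> mpart M 0) <+>\<^bsub>M\<^esub> (N \<inter> mpart M 1)"

definition simple_supermodule ::
    "('a, 'x) superalgebra_scheme \<Rightarrow> ('a, 'm, 'y) supermodule_scheme \<Rightarrow> bool"
  where "simple_supermodule A M \<longleftrightarrow>
    supermodule A M \<and> carrier M \<noteq> {\<zero>\<^bsub>M\<^esub>} \<and>
    (\<forall>N. graded_submodule A N M \<longrightarrow> N = {\<zero>\<^bsub>M\<^esub>} \<or> N = carrier M)"

text \<open>
  The space of all \<open>A\<close>-linear maps, with no condition on parities.  Maps are extensional, so that
  each one is represented by exactly one HOL function.
\<close>

definition hom_space ::
    "(complex, 'a, 'x) module_scheme \<Rightarrow> ('a, 'm, 'y) alg_module_scheme \<Rightarrow>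
     ('a, 'n, 'z) alg_module_scheme \<Rightarrow> (complex, 'm \<Rightarrow> 'n) module"
  where "hom_space A M N = \<lparr>
    carrier = {f \<in> LinearCombinations.module_hom \<C> M N \<inter> extensional (carrier M).
      \<forall>a\<in>carrier A. \<forall>m\<in>carrier M. f (act M a m) = act N a (f m)},
    mult = undefined,
    one = undefined,
    zero = (\<lambda>m\<in>carrier M. \<zero>\<^bsub>N\<^esub>),
    add = (\<lambda>f g. \<lambda>m\<in>carrier M. f m \<oplus>\<^bsub>N\<^esub> g m),
    smult = (\<lambda>c f. \<lambda>m\<in>carrier M. c \<odot>\<^bsub>N\<^esub> f m)\<rparr>"

definition superalgebra_hom ::
    "('a, 'x) superalgebra_scheme \<Rightarrow> ('b, 'y) superalgebra_scheme \<Rightarrow> ('a \<Rightarrow> 'b) set"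
  where "superalgebra_hom A B = {\<phi> \<in> Ring.ring_hom A B.
    (\<forall>c. \<forall>a\<in>carrier A. \<phi> (c \<odot>\<^bsub>A\<^esub> a) = c \<odot>\<^bsub>B\<^esub> \<phi> a) \<and>
    (\<forall>i. \<phi> ` part A i \<subseteq> part B i)}"

definition pullback :: "('a \<Rightarrow> 'b) \<Rightarrow> ('b, 'm) supermodule \<Rightarrow> ('a, 'm) supermodule"
  where "pullback \<phi> M = \<lparr>
    carrier = carrier M, mult = mult M, one = one M, zero = zero M, add = add M,
    smult = smult M,
    act = (\<lambda>a. act M (\<phi> a)),
    mpart = mpart M\<rparr>"

text \<open>
  The quotient by an ideal (if \<open>V\<close> is an algebra) or by a linear subspace (if \<open>V\<close> is a mere vector
  space): the ring \<^term>\<open>V Quot N\<close> of the library with the induced scalar multiplication added.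
\<close>

definition quot :: "(complex, 'v, 'x) module_scheme \<Rightarrow> 'v set \<Rightarrow> (complex, 'v set) module"
  where "quot V N = ring.extend (V Quot N)
    (module.fields (\<lambda>c X. \<Union>x\<in>X. N +>\<^bsub>V\<^esub> (c \<odot>\<^bsub>V\<^esub> x)))"

definition free_space :: "'k set \<Rightarrow> (complex, 'k \<Rightarrow>\<^sub>0 complex) module"
  where "free_space S = \<lparr>
    carrier = {p. Poly_Mapping.keys p \<subseteq> S},
    mult = undefined, one = undefined, zero = 0, add = (+),
    smult = (\<lambda>c. Poly_Mapping.map ((*) c))\<rparr>"

text \<open>The algebra of a submonoid \<open>S\<close> of the additively written monoid \<^typ>\<open>'k\<close>.\<close>

definition monoid_algebra :: "'k::monoid_add set \<Rightarrow> (complex, 'k \<Rightarrow>\<^sub>0 complex) module"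
  where "monoid_algebra S = \<lparr>
    carrier = {p. Poly_Mapping.keys p \<subseteq> S},
    mult = (*), one = 1, zero = 0, add = (+),
    smult = (\<lambda>c. Poly_Mapping.map ((*) c))\<rparr>"


section \<open>Superalgebras given by odd generators and relations\<close>

datatype word = Word (letters: "nat list")

instantiation word :: monoid_add
begin

definition zero_word :: word
  where "0 = Word []"

definition plus_word :: "word \<Rightarrow> word \<Rightarrow> word"
  where "v + w = Word (letters v @ letters w)"

instance
  by standard (simp_all add: zero_word_def plus_word_def)

end

type_synonym free = "word \<Rightarrow>\<^sub>0 complex"

definition letter :: "nat \<Rightarrow> free"
  where "letter i = Poly_Mapping.single (Word [i]) 1"

definition free_algebra :: "nat \<Rightarrow> (complex, free) module"
  where "free_algebra n = monoid_algebra {w. set (letters w) \<subseteq> {..<n}}"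

text \<open>
  The superalgebra with odd generators indexed by \<open>{..<n}\<close> and relators \<open>R\<close>.  (The relators used
  below are sums of words of even length, so that the parity is well defined.)
\<close>

definition presented :: "nat \<Rightarrow> free set \<Rightarrow> free set superalgebra"
  where "presented n R =
    (let F = free_algebra n; I = Idl\<^bsub>F\<^esub> R
     in module.extend (quot F I) (superalgebra.fields
       (\<lambda>i. {I +>\<^bsub>F\<^esub> p | p. p \<in> carrier F \<and>
          (\<forall>w\<in>Poly_Mapping.keys p. of_nat (length (letters w)) = i)})))"

definition generator :: "nat \<Rightarrow> free set \<Rightarrow> nat \<Rightarrow> free set"
  where "generator n R i = (Idl\<^bsub>free_algebra n\<^esub> R) +>\<^bsub>free_algebra n\<^esub> letter i"


section \<open>Exceptional Weyl groups\<close>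

datatype exceptional_type = G2 | F4 | E6 | E7 | E8

fun rank :: "exceptional_type \<Rightarrow> nat"
  where
    "rank G2 = 2"
  | "rank F4 = 4"
  | "rank E6 = 6"
  | "rank E7 = 7"
  | "rank E8 = 8"

text \<open>
  Bourbaki's numbering of the simple roots, shifted to start at 0.  The node sets \<open>{..<6}\<close>,
  \<open>{..<7}\<close> and \<open>{..<8}\<close> of the following diagram give \<open>E6\<close>, \<open>E7\<close> and \<open>E8\<close>.
\<close>

definition E_edges :: "(nat \<times> nat) set"
  where "E_edges = {(0, 2), (1, 3), (2, 3), (3, 4), (4, 5), (5, 6), (6, 7)}"

text \<open>
  \<open>cartan X i j\<close> is the value of the simple coroot \<open>i\<close> on the simple root \<open>j\<close>, that is,
  \<open>2 (\<alpha>\<^sub>i, \<alpha>\<^sub>j) / (\<alpha>\<^sub>i, \<alpha>\<^sub>i)\<close>.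
\<close>

fun cartan :: "exceptional_type \<Rightarrow> nat \<Rightarrow> nat \<Rightarrow> int"
  where
    "cartan G2 i j =
      (if i = j then 2 else if (i, j) = (0, 1) then -3 else if (i, j) = (1, 0) then -1 else 0)"
  | "cartan F4 i j =
      (if i = j then 2 else if (i, j) = (2, 1) then -2
       else if (i, j) \<in> {(0, 1), (1, 0), (1, 2), (2, 3), (3, 2)} then -1 else 0)"
  | "cartan _ i j =
      (if i = j then 2 else if (i, j) \<in> E_edges \<or> (j, i) \<in> E_edges then -1 else 0)"

definition coxeter_m :: "exceptional_type \<Rightarrow> nat \<Rightarrow> nat \<Rightarrow> nat"
  where "coxeter_m X i j =
    (if i = j then 1
     else if cartan X i j * cartan X j i = 0 then 2
     else if cartan X i j * cartan X j i = 1 then 3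
     else if cartan X i j * cartan X j i = 2 then 4
     else 6)"

text \<open>
  The reflection representation is the space of complex column vectors of length \<^term>\<open>rank X\<close>, its
  standard basis being the simple roots; the Weyl group is the group of matrices generated by the
  simple reflections \<open>s\<^sub>i \<alpha>\<^sub>j = \<alpha>\<^sub>j - cartan X i j \<alpha>\<^sub>i\<close>.
\<close>

definition simple_refl :: "exceptional_type \<Rightarrow> nat \<Rightarrow> complex mat"
  where "simple_refl X i = mat (rank X) (rank X)
    (\<lambda>(r, j). (if r = j then 1 else 0) - (if r = i then of_int (cartan X i j) else 0))"

definition weyl_group :: "exceptional_type \<Rightarrow> complex mat set"
  where "weyl_group X =
    generate (units_of (ring_mat TYPE(complex) (rank X) ())) (simple_refl X ` {..<rank X})"

definition is_reflection :: "nat \<Rightarrow> complex mat \<Rightarrow> bool"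
  where "is_reflection n w \<longleftrightarrow> w * w = 1\<^sub>m n \<and> kernel_dim (w - 1\<^sub>m n) = n - 1"

definition num_reflections :: "exceptional_type \<Rightarrow> nat"
  where "num_reflections X = card {w \<in> weyl_group X. is_reflection (rank X) w}"

text \<open>
  The invariant form is given by its Gram matrix with respect to the simple roots; the real span of
  the roots consists of the vectors with real coordinates.
\<close>

definition form :: "complex mat \<Rightarrow> complex vec \<Rightarrow> complex vec \<Rightarrow> complex"
  where "form b v w = v \<bullet> (b *\<^sub>v w)"

definition weyl_invariant_form :: "exceptional_type \<Rightarrow> complex mat \<Rightarrow> bool"
  where "weyl_invariant_form X b \<longleftrightarrow>
    b \<in> carrier_mat (rank X) (rank X) \<and>
    (\<forall>v\<in>carrier_vec (rank X). \<forall>w\<in>carrier_vec (rank X). form b v w = form b w v) \<and>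
    (\<forall>v\<in>carrier_vec (rank X).
      (\<forall>w\<in>carrier_vec (rank X). form b v w = 0) \<longrightarrow> v = 0\<^sub>v (rank X)) \<and>
    (\<forall>g\<in>weyl_group X. \<forall>v\<in>carrier_vec (rank X). \<forall>w\<in>carrier_vec (rank X).
      form b (g *\<^sub>v v) (g *\<^sub>v w) = form b v w) \<and>
    (\<forall>v\<in>carrier_vec (rank X). (\<forall>i<rank X. v $ i \<in> \<real>) \<and> v \<noteq> 0\<^sub>v (rank X) \<longrightarrow>
      form b v v \<in> \<real> \<and> Re (form b v v) > 0)"


section \<open>The spin Weyl group algebra, the Clifford algebra and the basic spin module\<close>

definition spin_relators :: "exceptional_type \<Rightarrow> free set"
  where "spin_relators X =
    {(letter i * letter j) ^ coxeter_m X i j - (- 1) ^ (coxeter_m X i j + 1) | i j.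
      i < rank X \<and> j < rank X}"

definition spin_algebra :: "exceptional_type \<Rightarrow> free set superalgebra"
  where "spin_algebra X = presented (rank X) (spin_relators X)"

definition spin_gen :: "exceptional_type \<Rightarrow> nat \<Rightarrow> free set"
  where "spin_gen X = generator (rank X) (spin_relators X)"

text \<open>
  The tensor algebra of the reflection representation is the free algebra on the simple roots.
\<close>

definition vec_to_free :: "complex vec \<Rightarrow> free"
  where "vec_to_free v = (\<Sum>i<dim_vec v. Poly_Mapping.single 0 (v $ i) * letter i)"

definition clifford_relators :: "exceptional_type \<Rightarrow> complex mat \<Rightarrow> free set"
  where "clifford_relators X b =
    {vec_to_free v * vec_to_free v - Poly_Mapping.single 0 (form b v v) | v.
      v \<in> carrier_vec (rank X)}"

definition clifford_algebra :: "exceptional_type \<Rightarrow> complex mat \<Rightarrow> free set superalgebra"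
  where "clifford_algebra X b = presented (rank X) (clifford_relators X b)"

definition clifford_root :: "exceptional_type \<Rightarrow> complex mat \<Rightarrow> nat \<Rightarrow> free set"
  where "clifford_root X b = generator (rank X) (clifford_relators X b)"

text \<open>
  \<open>B\<close> is a basic spin module if it is the pullback of a simple supermodule of the Clifford
  algebra (which is unique up to isomorphism) along the homomorphism \<open>\<phi>\<close> below (which is
  determined by its values on the generators).  As \<open>(\<alpha>\<^sub>i, \<alpha>\<^sub>i)\<close> is a positive real, \<^const>\<open>csqrt\<close> is its positive root.
\<close>

definition basic_spin_module ::
    "exceptional_type \<Rightarrow> complex mat \<Rightarrow> (free set, 'm) supermodule \<Rightarrow> bool"
  where "basic_spin_module X b B \<longleftrightarrow>
    (\<exists>\<phi> C. \<phi> \<in> superalgebra_hom (spin_algebra X) (clifford_algebra X b) \<and>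
      (\<forall>i<rank X. \<phi> (spin_gen X i) =
        (1 / csqrt (form b (unit_vec (rank X) i) (unit_vec (rank X) i)))
          \<odot>\<^bsub>clifford_algebra X b\<^esub> clifford_root X b i) \<and>
      simple_supermodule (clifford_algebra X b) C \<and>
      B = pullback \<phi> C)"


section \<open>The coinvariant algebra\<close>

text \<open>
  The symmetric algebra of the reflection representation is the polynomial algebra whose variables
  are the simple roots; monomials are exponent vectors.
\<close>

type_synonym mpoly = "(nat \<Rightarrow>\<^sub>0 nat) \<Rightarrow>\<^sub>0 complex"

definition sym_algebra :: "nat \<Rightarrow> (complex, mpoly) module"
  where "sym_algebra n = monoid_algebra {e. Poly_Mapping.keys e \<subseteq> {..<n}}"

definition sym_power :: "nat \<Rightarrow> nat \<Rightarrow> mpoly set"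
  where "sym_power n k = {p \<in> carrier (sym_algebra n).
    \<forall>e\<in>Poly_Mapping.keys p. (\<Sum>j\<in>Poly_Mapping.keys e. Poly_Mapping.lookup e j) = k}"

text \<open>The algebra endomorphism of the symmetric algebra that extends the linear map \<open>w\<close>.\<close>

definition sym_act :: "complex mat \<Rightarrow> mpoly \<Rightarrow> mpoly"
  where "sym_act w p = (\<Sum>e\<in>Poly_Mapping.keys p.
    Poly_Mapping.single 0 (Poly_Mapping.lookup p e) *
    (\<Prod>j\<in>Poly_Mapping.keys e.
      (\<Sum>i<dim_row w. Poly_Mapping.single (Poly_Mapping.single i 1) (w $$ (i, j)))
        ^ Poly_Mapping.lookup e j))"

definition coinvariant_ideal :: "exceptional_type \<Rightarrow> mpoly set"
  where "coinvariant_ideal X = Idl\<^bsub>sym_algebra (rank X)\<^esub>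
    {p. (\<exists>k>0. p \<in> sym_power (rank X) k) \<and> (\<forall>w\<in>weyl_group X. sym_act w p = p)}"

definition coinvariant_algebra :: "exceptional_type \<Rightarrow> (complex, mpoly set) module"
  where "coinvariant_algebra X = quot (sym_algebra (rank X)) (coinvariant_ideal X)"

definition coinvariant_part :: "exceptional_type \<Rightarrow> nat \<Rightarrow> (complex, mpoly set) module"
  where "coinvariant_part X k = (coinvariant_algebra X)
    \<lparr>carrier := {coinvariant_ideal X +>\<^bsub>sym_algebra (rank X)\<^esub> p | p. p \<in> sym_power (rank X) k}\<rparr>"

definition coinvariant_act :: "complex mat \<Rightarrow> mpoly set \<Rightarrow> mpoly set"
  where "coinvariant_act w Y = sym_act w ` Y"


section \<open>Tensor products and spin fake degrees\<close>

text \<open>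
  The pair \<open>(m, u)\<close>, as a basis vector of the free vector space on \<open>M \<times> U\<close>, becomes \<open>m \<otimes> u\<close> in the
  quotient by the relators.
\<close>

definition tensor_relators ::
    "(complex, 'm, 'x) module_scheme \<Rightarrow> (complex, 'u, 'y) module_scheme \<Rightarrow>
     ('m \<times> 'u \<Rightarrow>\<^sub>0 complex) set"
  where "tensor_relators M U =
    (let pure = (\<lambda>m u. Poly_Mapping.single (m, u) (1 :: complex))
     in {pure (m \<oplus>\<^bsub>M\<^esub> m') u - pure m u - pure m' u | m m' u.
          m \<in> carrier M \<and> m' \<in> carrier M \<and> u \<in> carrier U} \<union>
        {pure m (u \<oplus>\<^bsub>U\<^esub> u') - pure m u - pure m u' | m u u'.
          m \<in> carrier M \<and> u \<in> carrier U \<and> u' \<in> carrier U} \<union>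
        {pure (c \<odot>\<^bsub>M\<^esub> m) u - Poly_Mapping.single (m, u) c | c m u.
          m \<in> carrier M \<and> u \<in> carrier U} \<union>
        {pure m (c \<odot>\<^bsub>U\<^esub> u) - Poly_Mapping.single (m, u) c | c m u.
          m \<in> carrier M \<and> u \<in> carrier U})"

definition tensor_null ::
    "(complex, 'm, 'x) module_scheme \<Rightarrow> (complex, 'u, 'y) module_scheme \<Rightarrow>
     ('m \<times> 'u \<Rightarrow>\<^sub>0 complex) set"
  where "tensor_null M U =
    LinearCombinations.module.span \<C> (free_space (carrier M \<times> carrier U)) (tensor_relators M U)"

definition tensor_space ::
    "(complex, 'm, 'x) module_scheme \<Rightarrow> (complex, 'u, 'y) module_scheme \<Rightarrow>
     (complex, ('m \<times> 'u \<Rightarrow>\<^sub>0 complex) set) module"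
  where "tensor_space M U = quot (free_space (carrier M \<times> carrier U)) (tensor_null M U)"

text \<open>The linear map \<open>f \<otimes> g\<close> induced by linear endomorphisms \<open>f\<close> of \<open>M\<close> and \<open>g\<close> of \<open>U\<close>.\<close>

definition tensor_map ::
    "(complex, 'm, 'x) module_scheme \<Rightarrow> (complex, 'u, 'y) module_scheme \<Rightarrow>
     ('m \<Rightarrow> 'm) \<Rightarrow> ('u \<Rightarrow> 'u) \<Rightarrow>
     ('m \<times> 'u \<Rightarrow>\<^sub>0 complex) set \<Rightarrow> ('m \<times> 'u \<Rightarrow>\<^sub>0 complex) set"
  where "tensor_map M U f g Y = (\<Union>y\<in>Y. tensor_null M U
    +>\<^bsub>free_space (carrier M \<times> carrier U)\<^esub>
      (\<Sum>(m, u)\<in>Poly_Mapping.keys y. Poly_Mapping.single (f m, g u) (Poly_Mapping.lookup y (m, u))))"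

text \<open>
  If the operators \<open>T i\<close> on the vector space \<open>V\<close> satisfy the relations of a presented superalgebra,
  then \<open>presented_act V T\<close> is the resulting action on \<open>V\<close>: an element of the superalgebra is a coset
  of the free algebra, and all of its members act in the same way.
\<close>

definition presented_act ::
    "(complex, 'v, 'x) module_scheme \<Rightarrow> (nat \<Rightarrow> 'v \<Rightarrow> 'v) \<Rightarrow> free set \<Rightarrow> 'v \<Rightarrow> 'v"
  where "presented_act V T a v =
    (let p = (SOME p. p \<in> a)
     in \<Oplus>\<^bsub>V\<^esub>w\<in>Poly_Mapping.keys p.
          Poly_Mapping.lookup p w \<odot>\<^bsub>V\<^esub> foldr T (letters w) v)"

text \<open>
  The tensor product of a module \<open>M\<close> of the spin Weyl group algebra and a Weyl group module \<open>U\<close> on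
  which the group acts by \<open>\<rho>\<close>, with \<open>t\<^sub>i (m \<otimes> u) = t\<^sub>i m \<otimes> s\<^sub>i u\<close>.
\<close>

definition spin_tensor ::
    "exceptional_type \<Rightarrow> (free set, 'm, 'x) alg_module_scheme \<Rightarrow>
     (complex, 'u, 'y) module_scheme \<Rightarrow> (complex mat \<Rightarrow> 'u \<Rightarrow> 'u) \<Rightarrow>
     (free set, ('m \<times> 'u \<Rightarrow>\<^sub>0 complex) set) alg_module"
  where "spin_tensor X M U \<rho> = module.extend (tensor_space M U) (alg_module.fields
    (presented_act (tensor_space M U)
      (\<lambda>i. tensor_map M U (act M (spin_gen X i)) (\<rho> (simple_refl X i)))))"

definition spin_multiplicity ::
    "exceptional_type \<Rightarrow> (free set, 'm) supermodule \<Rightarrow> (free set, 'c) supermodule \<Rightarrow> nat \<Rightarrow> nat"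
  where "spin_multiplicity X B \<chi> k = vectorspace.dim \<C>
    (hom_space (spin_algebra X) \<chi> (spin_tensor X B (coinvariant_part X k) coinvariant_act))"

text \<open>
  \<^const>\<open>Abs_poly\<close> turns a coefficient sequence with finite support into a polynomial.
\<close>

definition spin_fake_degree ::
    "exceptional_type \<Rightarrow> (free set, 'm) supermodule \<Rightarrow> (free set, 'c) supermodule \<Rightarrow> complex poly"
  where "spin_fake_degree X B \<chi> = Abs_poly (\<lambda>k. of_nat (spin_multiplicity X B \<chi> k))"

end

theory Submission
  imports Defs
begin

text \<open>
  The coefficient of \<open>t\<^sup>k\<close> in the spin fake degree is the dimension of the space of all linear maps
  \<open>\<chi> \<rightarrow> B \<otimes> C\<^sub>k\<close> that commute with the spin algebra, where \<open>C\<^sub>k\<close> is the part of degree \<open>k\<close> of the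
  coinvariant algebra.  Two facts make the sequence of these dimensions symmetric about \<open>N / 2\<close>.

  \<^item> Poincare duality for the coinvariant algebra: \<open>C\<^sub>k = 0\<close> for \<open>k > N\<close>, and otherwise
    \<open>C\<^bsub>N - k\<^esub>\<close> is isomorphic to \<open>C\<^sub>k\<close> twisted by the sign character.
  \<^item> The generators \<open>t\<^sub>i\<close> are odd, so they anticommute with the parity involution of \<open>B\<close>.  Hence \<open>B\<close>
    is isomorphic to its own twist by the sign character (\<open>parity_involution\<close>).

  The two signs cancel in the tensor product (\<open>tensor_hom_intertwine\<close>), which yields an isomorphism
  \<open>B \<otimes> C\<^sub>k \<cong> B \<otimes> C\<^bsub>N - k\<^esub>\<close> of modules over the spin algebra, and therefore equal multiplicities.

  For the duality, let \<open>\<Delta>\<close> be the product of one root for each reflection; it has degree \<open>N\<close> and transforms under the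
  group by a character \<open>\<epsilon>\<close> with value \<open>-1\<close> on every reflection.  A polynomial that transforms by
  \<open>\<epsilon>\<close> is divisible by every root, hence by \<open>\<Delta>\<close>.  In particular the alternating sum
  \<open>\<Sum> \<epsilon>(w) w p\<close> is \<open>\<Delta> h\<close> for an invariant polynomial \<open>h\<close>; let \<open>\<phi>(p)\<close> be the constant term of \<open>h\<close>.
  The pairing \<open>(p, q) \<mapsto> \<phi>(p q)\<close> is concentrated in total degree \<open>N\<close> and changes by \<open>\<epsilon>\<close> under the
  group.  Its radical is precisely the ideal of the coinvariant algebra
  (\<open>inv_ideal_iff_socle_form\<close>).  The ideal lies in the radical because invariants can be pulled out of
  alternating sums.  Conversely, let \<open>p\<close> be in the radical.  By descending induction on the order,
  \<open>x p\<close> lies in the ideal for each simple root \<open>x\<close>; applying the simple reflection and dividing by \<open>x\<close>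
  shows that \<open>p + s p\<close> lies in it as well.  So modulo the ideal \<open>p\<close> transforms by \<open>\<epsilon>\<close>, and is
  therefore congruent to a multiple of its alternating sum \<open>\<Delta> h\<close>, which is in the ideal as
  \<open>\<phi>(p) = 0\<close>.

  The pairing identifies \<open>C\<^bsub>N - k\<^esub>\<close> with the twisted dual of \<open>C\<^sub>k\<close>.  To remove the dual, the group
  acts by real matrices: \<open>p \<mapsto> \<Sum> \<phi>(p z) z\<close>, with \<open>z\<close> ranging over the conjugates of the monomials of
  degree \<open>N - k\<close>, is a map from degree \<open>k\<close> to degree \<open>N - k\<close> that reflects the ideal, as pairing its
  complex conjugate with \<open>p\<close> gives a sum of squares of absolute values (\<open>duality_inv_ideal_iff\<close>).
\<close>

abbreviation "lookup \<equiv> Poly_Mapping.lookup"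
abbreviation "keys \<equiv> Poly_Mapping.keys"
abbreviation "single \<equiv> Poly_Mapping.single"

section \<open>Polynomials, substitution and grading\<close>

abbreviation pol_const :: "complex \<Rightarrow> mpoly"
  where "pol_const c \<equiv> single 0 c"

lemma pol_const_mult: "pol_const c * (pol_const d * p) = pol_const (c * d) * p"
  by (simp add: mult.assoc[symmetric] mult_single)

lemma pol_const_sum: "pol_const (sum g A) = (\<Sum>i\<in>A. pol_const (g i))"
  by (induction A rule: infinite_finite_induct) (simp_all add: single_add)

definition pol_var :: "nat \<Rightarrow> mpoly"
  where "pol_var i = single (single i 1) 1"

lemma sum_singles: "(p :: 'a \<Rightarrow>\<^sub>0 'b::comm_monoid_add) = (\<Sum>e\<in>keys p. single e (lookup p e))"
  by (rule poly_mapping_eqI)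
     (simp add: lookup_sum lookup_single when_def in_keys_iff if_distrib sum.delta cong: if_cong)

lemma single_induct [case_names zero add single]:
  fixes p :: "'a \<Rightarrow>\<^sub>0 'b::comm_monoid_add"
  assumes "P 0" "\<And>p q. P p \<Longrightarrow> P q \<Longrightarrow> P (p + q)" "\<And>e c. P (single e c)"
  shows "P p"
proof -
  have "P (\<Sum>e\<in>A. single e (lookup p e))" if "finite A" for A
    using that by (induction A) (auto intro: assms)
  then show ?thesis
    by (subst sum_singles) auto
qed

text \<open>
  The group acts on polynomials by substituting linear forms for the variables.  That substitution
  respects products does not depend on what is substituted.
\<close>

definition monomial_value :: "(nat \<Rightarrow> mpoly) \<Rightarrow> (nat \<Rightarrow>\<^sub>0 nat) \<Rightarrow> mpoly"
  where "monomial_value L e = (\<Prod>j\<in>keys e. L j ^ lookup e j)"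

definition substitute :: "(nat \<Rightarrow> mpoly) \<Rightarrow> mpoly \<Rightarrow> mpoly"
  where "substitute L p = (\<Sum>e\<in>keys p. pol_const (lookup p e) * monomial_value L e)"

lemma monomial_value_superset:
  assumes "finite A" "keys e \<subseteq> A"
  shows "monomial_value L e = (\<Prod>j\<in>A. L j ^ lookup e j)"
  unfolding monomial_value_def
  by (rule prod.mono_neutral_left) (use assms in \<open>auto simp: in_keys_iff\<close>)

lemma monomial_value_add: "monomial_value L (e + f) = monomial_value L e * monomial_value L f"
proof -
  have "keys (e + f) \<subseteq> keys e \<union> keys f"
    by (rule keys_add)
  then show ?thesis
    by (simp add: monomial_value_superset[of "keys e \<union> keys f"] lookup_add power_add prod.distrib)
qed

lemma substitute_superset:
  assumes "finite A" "keys p \<subseteq> A"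
  shows "substitute L p = (\<Sum>e\<in>A. pol_const (lookup p e) * monomial_value L e)"
  unfolding substitute_def
  by (rule sum.mono_neutral_left) (use assms in \<open>auto simp: in_keys_iff\<close>)

lemma substitute_add: "substitute L (p + q) = substitute L p + substitute L q"
proof -
  have "keys (p + q) \<subseteq> keys p \<union> keys q"
    by (rule keys_add)
  then show ?thesis
    by (simp add: substitute_superset[of "keys p \<union> keys q"] lookup_add single_add
        distrib_right sum.distrib)
qed

lemma substitute_zero [simp]: "substitute L 0 = 0"
  by (simp add: substitute_def)

lemma substitute_single: "substitute L (single e c) = pol_const c * monomial_value L e"
  by (cases "c = 0") (simp_all add: substitute_def)

lemma substitute_mult: "substitute L (p * q) = substitute L p * substitute L q"
proof (induction p rule: single_induct)
  case (single e c)
  show ?case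
  proof (induction q rule: single_induct)
    case (single f d)
    have "pol_const (c * d) = pol_const c * pol_const d"
      by (simp add: mult_single)
    then show ?case
      by (simp add: mult_single substitute_single monomial_value_add algebra_simps)
  qed (simp_all add: distrib_left substitute_add)
qed (simp_all add: distrib_right substitute_add)

lemma substitute_const [simp]: "substitute L (pol_const c) = pol_const c"
  by (simp add: substitute_single monomial_value_def)

lemma substitute_var [simp]: "substitute L (pol_var i) = L i"
  by (simp add: pol_var_def substitute_single monomial_value_def)

lemma sym_act_substitute:
  "sym_act w = substitute (\<lambda>j. \<Sum>i<dim_row w. pol_const (w $$ (i, j)) * pol_var i)"
  by (simp add: fun_eq_iff sym_act_def substitute_def monomial_value_def pol_var_def mult_single)

lemma sym_act_add: "sym_act w (p + q) = sym_act w p + sym_act w q"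
  and sym_act_mult: "sym_act w (p * q) = sym_act w p * sym_act w q"
  and sym_act_const [simp]: "sym_act w (pol_const c) = pol_const c"
  and sym_act_var: "sym_act w (pol_var j) = (\<Sum>i<dim_row w. pol_const (w $$ (i, j)) * pol_var i)"
  and sym_act_zero [simp]: "sym_act w 0 = 0"
  by (simp_all add: sym_act_substitute substitute_add substitute_mult)

lemma sym_act_one [simp]: "sym_act w 1 = 1"
  using sym_act_const[of w 1] by simp

lemma sym_act_uminus: "sym_act w (- p) = - sym_act w p"
  using sym_act_add[of w p "- p"] by (simp add: eq_neg_iff_add_eq_0 add.commute)

lemma sym_act_diff: "sym_act w (p - q) = sym_act w p - sym_act w q"
  using sym_act_add[of w p "- q"] by (simp add: sym_act_uminus)

lemma sym_act_sum: "sym_act w (sum f A) = (\<Sum>i\<in>A. sym_act w (f i))"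
  by (induction A rule: infinite_finite_induct) (simp_all add: sym_act_add)

lemma sym_act_prod: "sym_act w (prod f A) = (\<Prod>i\<in>A. sym_act w (f i))"
  by (induction A rule: infinite_finite_induct) (simp_all add: sym_act_mult)

lemma sym_act_power: "sym_act w (p ^ k) = sym_act w p ^ k"
  by (induction k) (simp_all add: sym_act_mult)

lemma sym_act_scale: "sym_act w (pol_const c * p) = pol_const c * sym_act w p"
  by (simp add: sym_act_mult)

abbreviation Pol :: "nat \<Rightarrow> mpoly set"
  where "Pol n \<equiv> carrier (sym_algebra n)"

lemma Pol_iff: "p \<in> Pol n \<longleftrightarrow> (\<forall>e\<in>keys p. keys e \<subseteq> {..<n})"
  by (auto simp: sym_algebra_def monoid_algebra_def)

lemma Pol_zero [simp, intro]: "0 \<in> Pol n"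
  by (simp add: Pol_iff)

lemma Pol_one [simp, intro]: "1 \<in> Pol n"
  by (simp add: Pol_iff)

lemma Pol_const [simp, intro]: "pol_const c \<in> Pol n"
  by (simp add: Pol_iff)

lemma Pol_single: "keys e \<subseteq> {..<n} \<Longrightarrow> single e c \<in> Pol n"
  by (simp add: Pol_iff)

lemma Pol_var [simp]: "i < n \<Longrightarrow> pol_var i \<in> Pol n"
  by (simp add: Pol_iff pol_var_def)

lemma Pol_add [intro]: "p \<in> Pol n \<Longrightarrow> q \<in> Pol n \<Longrightarrow> p + q \<in> Pol n"
  using keys_add[of p q] by (auto simp: Pol_iff)

lemma Pol_mult [intro]: 
  assumes "p \<in> Pol n" "q \<in> Pol n"
  shows "p * q \<in> Pol n"
  unfolding Pol_iff
proof
  fix e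
  assume "e \<in> keys (p * q)"
  then obtain f g where "f \<in> keys p" "g \<in> keys q" "e = f + g"
    using keys_mult[of p q] by blast
  then show "keys e \<subseteq> {..<n}"
    using assms keys_add[of f g] unfolding Pol_iff by blast
qed

lemma Pol_uminus [intro]: "p \<in> Pol n \<Longrightarrow> - p \<in> Pol n"
  by (auto simp: Pol_iff in_keys_iff)

lemma Pol_diff [intro]: "p \<in> Pol n \<Longrightarrow> q \<in> Pol n \<Longrightarrow> p - q \<in> Pol n"
  using Pol_add[OF _ Pol_uminus] by fastforce

lemma Pol_sum [intro]: "(\<And>i. i \<in> A \<Longrightarrow> f i \<in> Pol n) \<Longrightarrow> sum f A \<in> Pol n"
  by (induction A rule: infinite_finite_induct) auto

lemma Pol_prod [intro]: "(\<And>i. i \<in> A \<Longrightarrow> f i \<in> Pol n) \<Longrightarrow> prod f A \<in> Pol n"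
  by (induction A rule: infinite_finite_induct) auto

lemma Pol_power [intro]: "p \<in> Pol n \<Longrightarrow> p ^ k \<in> Pol n"
  by (induction k) auto

lemma monomial_value_var: "monomial_value pol_var e = single e 1"
proof -
  have pow: "pol_var j ^ k = single (single j k) 1" for j k
    by (induction k) (simp_all add: pol_var_def mult_single single_add[symmetric])
  have "(\<Prod>j\<in>A. single (f j) (1::complex)) = single (\<Sum>j\<in>A. f j) 1"
    if "finite A" for A :: "nat set" and f :: "nat \<Rightarrow> (nat \<Rightarrow>\<^sub>0 nat)"
    using that by (induction A) (simp_all add: mult_single)
  then show ?thesis
    by (subst (2) sum_singles) (simp add: monomial_value_def pow)
qed

lemma single_as_monomial: "single e c = pol_const c * (\<Prod>j\<in>keys e. pol_var j ^ lookup e j)"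
  using monomial_value_var[of e] by (simp add: monomial_value_def mult_single)

text \<open>
  The symmetric algebra is generated by its variables, so identities between compositions of algebra
  endomorphisms only have to be checked on the variables.
\<close>

lemma Pol_induct [consumes 1, case_names const var add mult]:
  assumes p: "p \<in> Pol n"
    and const: "\<And>c. P (pol_const c)"
    and var: "\<And>i. i < n \<Longrightarrow> P (pol_var i)"
    and add: "\<And>p q. p \<in> Pol n \<Longrightarrow> q \<in> Pol n \<Longrightarrow> P p \<Longrightarrow> P q \<Longrightarrow> P (p + q)"
    and mult: "\<And>p q. p \<in> Pol n \<Longrightarrow> q \<in> Pol n \<Longrightarrow> P p \<Longrightarrow> P q \<Longrightarrow> P (p * q)"
  shows "P p"
proof -
  have pow: "P (pol_var i ^ k)" if "i < n" for i k
  proof (induction k)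
    case 0 
    show ?case using const[of 1] by simp
  next
    case (Suc k)
    show ?case
      unfolding power_Suc by (intro mult var Suc that Pol_var Pol_power)
  qed
  have prod: "P (\<Prod>j\<in>A. pol_var j ^ f j)" if "finite A" "A \<subseteq> {..<n}" for A f
    using that
  proof (induction A)
    case empty
    show ?case using const[of 1] by simp
  next
    case (insert j A)
    have "(\<Prod>j\<in>A. pol_var j ^ f j) \<in> Pol n"
      using insert by (intro Pol_prod Pol_power Pol_var) auto
    moreover have "pol_var j ^ f j \<in> Pol n"
      using insert by (intro Pol_power Pol_var) auto
    ultimately show ?case
      using insert pow mult by simp
  qed
  have single: "P (single e c)" if "keys e \<subseteq> {..<n}" for e c
  proof (subst single_as_monomial, rule mult)
    show "(\<Prod>j\<in>keys e. pol_var j ^ lookup e j) \<in> Pol n"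
      using that by (intro Pol_prod Pol_power Pol_var) auto
    show "P (\<Prod>j\<in>keys e. pol_var j ^ lookup e j)"
      by (rule prod) (use that in auto)
  qed (auto intro: const)
  have "P (\<Sum>e\<in>A. single e (lookup p e))" if "finite A" "A \<subseteq> keys p" for A
    using that
  proof (induction A)
    case empty
    show ?case using const[of 0] by simp
  next
    case (insert e A)
    have "(\<Sum>e\<in>A. single e (lookup p e)) \<in> Pol n" "single e (lookup p e) \<in> Pol n"
      using insert p by (auto simp: Pol_iff[of p] intro!: Pol_sum Pol_single)
    with insert p show ?case
      by (auto simp: Pol_iff[of p] intro!: add single)
  qed
  then show ?thesis
    by (subst sum_singles) auto
qed

lemma sym_act_Pol:
  assumes "dim_row w = n"
  shows "sym_act w p \<in> Pol n"
proof (induction p rule: single_induct)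
  case (single e c)
  have "(\<Prod>j\<in>keys e. (sym_act w (pol_var j)) ^ lookup e j) \<in> Pol n"
    by (intro Pol_prod Pol_power) (auto simp: assms sym_act_var intro!: Pol_sum Pol_mult)
  then show ?case
    by (subst single_as_monomial) (auto simp: sym_act_mult sym_act_prod sym_act_power)
qed (auto simp: sym_act_add)

lemma sym_act_compose:
  assumes w: "w \<in> carrier_mat n n" and v: "v \<in> carrier_mat n n" and p: "p \<in> Pol n"
  shows "sym_act (w * v) p = sym_act w (sym_act v p)"
  using p
proof (induction p rule: Pol_induct)
  case (var j)
  have entry: "pol_const ((w * v) $$ (k, j)) =
      (\<Sum>i<n. pol_const (w $$ (k, i)) * pol_const (v $$ (i, j)))" if "k < n" for k
  proof -
    have "(w * v) $$ (k, j) = (\<Sum>i<n. w $$ (k, i) * v $$ (i, j))"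
      using w v var that by (simp add: scalar_prod_def lessThan_atLeast0)
    then show ?thesis
      by (simp add: mult_single pol_const_sum)
  qed
  have "sym_act (w * v) (pol_var j) =
      (\<Sum>k<n. \<Sum>i<n. pol_const (w $$ (k, i)) * pol_const (v $$ (i, j)) * pol_var k)"
    using w by (simp add: sym_act_var entry sum_distrib_right)
  also have "\<dots> = (\<Sum>i<n. pol_const (v $$ (i, j)) * sym_act w (pol_var i))"
    unfolding sym_act_var sum_distrib_left using w
    by (subst sum.swap) (simp add: algebra_simps)
  also have "\<dots> = sym_act w (sym_act v (pol_var j))"
    using v by (simp add: sym_act_var[of v] sym_act_sum sym_act_scale)
  finally show ?case .
qed (simp_all add: sym_act_add sym_act_mult)

lemma sym_act_1:
  assumes "p \<in> Pol n"
  shows "sym_act (1\<^sub>m n) p = p"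
  using assms
proof (induction p rule: Pol_induct)
  case (var j)
  have "sym_act (1\<^sub>m n) (pol_var j) = (\<Sum>i<n. if i = j then pol_var j else 0)"
    unfolding sym_act_var using var by (intro sum.cong) auto
  then show ?case
    using var by (simp add: sum.delta)
qed (simp_all add: sym_act_add sym_act_mult)


subsection \<open>Degrees\<close>

definition mdeg :: "(nat \<Rightarrow>\<^sub>0 nat) \<Rightarrow> nat"
  where "mdeg e = (\<Sum>j\<in>keys e. lookup e j)"

lemma mdeg_superset: "finite A \<Longrightarrow> keys e \<subseteq> A \<Longrightarrow> mdeg e = (\<Sum>j\<in>A. lookup e j)"
  unfolding mdeg_def by (rule sum.mono_neutral_left) (auto simp: in_keys_iff)

lemma mdeg_add: "mdeg (e + f) = mdeg e + mdeg f"
proof -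
  have "keys (e + f) \<subseteq> keys e \<union> keys f"
    by (rule keys_add)
  then show ?thesis
    by (simp add: mdeg_superset[of "keys e \<union> keys f"] lookup_add sum.distrib)
qed

lemma mdeg_zero [simp]: "mdeg 0 = 0"
  by (simp add: mdeg_def)

lemma mdeg_single [simp]: "mdeg (single i k) = k"
  by (cases "k = 0") (simp_all add: mdeg_def)

lemma mdeg_eq_0_iff: "mdeg e = 0 \<longleftrightarrow> e = 0"
proof
  assume "mdeg e = 0"
  then have "lookup e j = 0" for j
    by (cases "j \<in> keys e") (auto simp: mdeg_def in_keys_iff)
  then show "e = 0"
    by (intro poly_mapping_eqI) simp
qed simp

lemma sym_power_iff: "p \<in> sym_power n k \<longleftrightarrow> p \<in> Pol n \<and> (\<forall>e\<in>keys p. mdeg e = k)"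
  by (simp add: sym_power_def mdeg_def)

lemma sym_power_Pol: "p \<in> sym_power n k \<Longrightarrow> p \<in> Pol n"
  by (simp add: sym_power_iff)

lemma sym_power_zero [simp, intro]: "0 \<in> sym_power n k"
  by (simp add: sym_power_iff)

lemma sym_power_const [simp, intro]: "pol_const c \<in> sym_power n 0"
  by (simp add: sym_power_iff)

lemma sym_power_one [simp, intro]: "1 \<in> sym_power n 0"
  by (simp add: sym_power_iff)

lemma sym_power_single: "keys e \<subseteq> {..<n} \<Longrightarrow> single e c \<in> sym_power n (mdeg e)"
  by (simp add: sym_power_iff Pol_single)

lemma sym_power_var: "i < n \<Longrightarrow> pol_var i \<in> sym_power n 1"
  using sym_power_single[of "single i 1" n 1] by (simp add: pol_var_def)

lemma sym_power_add [intro]: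
  "p \<in> sym_power n k \<Longrightarrow> q \<in> sym_power n k \<Longrightarrow> p + q \<in> sym_power n k"
  using keys_add[of p q] by (auto simp: sym_power_iff)

lemma sym_power_mult [intro]:
  assumes "p \<in> sym_power n k" "q \<in> sym_power n l"
  shows "p * q \<in> sym_power n (k + l)"
  using assms keys_mult[of p q] by (fastforce simp: sym_power_iff mdeg_add)

lemma sym_power_uminus [intro]: "p \<in> sym_power n k \<Longrightarrow> - p \<in> sym_power n k"
  by (auto simp: sym_power_iff in_keys_iff)

lemma sym_power_scale [intro]: "p \<in> sym_power n k \<Longrightarrow> pol_const c * p \<in> sym_power n k"
  using sym_power_mult[of "pol_const c" n 0 p k] by simp

lemma sym_power_sum [intro]: "(\<And>i. i \<in> A \<Longrightarrow> f i \<in> sym_power n k) \<Longrightarrow> sum f A \<in> sym_power n k"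
  by (induction A rule: infinite_finite_induct) auto

lemma sym_power_prod:
  "(\<And>i. i \<in> A \<Longrightarrow> f i \<in> sym_power n (g i)) \<Longrightarrow> prod f A \<in> sym_power n (sum g A)"
  by (induction A rule: infinite_finite_induct) auto

lemma sym_power_power: "p \<in> sym_power n k \<Longrightarrow> p ^ l \<in> sym_power n (l * k)"
  by (induction l) auto

lemma sym_act_var_degree: "dim_row w = n \<Longrightarrow> sym_act w (pol_var j) \<in> sym_power n 1"
  unfolding sym_act_var by (auto intro!: sym_power_sum sym_power_scale sym_power_var[unfolded One_nat_def])

lemma sym_act_degree:
  assumes w: "dim_row w = n" and p: "p \<in> sym_power n k"
  shows "sym_act w p \<in> sym_power n k"
proof -
  have single: "sym_act w (single e c) \<in> sym_power n (mdeg e)" for e c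
  proof -
    have "(\<Prod>j\<in>keys e. (sym_act w (pol_var j)) ^ lookup e j)
      \<in> sym_power n (\<Sum>j\<in>keys e. lookup e j * 1)"
      by (intro sym_power_prod sym_power_power sym_act_var_degree w)
    then show ?thesis
      by (subst single_as_monomial)
         (auto simp: sym_act_mult sym_act_prod sym_act_power mdeg_def intro!: sym_power_scale)
  qed
  have "sym_act w p = (\<Sum>e\<in>keys p. sym_act w (single e (lookup p e)))"
    by (subst sum_singles) (rule sym_act_sum)
  moreover have "sym_act w (single e (lookup p e)) \<in> sym_power n k" if "e \<in> keys p" for e
    using single[of e] that p by (auto simp: sym_power_iff[of p])
  ultimately show ?thesis
    by auto
qed

definition homog :: "nat \<Rightarrow> mpoly \<Rightarrow> mpoly"
  where "homog k p = Poly_Mapping.mapp (\<lambda>e c. if mdeg e = k then c else 0) p"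

lemma lookup_homog: "lookup (homog k p) e = (if mdeg e = k then lookup p e else 0)"
  by (simp add: homog_def lookup_mapp when_def in_keys_iff)

lemma homog_add: "homog k (p + q) = homog k p + homog k q"
  by (rule poly_mapping_eqI) (simp add: lookup_homog lookup_add)

lemma homog_zero [simp]: "homog k 0 = 0"
  by (rule poly_mapping_eqI) (simp add: lookup_homog)

lemma homog_sum: "homog k (sum f A) = (\<Sum>i\<in>A. homog k (f i))"
  by (induction A rule: infinite_finite_induct) (simp_all add: homog_add)

lemma homog_0: "homog 0 p = pol_const (lookup p 0)"
  by (rule poly_mapping_eqI) (simp add: lookup_homog lookup_single when_def mdeg_eq_0_iff)

lemma homog_sym_power:
  assumes "p \<in> Pol n"
  shows "homog k p \<in> sym_power n k"
  using assms by (auto simp: sym_power_iff Pol_iff in_keys_iff lookup_homog split: if_splits)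

lemma homog_of_sym_power:
  assumes "p \<in> sym_power n l"
  shows "homog k p = (if k = l then p else 0)"
  by (rule poly_mapping_eqI) (use assms in \<open>auto simp: sym_power_iff in_keys_iff lookup_homog\<close>)

text \<open>
  The bound \<open>D\<close> comes with the vanishing of the components beyond it, so that a component of an
  arbitrary degree can be extracted from the finite sum.
\<close>

lemma sum_homog:
  obtains D where "p = (\<Sum>d<D. homog d p)" "\<And>d. d \<ge> D \<Longrightarrow> homog d p = 0"
proof -
  define D where "D = Suc (Max (insert 0 (mdeg ` keys p)))"
  have D: "mdeg e < D" if "e \<in> keys p" for e
    unfolding D_def using that by (auto intro!: le_imp_less_Suc Max_ge)
  have "p = (\<Sum>d<D. homog d p)"
    by (rule poly_mapping_eqI)
       (use D in \<open>force simp: lookup_sum lookup_homog sum.delta' in_keys_iff\<close>)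
  moreover have "homog d p = 0" if "d \<ge> D" for d
    by (rule poly_mapping_eqI) (use D that in \<open>force simp: lookup_homog in_keys_iff\<close>)
  ultimately show ?thesis
    by (rule that)
qed

text \<open>
  Multiplication by a homogeneous polynomial shifts the decomposition into components, which is
  unique.
\<close>

lemma homog_mult:
  assumes a: "a \<in> sym_power n m" and p: "p \<in> Pol n"
  shows "homog (m + d) (a * p) = a * homog d p"
    and "k < m \<Longrightarrow> homog k (a * p) = 0"
proof -
  obtain D where D: "p = (\<Sum>d<D. homog d p)" "\<And>d. d \<ge> D \<Longrightarrow> homog d p = 0"
    by (rule sum_homog[of p]) blast
  have *: "homog k (a * homog i p) = (if k = m + i then a * homog i p else 0)" for k i
    by (rule homog_of_sym_power[of _ n]) (intro sym_power_mult a homog_sym_power p)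
  have **: "homog k (a * p) = (\<Sum>i<D. if k = m + i then a * homog i p else 0)" for k
    by (subst D(1)) (simp add: sum_distrib_left homog_sum *)
  have "homog (m + d) (a * p) = (\<Sum>i<D. if i = d then a * homog i p else 0)"
    unfolding ** by (intro sum.cong) auto
  also have "\<dots> = a * homog d p"
    using D(2)[of d] by (simp add: sum.delta)
  finally show "homog (m + d) (a * p) = a * homog d p" .
  show "homog k (a * p) = 0" if "k < m"
    unfolding ** using that by (intro sum.neutral) auto
qed

lemma homog_sym_act:
  assumes w: "dim_row w = n" and p: "p \<in> Pol n"
  shows "homog k (sym_act w p) = sym_act w (homog k p)"
proof -
  obtain D where D: "p = (\<Sum>d<D. homog d p)" "\<And>d. d \<ge> D \<Longrightarrow> homog d p = 0"
    by (rule sum_homog[of p]) blast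
  have *: "homog k (sym_act w (homog i p)) = (if k = i then sym_act w (homog i p) else 0)" for i
    by (rule homog_of_sym_power[of _ n]) (intro sym_act_degree w homog_sym_power p)
  have "homog k (sym_act w p) = (\<Sum>i<D. if k = i then sym_act w (homog i p) else 0)"
    by (subst D(1)) (simp add: sym_act_sum homog_sum *)
  also have "\<dots> = sym_act w (homog k p)"
    using D(2)[of k] by (simp add: sum.delta')
  finally show ?thesis .
qed

lemma lookup_mult_0: "lookup (p * q) 0 = lookup p 0 * lookup (q :: mpoly) 0"
proof (induction p rule: single_induct)
  case (single e c)
  show ?case
  proof (induction q rule: single_induct)
    case (single f d)
    have "e + f = 0 \<longleftrightarrow> e = 0 \<and> f = 0"
      by (metis mdeg_add mdeg_eq_0_iff add_is_0)
    then show ?case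
      by (auto simp: mult_single lookup_single when_def)
  qed (simp_all add: distrib_left lookup_add)
qed (simp_all add: distrib_right lookup_add)


subsection \<open>Complex conjugation of coefficients\<close>

text \<open>
  The Weyl group acts by real matrices, so its action commutes with this conjugation.  The real
  structure is the reason why the pieces of the coinvariant algebra are self-dual.
\<close>

definition pol_cnj :: "mpoly \<Rightarrow> mpoly"
  where "pol_cnj = Poly_Mapping.map cnj"

lemma lookup_pol_cnj: "lookup (pol_cnj p) e = cnj (lookup p e)"
  by (simp add: pol_cnj_def Poly_Mapping.map.rep_eq when_def)

lemma pol_cnj_add: "pol_cnj (p + q) = pol_cnj p + pol_cnj q"
  by (rule poly_mapping_eqI) (simp add: lookup_pol_cnj lookup_add)

lemma pol_cnj_zero [simp]: "pol_cnj 0 = 0"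
  by (rule poly_mapping_eqI) (simp add: lookup_pol_cnj)

lemma pol_cnj_single [simp]: "pol_cnj (single e c) = single e (cnj c)"
  by (rule poly_mapping_eqI) (simp add: lookup_pol_cnj lookup_single when_def)

lemma pol_cnj_var [simp]: "pol_cnj (pol_var i) = pol_var i"
  by (simp add: pol_var_def)

lemma pol_cnj_mult: "pol_cnj (p * q) = pol_cnj p * pol_cnj q"
proof (induction p rule: single_induct)
  case (single e c)
  show ?case
    by (induction q rule: single_induct) (simp_all add: mult_single distrib_left pol_cnj_add)
qed (simp_all add: distrib_right pol_cnj_add)

lemma pol_cnj_sum: "pol_cnj (sum f A) = (\<Sum>i\<in>A. pol_cnj (f i))"
  by (induction A rule: infinite_finite_induct) (simp_all add: pol_cnj_add)

lemma keys_pol_cnj [simp]: "keys (pol_cnj p) = keys p"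
  by (auto simp: in_keys_iff lookup_pol_cnj)

lemma pol_cnj_Pol [simp]: "pol_cnj p \<in> Pol n \<longleftrightarrow> p \<in> Pol n"
  by (simp add: Pol_iff)

lemma pol_cnj_sym_power [simp]: "pol_cnj p \<in> sym_power n k \<longleftrightarrow> p \<in> sym_power n k"
  by (simp add: sym_power_iff)

lemma pol_cnj_sym_act:
  assumes w: "dim_row w = n" and real: "\<And>i j. i < n \<Longrightarrow> j < n \<Longrightarrow> w $$ (i, j) \<in> \<real>"
    and p: "p \<in> Pol n"
  shows "pol_cnj (sym_act w p) = sym_act w (pol_cnj p)"
  using p
proof (induction p rule: Pol_induct)
  case (var j)
  then show ?case
    using real by (simp add: sym_act_var pol_cnj_sum pol_cnj_mult w Reals_cnj_iff)
qed (simp_all add: sym_act_add sym_act_mult pol_cnj_add pol_cnj_mult)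


section \<open>Linear maps of rank one\<close>

lemma dim_eq_1_iff:
  assumes W: "vectorspace \<C> W" and fd: "vectorspace.fin_dim \<C> W"
  shows "vectorspace.dim \<C> W = 1 \<longleftrightarrow>
    (\<exists>a\<in>carrier W. a \<noteq> \<zero>\<^bsub>W\<^esub> \<and> (\<forall>v\<in>carrier W. \<exists>c. v = c \<odot>\<^bsub>W\<^esub> a))"
proof -
  interpret vectorspace \<C> W by (rule W)
  have lincomb: "lincomb f {a} = f a \<odot>\<^bsub>W\<^esub> a" if "a \<in> carrier W" for f a
    using that by (simp add: lincomb_def)
  have span: "span {a} = {c \<odot>\<^bsub>W\<^esub> a | c. True}" if "a \<in> carrier W" for a
    using that finite_span[of "{a}"] lincomb[OF that] by (auto intro: exI[of _ "\<lambda>_. _"])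
  show ?thesis
  proof
    assume "dim = 1"
    obtain A where A: "finite A" "basis A"
      using finite_basis_exists[OF fd] by blast
    with \<open>dim = 1\<close> have "card A = 1"
      using dim_basis by simp
    then obtain a where a: "A = {a}"
      by (rule card_1_singletonE)
    then have "a \<in> carrier W" "a \<noteq> \<zero>\<^bsub>W\<^esub>" "span {a} = carrier W"
      using A vs_zero_lin_dep[of A] by (auto simp: basis_def)
    then show "\<exists>a\<in>carrier W. a \<noteq> \<zero>\<^bsub>W\<^esub> \<and> (\<forall>v\<in>carrier W. \<exists>c. v = c \<odot>\<^bsub>W\<^esub> a)"
      using span by fastforce
  next
    assume "\<exists>a\<in>carrier W. a \<noteq> \<zero>\<^bsub>W\<^esub> \<and> (\<forall>v\<in>carrier W. \<exists>c. v = c \<odot>\<^bsub>W\<^esub> a)"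
    then obtain a where a: "a \<in> carrier W" "a \<noteq> \<zero>\<^bsub>W\<^esub>" "\<And>v. v \<in> carrier W \<Longrightarrow> \<exists>c. v = c \<odot>\<^bsub>W\<^esub> a"
      by blast
    have "lin_indpt {a}"
    proof (rule finite_lin_indpt2)
      fix f :: "'a \<Rightarrow> complex"
      assume "lincomb f {a} = \<zero>\<^bsub>W\<^esub>"
      then have f: "f a \<odot>\<^bsub>W\<^esub> a = \<zero>\<^bsub>W\<^esub>"
        using lincomb a by simp
      have "f a = 0"
      proof (rule ccontr)
        assume "f a \<noteq> 0"
        then have "a = (inverse (f a) * f a) \<odot>\<^bsub>W\<^esub> a"
          using a smult_one[of a] by simp
        also have "\<dots> = inverse (f a) \<odot>\<^bsub>W\<^esub> (f a \<odot>\<^bsub>W\<^esub> a)"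
          using a smult_assoc1[of "inverse (f a)" "f a" a] by simp
        also have "\<dots> = \<zero>\<^bsub>W\<^esub>"
          unfolding f by simp
        finally show False
          using a by simp
      qed
      then show "\<forall>v\<in>{a}. f v = \<zero>\<^bsub>\<C>\<^esub>"
        by simp
    qed (use a in auto)
    moreover have "gen_set {a}"
      using span[OF a(1)] a smult_closed[of _ a] by auto
    ultimately have "basis {a}"
      using a by (simp add: basis_def)
    then show "dim = 1"
      using dim_basis[of "{a}"] by simp
  qed
qed

text \<open>
  By rank-nullity the kernel is a hyperplane iff the image is a line.  This turns the definition of
  a reflection by the dimension of its mirror into the existence of a root.
\<close>

lemma kernel_dim_rank_one:
  fixes A :: "complex mat"
  assumes A: "A \<in> carrier_mat n n" and n: "n > 0"
  shows "kernel_dim A = n - 1 \<longleftrightarrow>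
    (\<exists>a\<in>carrier_vec n. a \<noteq> 0\<^sub>v n \<and> (\<exists>v\<in>carrier_vec n. A *\<^sub>v v = a) \<and>
      (\<forall>v\<in>carrier_vec n. \<exists>c. A *\<^sub>v v = c \<cdot>\<^sub>v a))"
proof -
  define V where "V = module_vec TYPE(complex) n"
  define T where "T = (\<lambda>v. A *\<^sub>v v)"
  have V: "carrier V = carrier_vec n" "\<zero>\<^bsub>V\<^esub> = 0\<^sub>v n" "add V = (+)" "module.smult V = (\<cdot>\<^sub>v)"
    by (simp_all add: V_def module_vec_simps)
  have vs: "vectorspace \<C> V"
    unfolding V_def by (rule vec_vs)
  have hom: "T \<in> LinearCombinations.module_hom \<C> V V"
    using A by (auto simp: LinearCombinations.module_hom_def V T_def mult_add_distrib_mat_vec mult_mat_vec)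
  have lm: "linear_map \<C> V V T"
    unfolding linear_map_def mod_hom_def mod_hom_axioms_def
    using vs hom by (simp add: vectorspace_def)
  have fd: "vectorspace.fin_dim \<C> V" and dimV: "vectorspace.dim \<C> V = n"
    unfolding V_def by (rule vec_space.fin_dim, rule vec_space.dim_is_n)
  define I where "I = V\<lparr>carrier := T ` carrier_vec n\<rparr>"
  have im: "mod_hom.im V T = T ` carrier_vec n"
    using lm by (subst mod_hom.im_def) (auto simp: linear_map_def V)
  have ker: "mod_hom.ker V V T = mat_kernel A"
    using lm A by (subst mod_hom.ker_def) (auto simp: linear_map_def V T_def mat_kernel_def)
  have dim: "vectorspace.dim \<C> I + kernel_dim A = n"
    using linear_map.rank_nullity[OF lm fd] A
    unfolding im ker dimV I_def by (simp add: kernel_dim_def V_def)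
  have Ivs: "vectorspace \<C> I"
    using vectorspace.subspace_is_vs[OF vs linear_map.imT_is_subspace[OF lm]]
    unfolding im I_def .
  have lmI: "linear_map \<C> V I T"
    unfolding linear_map_def mod_hom_def mod_hom_axioms_def
    using vs Ivs hom by (auto simp: vectorspace_def LinearCombinations.module_hom_def I_def V)
  have Ifd: "vectorspace.fin_dim \<C> I"
    by (rule linear_map.rank_nullity_main(2)[OF lmI fd]) (simp add: I_def V)
  have "kernel_dim A = n - 1 \<longleftrightarrow> vectorspace.dim \<C> I = 1"
    using dim n by auto
  also have "\<dots> \<longleftrightarrow> (\<exists>a\<in>T ` carrier_vec n. a \<noteq> 0\<^sub>v n \<and>
      (\<forall>v\<in>T ` carrier_vec n. \<exists>c. v = c \<cdot>\<^sub>v a))"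
    using dim_eq_1_iff[OF Ivs Ifd] by (simp add: I_def V)
  also have "\<dots> \<longleftrightarrow> (\<exists>a\<in>carrier_vec n. a \<noteq> 0\<^sub>v n \<and> (\<exists>v\<in>carrier_vec n. A *\<^sub>v v = a) \<and>
      (\<forall>v\<in>carrier_vec n. \<exists>c. A *\<^sub>v v = c \<cdot>\<^sub>v a))"
    (is "?L = ?R")
  proof
    show ?R if ?L
    proof -
      from that obtain v where "v \<in> carrier_vec n" "T v \<noteq> 0\<^sub>v n"
        "\<And>u. u \<in> carrier_vec n \<Longrightarrow> \<exists>c. T u = c \<cdot>\<^sub>v T v"
        by auto
      then show ?thesis
        using A by (intro bexI[of _ "T v"]) (auto simp: T_def)
    qed
    show ?L if ?R
      using that unfolding T_def by blast
  qed
  finally show ?thesis .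
qed


section \<open>Weyl groups as finite real reflection groups\<close>

lemma form_add_left:
  "b \<in> carrier_mat n n \<Longrightarrow> u \<in> carrier_vec n \<Longrightarrow> v \<in> carrier_vec n \<Longrightarrow> w \<in> carrier_vec n \<Longrightarrow>
    form b (u + v) w = form b u w + form b v w"
  by (simp add: form_def add_scalar_prod_distrib[of _ n])

lemma form_smult_left:
  "b \<in> carrier_mat n n \<Longrightarrow> u \<in> carrier_vec n \<Longrightarrow> w \<in> carrier_vec n \<Longrightarrow>
    form b (c \<cdot>\<^sub>v u) w = c * form b u w"
  by (simp add: form_def)

locale euclidean_form =
  fixes n :: nat and b :: "complex mat"
  assumes b_carrier: "b \<in> carrier_mat n n"
    and form_sym: "\<And>v w. v \<in> carrier_vec n \<Longrightarrow> w \<in> carrier_vec n \<Longrightarrow> form b v w = form b w v"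
    and form_nondeg: "\<And>v. v \<in> carrier_vec n \<Longrightarrow> (\<And>w. w \<in> carrier_vec n \<Longrightarrow> form b v w = 0) \<Longrightarrow>
      v = 0\<^sub>v n"
    and form_real: "\<And>v. v \<in> carrier_vec n \<Longrightarrow> (\<And>i. i < n \<Longrightarrow> v $ i \<in> \<real>) \<Longrightarrow> form b v v \<in> \<real>"
    and form_pos: "\<And>v. v \<in> carrier_vec n \<Longrightarrow> (\<And>i. i < n \<Longrightarrow> v $ i \<in> \<real>) \<Longrightarrow> v \<noteq> 0\<^sub>v n \<Longrightarrow>
      Re (form b v v) > 0"
begin

lemma form_add_right:
  "u \<in> carrier_vec n \<Longrightarrow> v \<in> carrier_vec n \<Longrightarrow> w \<in> carrier_vec n \<Longrightarrow>
    form b w (u + v) = form b w u + form b w v"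
  using form_add_left[OF b_carrier] form_sym by (metis add_carrier_vec)

lemma form_smult_right:
  "u \<in> carrier_vec n \<Longrightarrow> w \<in> carrier_vec n \<Longrightarrow> form b w (c \<cdot>\<^sub>v u) = c * form b w u"
  using form_smult_left[OF b_carrier] form_sym by (metis smult_carrier_vec)

text \<open>
  Polarization: the form is only assumed to be real on pairs \<open>(v, v)\<close>.
\<close>

lemma form_entry_real:
  assumes "i < n" "j < n"
  shows "b $$ (i, j) \<in> \<real>"
proof -
  define e where "e i = (unit_vec n i :: complex vec)" for i
  have e: "e i \<in> carrier_vec n" for i
    by (simp add: e_def)
  have real: "form b (e i) (e i) \<in> \<real>" "form b (e j) (e j) \<in> \<real>"
    by (intro form_real e; simp add: e_def unit_vec_def)+
  have "form b (e i + e j) (e i + e j) \<in> \<real>"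
    by (intro form_real add_carrier_vec e) (simp add: e_def unit_vec_def)
  also have "form b (e i + e j) (e i + e j) =
      form b (e i) (e i) + form b (e j) (e j) + 2 * form b (e i) (e j)"
    using e form_sym[of "e j" "e i"]
    by (simp add: form_add_left[OF b_carrier] form_add_right)
  finally have "2 * form b (e i) (e j) \<in> \<real>"
    using real by (metis Reals_add Reals_diff add_diff_cancel_left')
  then have "2 * form b (e i) (e j) / 2 \<in> \<real>"
    by (intro Reals_divide) simp_all
  moreover have "form b (e i) (e j) = b $$ (i, j)"
    using b_carrier assms by (simp add: form_def e_def)
  ultimately show ?thesis
    by simp
qed

text \<open>
  The system \<open>b d = e\<^sub>i\<close> is solvable as the form is nondegenerate; since \<open>b\<close> is real, the real part of
  a solution is again a solution.
\<close>

lemma dual_vector: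
  assumes i: "i < n"
  obtains d where "d \<in> carrier_vec n" "\<And>j. j < n \<Longrightarrow> d $ j \<in> \<real>"
    "\<And>v. v \<in> carrier_vec n \<Longrightarrow> form b v d = v $ i"
proof -
  have "det b \<noteq> 0"
  proof
    assume "det b = 0"
    then obtain v where v: "v \<in> carrier_vec n" "v \<noteq> 0\<^sub>v n" "b *\<^sub>v v = 0\<^sub>v n"
      using det_0_iff_vec_prod_zero[OF b_carrier] by blast
    have "form b v w = 0" if "w \<in> carrier_vec n" for w
      using that v form_sym[of v w] by (simp add: form_def)
    then show False
      using form_nondeg v by blast
  qed
  then obtain c where c: "c \<in> carrier_mat n n" "b * c = 1\<^sub>m n"
    using det_non_zero_imp_unit[OF b_carrier, of "TYPE(complex)"]
    by (auto simp: Units_def ring_mat_def)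
  define e where "e = c *\<^sub>v unit_vec n i"
  define d where "d = vec n (\<lambda>j. complex_of_real (Re (e $ j)))"
  have e: "e \<in> carrier_vec n" "b *\<^sub>v e = unit_vec n i"
    using c b_carrier by (auto simp: e_def simp flip: assoc_mult_mat_vec)
  have "b *\<^sub>v d = unit_vec n i"
  proof (rule eq_vecI)
    fix k
    assume "k < dim_vec (unit_vec n i :: complex vec)"
    then have k: "k < n"
      by simp
    have "(b *\<^sub>v e) $ k = (\<Sum>j<n. b $$ (k, j) * e $ j)"
      using b_carrier e(1) k by (simp add: scalar_prod_def lessThan_atLeast0)
    moreover have "(b *\<^sub>v d) $ k = (\<Sum>j<n. b $$ (k, j) * d $ j)"
      using b_carrier k by (simp add: scalar_prod_def lessThan_atLeast0 d_def)
    moreover have "b $$ (k, j) * d $ j = complex_of_real (Re (b $$ (k, j) * e $ j))" if "j < n" for j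
      using form_entry_real[OF k that] that by (simp add: d_def complex_eq_iff complex_is_Real_iff)
    ultimately have "(b *\<^sub>v d) $ k = complex_of_real (Re ((b *\<^sub>v e) $ k))"
      by simp
    also have "\<dots> = unit_vec n i $ k"
      using e k i by (simp add: unit_vec_def)
    finally show "(b *\<^sub>v d) $ k = unit_vec n i $ k" .
  qed (use b_carrier in auto)
  then have "form b v d = v $ i" if "v \<in> carrier_vec n" for v
    using that i by (simp add: form_def)
  then show ?thesis
    by (intro that[of d]) (simp_all add: d_def)
qed

text \<open>
  This is the Cauchy--Schwarz inequality for \<open>v\<close> and the vector \<open>d\<close> dual to the \<open>i\<close>-th coordinate:
  the form is nonnegative at \<open>u = v - (v, d) / (d, d) d\<close>.
\<close>

lemma coordinate_bound:
  assumes i: "i < n"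
  obtains K where "\<And>v. v \<in> carrier_vec n \<Longrightarrow> (\<And>j. j < n \<Longrightarrow> v $ j \<in> \<real>) \<Longrightarrow>
    (Re (v $ i))\<^sup>2 \<le> K * Re (form b v v)"
proof -
  obtain d where d: "d \<in> carrier_vec n" "\<And>j. j < n \<Longrightarrow> d $ j \<in> \<real>"
    "\<And>v. v \<in> carrier_vec n \<Longrightarrow> form b v d = v $ i"
    by (rule dual_vector[OF i]) blast
  define q where "q = Re (form b d d)"
  have "d \<noteq> 0\<^sub>v n"
    using d(3)[of "unit_vec n i"] i b_carrier by (auto simp: form_def)
  then have q: "q > 0"
    unfolding q_def using d form_pos by blast
  have fd: "form b d d = of_real q"
    unfolding q_def using form_real[OF d(1,2)] by simp
  have "(Re (v $ i))\<^sup>2 \<le> q * Re (form b v v)"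
    if v: "v \<in> carrier_vec n" and real: "\<And>j. j < n \<Longrightarrow> v $ j \<in> \<real>" for v
  proof -
    define a where "a = Re (v $ i)"
    have a: "v $ i = of_real a"
      using real[OF i] by (simp add: a_def)
    define u where "u = v + complex_of_real (- a / q) \<cdot>\<^sub>v d"
    have u: "u \<in> carrier_vec n"
      using v d by (simp add: u_def)
    have "u $ j \<in> \<real>" if "j < n" for j
      using that v d(1) real[OF that] d(2)[OF that] by (auto simp: u_def intro!: Reals_add Reals_mult)
    then have "0 \<le> Re (form b u u)"
      using form_pos[OF u] by (cases "u = 0\<^sub>v n") (auto simp: form_def scalar_prod_def)
    also have "form b u u = form b v v + 2 * complex_of_real (- a / q) * form b v d
        + complex_of_real (- a / q) * complex_of_real (- a / q) * form b d d"
      using v d(1) form_sym[of d v] unfolding u_def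
      by (simp add: form_add_left[OF b_carrier] form_add_right form_smult_left[OF b_carrier]
          form_smult_right algebra_simps)
    also have "\<dots> = form b v v + complex_of_real (2 * (- a / q) * a + (- a / q) * (- a / q) * q)"
      unfolding d(3)[OF v] a fd by simp
    also have "2 * (- a / q) * a + (- a / q) * (- a / q) * q = - (a\<^sup>2 / q)"
      using q by (simp add: field_simps power2_eq_square)
    finally show ?thesis
      using q by (simp add: a_def field_simps)
  qed
  then show ?thesis
    by (rule that)
qed

text \<open>The entries of an isometry are bounded, as its columns have prescribed lengths.\<close>

lemma finite_integral_isometries:
  "finite {w \<in> carrier_mat n n. (\<forall>i<n. \<forall>j<n. w $$ (i, j) \<in> \<int>) \<and>
    (\<forall>v\<in>carrier_vec n. form b (w *\<^sub>v v) (w *\<^sub>v v) = form b v v)}" (is "finite ?M")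
proof -
  have "\<exists>K. \<forall>v\<in>carrier_vec n. (\<forall>j<n. v $ j \<in> \<real>) \<longrightarrow> (Re (v $ i))\<^sup>2 \<le> K * Re (form b v v)"
    if "i < n" for i
    using coordinate_bound[OF that] by metis
  then obtain K where K: "\<And>i v. i < n \<Longrightarrow> v \<in> carrier_vec n \<Longrightarrow> (\<And>j. j < n \<Longrightarrow> v $ j \<in> \<real>) \<Longrightarrow>
      (Re (v $ i))\<^sup>2 \<le> K i * Re (form b v v)"
    by metis
  define c where "c i j = K i * Re (form b (unit_vec n j) (unit_vec n j))" for i j
  define Z where "Z = (\<lambda>(i, j). (of_int :: int \<Rightarrow> complex) ` {z. (real_of_int z)\<^sup>2 \<le> c i j})"
  have "finite {z. (real_of_int z)\<^sup>2 \<le> c}" for c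
  proof (rule finite_subset)
    show "{z. (real_of_int z)\<^sup>2 \<le> c} \<subseteq> {- \<lceil>c\<rceil>..\<lceil>c\<rceil>}"
    proof
      fix z
      assume "z \<in> {z. (real_of_int z)\<^sup>2 \<le> c}"
      then have "real_of_int (z\<^sup>2) \<le> c"
        by simp
      then have "z\<^sup>2 \<le> \<lceil>c\<rceil>"
        by linarith
      moreover have "\<bar>z\<bar> \<le> z\<^sup>2"
      proof (cases "z = 0")
        case False
        then have "\<bar>z\<bar> * 1 \<le> \<bar>z\<bar> * \<bar>z\<bar>"
          by (intro mult_left_mono) auto
        then show ?thesis
          by (simp add: power2_eq_square)
      qed simp
      ultimately show "z \<in> {- \<lceil>c\<rceil>..\<lceil>c\<rceil>}"
        by auto
    qed
  qed simp
  then have "finite (PiE ({..<n} \<times> {..<n}) Z)"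
    by (intro finite_PiE) (auto simp: Z_def)
  moreover have "?M \<subseteq> (\<lambda>f. mat n n f) ` PiE ({..<n} \<times> {..<n}) Z"
  proof
    fix w
    assume w: "w \<in> ?M"
    have "w $$ (i, j) \<in> Z (i, j)" if ij: "i < n" "j < n" for i j
    proof -
      have col: "(w *\<^sub>v unit_vec n j) $ k = w $$ (k, j)" if "k < n" for k
      proof -
        have "w \<in> carrier_mat n n"
          using w by simp
        then show ?thesis
          using ij that by simp
      qed
      have "w $$ (i, j) \<in> \<int>"
        using w ij by simp
      then obtain z where z: "w $$ (i, j) = of_int z"
        by (rule Ints_cases)
      have "w $$ (k, j) \<in> \<real>" if "k < n" for k
      proof -
        have "w $$ (k, j) \<in> \<int>"
          using w ij that by simp
        then show ?thesis
          by (auto elim: Ints_cases)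
      qed
      then have "(Re ((w *\<^sub>v unit_vec n j) $ i))\<^sup>2 \<le>
          K i * Re (form b (w *\<^sub>v unit_vec n j) (w *\<^sub>v unit_vec n j))"
        using w ij by (intro K) (auto simp: col)
      also have "\<dots> = c i j"
        using w by (simp add: c_def)
      finally show ?thesis
        using ij by (simp add: col z Z_def)
    qed
    then have "restrict (\<lambda>ij. w $$ ij) ({..<n} \<times> {..<n}) \<in> PiE ({..<n} \<times> {..<n}) Z"
      by auto
    moreover have "w = mat n n (restrict (\<lambda>ij. w $$ ij) ({..<n} \<times> {..<n}))"
      using w by (intro eq_matI) auto
    ultimately show "w \<in> (\<lambda>f. mat n n f) ` PiE ({..<n} \<times> {..<n}) Z"
      by blast
  qed
  ultimately show ?thesis
    by (meson finite_imageI finite_subset)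
qed

end


text \<open>
  The properties of a Weyl group on which the duality rests: it is a finite group of real isometries,
  generated by the reflections \<open>s i\<close>, where \<open>s i\<close> moves every vector along the \<open>i\<close>-th coordinate axis
  (its rows other than the \<open>i\<close>-th are those of the identity).
\<close>

locale reflection_group = euclidean_form n b for n :: nat and b :: "complex mat" +
  fixes W :: "complex mat set" and s :: "nat \<Rightarrow> complex mat"
  assumes n_pos: "n > 0"
    and finite_W: "finite W"
    and W_carrier: "w \<in> W \<Longrightarrow> w \<in> carrier_mat n n"
    and W_one: "1\<^sub>m n \<in> W"
    and W_mult: "v \<in> W \<Longrightarrow> w \<in> W \<Longrightarrow> v * w \<in> W"
    and W_inv: "w \<in> W \<Longrightarrow> \<exists>v\<in>W. v * w = 1\<^sub>m n \<and> w * v = 1\<^sub>m n"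
    and W_real: "w \<in> W \<Longrightarrow> i < n \<Longrightarrow> j < n \<Longrightarrow> w $$ (i, j) \<in> \<real>"
    and W_form: "w \<in> W \<Longrightarrow> x \<in> carrier_vec n \<Longrightarrow> y \<in> carrier_vec n \<Longrightarrow>
      form b (w *\<^sub>v x) (w *\<^sub>v y) = form b x y"
    and s_W: "i < n \<Longrightarrow> s i \<in> W"
    and s_involution: "i < n \<Longrightarrow> s i * s i = 1\<^sub>m n"
    and s_entry: "i < n \<Longrightarrow> r < n \<Longrightarrow> j < n \<Longrightarrow> r \<noteq> i \<Longrightarrow>
      s i $$ (r, j) = (if r = j then 1 else 0)"
    and s_diagonal: "i < n \<Longrightarrow> s i $$ (i, i) = - 1"
    and W_induct [consumes 1, case_names one step]:
      "w \<in> W \<Longrightarrow> P (1\<^sub>m n) \<Longrightarrow> (\<And>i w. i < n \<Longrightarrow> w \<in> W \<Longrightarrow> P w \<Longrightarrow> P (s i * w)) \<Longrightarrow> P w"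

lemma simple_refl_carrier: "simple_refl X i \<in> carrier_mat (rank X) (rank X)"
  by (simp add: simple_refl_def)

lemma cartan_diagonal: "cartan X i i = 2"
  by (cases X) auto

lemma simple_refl_involution:
  assumes i: "i < rank X"
  shows "simple_refl X i * simple_refl X i = 1\<^sub>m (rank X)"
proof (rule eq_matI)
  fix r j
  assume "r < dim_row (1\<^sub>m (rank X) :: complex mat)" "j < dim_col (1\<^sub>m (rank X) :: complex mat)"
  then have r: "r < rank X" and j: "j < rank X"
    by simp_all
  define c where "c k = complex_of_int (cartan X i k)" for k
  have ci: "c i = 2"
    by (simp add: c_def cartan_diagonal)
  have "(simple_refl X i * simple_refl X i) $$ (r, j) = (\<Sum>k<rank X.
      ((if r = k then 1 else 0) - (if r = i then c k else 0)) *
      ((if k = j then 1 else 0) - (if k = i then c j else 0)))"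
    unfolding c_def using r j by (simp add: simple_refl_def scalar_prod_def lessThan_atLeast0)
  also have "\<dots> = (\<Sum>k<rank X. (if k = j then (if r = k then 1 else 0) - (if r = i then c k else 0) else 0)
      - (if k = i then ((if r = k then 1 else 0) - (if r = i then c k else 0)) * c j else 0))"
    by (intro sum.cong) (auto simp: algebra_simps)
  also have "\<dots> = ((if r = j then 1 else 0) - (if r = i then c j else 0))
      - ((if r = i then 1 else 0) - (if r = i then c i else 0)) * c j"
    using i j by (simp add: sum_subtractf sum.delta)
  also have "\<dots> = 1\<^sub>m (rank X) $$ (r, j)"
    using r j by (simp add: ci)
  finally show "(simple_refl X i * simple_refl X i) $$ (r, j) = 1\<^sub>m (rank X) $$ (r, j)" .
qed (simp_all add: simple_refl_def)

lemma rank_pos: "rank X > 0"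
  by (cases X) auto

lemma simple_refl_Units:
  assumes "i < rank X"
  shows "simple_refl X i \<in> Units (ring_mat TYPE(complex) (rank X) ())"
  using simple_refl_involution[OF assms] simple_refl_carrier
  by (auto simp: Units_def ring_mat_def)

context
  fixes X :: exceptional_type
begin

interpretation mat_ring: ring "ring_mat TYPE(complex) (rank X) ()"
  by (rule ring_mat)

interpretation mat_units: group "units_of (ring_mat TYPE(complex) (rank X) ())"
  by (rule mat_ring.units_group)

lemma simple_refl_units_group:
  "simple_refl X ` {..<rank X} \<subseteq> carrier (units_of (ring_mat TYPE(complex) (rank X) ()))"
  using simple_refl_Units by (auto simp: units_of_carrier)

lemma weyl_group_subset_Units: "weyl_group X \<subseteq> Units (ring_mat TYPE(complex) (rank X) ())"
  using mat_units.generate_incl[OF simple_refl_units_group]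
  by (simp add: weyl_group_def units_of_carrier)

lemma weyl_group_carrier: "w \<in> weyl_group X \<Longrightarrow> w \<in> carrier_mat (rank X) (rank X)"
  using weyl_group_subset_Units by (auto simp: Units_def ring_mat_simps)

lemma weyl_group_one: "1\<^sub>m (rank X) \<in> weyl_group X"
  using generate.one[of "units_of (ring_mat TYPE(complex) (rank X) ())"]
  by (simp add: weyl_group_def units_of_one ring_mat_simps)

lemma weyl_group_mult: "v \<in> weyl_group X \<Longrightarrow> w \<in> weyl_group X \<Longrightarrow> v * w \<in> weyl_group X"
  using generate.eng[of v "units_of (ring_mat TYPE(complex) (rank X) ())" _ w]
  by (simp add: weyl_group_def units_of_mult ring_mat_simps)

lemma simple_refl_weyl_group: "i < rank X \<Longrightarrow> simple_refl X i \<in> weyl_group X"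
  by (auto simp: weyl_group_def intro: generate.incl)

lemma simple_refl_inv:
  assumes i: "i < rank X"
  shows "inv\<^bsub>units_of (ring_mat TYPE(complex) (rank X) ())\<^esub> simple_refl X i = simple_refl X i"
proof (rule mat_units.inv_equality)
  show "simple_refl X i \<otimes>\<^bsub>units_of (ring_mat TYPE(complex) (rank X) ())\<^esub> simple_refl X i =
      \<one>\<^bsub>units_of (ring_mat TYPE(complex) (rank X) ())\<^esub>"
    using simple_refl_involution[OF i] by (simp add: units_of_mult units_of_one ring_mat_simps)
qed (use simple_refl_units_group i in auto)

text \<open>
  The generators are their own inverses, so every element of the group is a word in them.
\<close>

lemma weyl_group_induct [consumes 1, case_names one step]:
  assumes w: "w \<in> weyl_group X"
    and one: "P (1\<^sub>m (rank X))"
    and step: "\<And>i w. i < rank X \<Longrightarrow> w \<in> weyl_group X \<Longrightarrow> P w \<Longrightarrow> P (simple_refl X i * w)"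
  shows "P w"
proof -
  have "P (w * v)" if "v \<in> weyl_group X" "P v" for v
    using w that unfolding weyl_group_def
  proof (induction arbitrary: v rule: generate.induct)
    case one
    then show ?case
      using weyl_group_carrier[of v] by (simp add: weyl_group_def units_of_one ring_mat_simps)
  next
    case (incl h)
    then show ?case
      using step by (auto simp: weyl_group_def)
  next
    case (inv h)
    then show ?case
      using step simple_refl_inv by (auto simp: weyl_group_def)
  next
    case (eng h1 h2)
    have c: "h1 \<in> carrier_mat (rank X) (rank X)" "h2 \<in> carrier_mat (rank X) (rank X)"
      "v \<in> carrier_mat (rank X) (rank X)"
      using eng weyl_group_carrier by (simp_all add: weyl_group_def)
    have "P (h2 * v)"
      using eng by blast
    moreover have "h2 * v \<in> weyl_group X"
      using eng weyl_group_mult by (simp add: weyl_group_def)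
    ultimately have "P (h1 * (h2 * v))"
      using eng by (simp add: weyl_group_def)
    then show ?case
      using c by (simp add: units_of_mult ring_mat_simps)
  qed
  from this[OF weyl_group_one one] show ?thesis
    using weyl_group_carrier[OF w] by simp
qed

lemma weyl_group_inv:
  assumes "w \<in> weyl_group X"
  shows "\<exists>v\<in>weyl_group X. v * w = 1\<^sub>m (rank X) \<and> w * v = 1\<^sub>m (rank X)"
  using assms
proof (induction w rule: weyl_group_induct)
  case one
  show ?case
    by (intro bexI[of _ "1\<^sub>m (rank X)"] weyl_group_one) simp
next
  case (step i w)
  then obtain v where v: "v \<in> weyl_group X" "v * w = 1\<^sub>m (rank X)" "w * v = 1\<^sub>m (rank X)"
    by blast
  let ?s = "simple_refl X i"
  have c: "v \<in> carrier_mat (rank X) (rank X)" "w \<in> carrier_mat (rank X) (rank X)"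
    "?s \<in> carrier_mat (rank X) (rank X)"
    using v step weyl_group_carrier simple_refl_carrier by auto
  have "v * ?s * (?s * w) = v * (?s * ?s) * w" "?s * w * (v * ?s) = ?s * (w * v) * ?s"
    using c by (simp_all add: assoc_mult_mat[of _ "rank X" "rank X" _ "rank X" _ "rank X"])
  then have "v * ?s * (?s * w) = 1\<^sub>m (rank X)" "?s * w * (v * ?s) = 1\<^sub>m (rank X)"
    using c v step simple_refl_involution by auto
  moreover have "v * ?s \<in> weyl_group X"
    using v step simple_refl_weyl_group weyl_group_mult by blast
  ultimately show ?case
    by blast
qed

lemma weyl_group_integral:
  assumes "w \<in> weyl_group X" "i < rank X" "j < rank X"
  shows "w $$ (i, j) \<in> \<int>"
  using assms
proof (induction w arbitrary: i j rule: weyl_group_induct)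
  case (step k w)
  have "(simple_refl X k * w) $$ (i, j) = (\<Sum>l<rank X. simple_refl X k $$ (i, l) * w $$ (l, j))"
    using step weyl_group_carrier[of w] simple_refl_carrier[of X k]
    by (simp add: scalar_prod_def lessThan_atLeast0)
  moreover have "simple_refl X k $$ (i, l) \<in> \<int>" if "l < rank X" for l
    using that step by (simp add: simple_refl_def)
  ultimately show ?case
    using step by (auto intro!: Ints_sum Ints_mult)
qed simp

end

text \<open>
  The group is finite because its elements are integral isometries of a positive definite form.
\<close>

theorem weyl_group_reflection_group:
  assumes "weyl_invariant_form X b"
  shows "reflection_group (rank X) b (weyl_group X) (simple_refl X)"
proof -
  have b: "b \<in> carrier_mat (rank X) (rank X)"
    and sym: "\<And>v w. v \<in> carrier_vec (rank X) \<Longrightarrow> w \<in> carrier_vec (rank X) \<Longrightarrow>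
      form b v w = form b w v"
    and nondeg: "\<And>v. v \<in> carrier_vec (rank X) \<Longrightarrow>
      (\<And>w. w \<in> carrier_vec (rank X) \<Longrightarrow> form b v w = 0) \<Longrightarrow> v = 0\<^sub>v (rank X)"
    and form: "\<And>w u v. w \<in> weyl_group X \<Longrightarrow> u \<in> carrier_vec (rank X) \<Longrightarrow>
      v \<in> carrier_vec (rank X) \<Longrightarrow> form b (w *\<^sub>v u) (w *\<^sub>v v) = form b u v"
    and pos: "\<And>v. v \<in> carrier_vec (rank X) \<Longrightarrow> (\<And>i. i < rank X \<Longrightarrow> v $ i \<in> \<real>) \<Longrightarrow>
      v \<noteq> 0\<^sub>v (rank X) \<Longrightarrow> form b v v \<in> \<real> \<and> Re (form b v v) > 0"
    using assms unfolding weyl_invariant_form_def by blast+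
  have zero: "form b (0\<^sub>v (rank X)) (0\<^sub>v (rank X)) = 0"
    using b by (simp add: form_def scalar_prod_def)
  interpret euclidean_form "rank X" b
  proof
    show "form b v v \<in> \<real>"
      if "v \<in> carrier_vec (rank X)" "\<And>i. i < rank X \<Longrightarrow> v $ i \<in> \<real>" for v
      using pos[OF that] zero by (cases "v = 0\<^sub>v (rank X)") simp_all
  qed (use b sym nondeg pos in blast)+
  have fin: "finite (weyl_group X)"
    by (rule finite_subset[OF _ finite_integral_isometries])
       (use weyl_group_carrier weyl_group_integral form in blast)
  show ?thesis
  proof
    show "w $$ (i, j) \<in> \<real>" if "w \<in> weyl_group X" "i < rank X" "j < rank X" for w i j
      using weyl_group_integral[OF that] by (auto elim: Ints_cases)
    show "simple_refl X i $$ (r, j) = (if r = j then 1 else 0)"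
      if "i < rank X" "r < rank X" "j < rank X" "r \<noteq> i" for i r j
      using that by (simp add: simple_refl_def)
    show "simple_refl X i $$ (i, i) = - 1" if "i < rank X" for i
      using that by (simp add: simple_refl_def cartan_diagonal)
    show "P w" if "w \<in> weyl_group X" "P (1\<^sub>m (rank X))"
      "\<And>i w. i < rank X \<Longrightarrow> w \<in> weyl_group X \<Longrightarrow> P w \<Longrightarrow> P (simple_refl X i * w)" for w P
      using that by (rule weyl_group_induct)
  qed (fact rank_pos fin weyl_group_carrier weyl_group_one weyl_group_mult weyl_group_inv
      form simple_refl_weyl_group simple_refl_involution)+
qed


section \<open>Roots of reflections and their product\<close>

context reflection_group
begin

definition linear_poly :: "complex vec \<Rightarrow> mpoly"
  where "linear_poly v = (\<Sum>i<n. pol_const (v $ i) * pol_var i)"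

lemma linear_poly_Pol [simp]: "linear_poly v \<in> Pol n"
  unfolding linear_poly_def by (intro Pol_sum Pol_mult) auto

lemma linear_poly_degree: "linear_poly v \<in> sym_power n 1"
  unfolding linear_poly_def by (intro sym_power_sum sym_power_scale sym_power_var) auto

lemma linear_poly_add:
  "u \<in> carrier_vec n \<Longrightarrow> v \<in> carrier_vec n \<Longrightarrow> linear_poly (u + v) = linear_poly u + linear_poly v"
  by (simp add: linear_poly_def single_add distrib_right sum.distrib)

lemma linear_poly_smult:
  "v \<in> carrier_vec n \<Longrightarrow> linear_poly (c \<cdot>\<^sub>v v) = pol_const c * linear_poly v"
  by (simp add: linear_poly_def sum_distrib_left mult.assoc[symmetric] mult_single)

lemma linear_poly_coeff: "i < n \<Longrightarrow> lookup (linear_poly v) (single i 1) = v $ i"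
proof -
  assume i: "i < n"
  have "single j (Suc 0) = single i (Suc 0) \<longleftrightarrow> j = i" for j :: nat
    by (metis lookup_single_eq lookup_single_not_eq zero_neq_one One_nat_def)
  then have "lookup (linear_poly v) (single i 1) = (\<Sum>j<n. if j = i then v $ j else 0)"
    by (simp add: linear_poly_def lookup_sum pol_var_def mult_single lookup_single when_def)
  then show ?thesis
    using i by (simp add: sum.delta)
qed

lemma linear_poly_eq_0_iff: "v \<in> carrier_vec n \<Longrightarrow> linear_poly v = 0 \<longleftrightarrow> v = 0\<^sub>v n"
proof
  assume v: "v \<in> carrier_vec n" and "linear_poly v = 0"
  then show "v = 0\<^sub>v n"
    using linear_poly_coeff[of _ v] by (intro eq_vecI) (auto simp del: One_nat_def)
qed (simp add: linear_poly_def)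

lemma linear_poly_unit_vec: "i < n \<Longrightarrow> linear_poly (unit_vec n i) = pol_var i"
proof -
  assume i: "i < n"
  then have "linear_poly (unit_vec n i) = (\<Sum>j<n. if j = i then pol_var j else 0)"
    unfolding linear_poly_def by (intro sum.cong) (auto simp: unit_vec_def)
  then show ?thesis
    using i by (simp add: sum.delta)
qed

lemma sym_act_linear_poly:
  assumes w: "w \<in> carrier_mat n n" and v: "v \<in> carrier_vec n"
  shows "sym_act w (linear_poly v) = linear_poly (w *\<^sub>v v)"
proof -
  have entry: "pol_const ((w *\<^sub>v v) $ i) = (\<Sum>j<n. pol_const (w $$ (i, j)) * pol_const (v $ j))"
    if "i < n" for i
    using w v that by (simp add: scalar_prod_def lessThan_atLeast0 mult_single pol_const_sum)
  have "sym_act w (linear_poly v) =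
      (\<Sum>j<n. \<Sum>i<n. pol_const (w $$ (i, j)) * pol_const (v $ j) * pol_var i)"
    using w by (simp add: linear_poly_def sym_act_sum sym_act_scale sym_act_var sum_distrib_left
        mult.assoc mult.left_commute[of "pol_const (v $ _)"])
  also have "\<dots> = linear_poly (w *\<^sub>v v)"
    by (subst sum.swap) (simp add: linear_poly_def entry sum_distrib_right)
  finally show ?thesis .
qed

lemma mat_eqI_vec:
  assumes "v \<in> carrier_mat n n" "w \<in> carrier_mat n n"
    and "\<And>x. x \<in> carrier_vec n \<Longrightarrow> v *\<^sub>v x = w *\<^sub>v x"
  shows "v = (w :: complex mat)"
proof (rule eq_matI)
  fix i j
  assume "i < dim_row w" "j < dim_col w"
  then have ij: "i < n" "j < n"
    using assms by auto
  then have "(v *\<^sub>v unit_vec n j) $ i = (w *\<^sub>v unit_vec n j) $ i"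
    using assms by simp
  then show "v $$ (i, j) = w $$ (i, j)"
    using assms(1,2) ij by simp
qed (use assms in auto)

text \<open>
  The image of \<open>w - 1\<close> is the line of \<open>a\<close>.  Writing \<open>a\<close> itself as a value \<open>w v - v\<close> makes it evident
  that an involution \<open>w\<close> negates \<open>a\<close>.
\<close>

definition is_root :: "complex mat \<Rightarrow> complex vec \<Rightarrow> bool"
  where "is_root w a \<longleftrightarrow> a \<in> carrier_vec n \<and> a \<noteq> 0\<^sub>v n \<and>
    (\<exists>v\<in>carrier_vec n. w *\<^sub>v v = v + a) \<and> (\<forall>v\<in>carrier_vec n. \<exists>c. w *\<^sub>v v = v + c \<cdot>\<^sub>v a)"

lemma is_reflection_iff:
  assumes w: "w \<in> carrier_mat n n"
  shows "is_reflection n w \<longleftrightarrow> w * w = 1\<^sub>m n \<and> (\<exists>a. is_root w a)"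
proof -
  have "(w - 1\<^sub>m n) *\<^sub>v v = x \<longleftrightarrow> w *\<^sub>v v = v + x"
    if "v \<in> carrier_vec n" "x \<in> carrier_vec n" for v x
  proof -
    have "(w - 1\<^sub>m n) *\<^sub>v v = w *\<^sub>v v - v"
      using w that by (simp add: minus_mult_distrib_mat_vec)
    also have "\<dots> = x \<longleftrightarrow> w *\<^sub>v v = v + x"
      using w that by (auto simp: vec_eq_iff algebra_simps)
    finally show ?thesis .
  qed
  moreover have "w - 1\<^sub>m n \<in> carrier_mat n n"
    by (rule minus_carrier_mat) simp
  note kernel_dim_rank_one[OF this n_pos]
  ultimately show ?thesis
    unfolding is_reflection_def is_root_def
    by (smt (verit, best) smult_carrier_vec)
qed

definition Refl :: "complex mat set"
  where "Refl = {w \<in> W. is_reflection n w}"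

definition root_vec :: "complex mat \<Rightarrow> complex vec"
  where "root_vec w = (SOME a. is_root w a)"

definition root_poly :: "complex mat \<Rightarrow> mpoly"
  where "root_poly w = linear_poly (root_vec w)"

lemma finite_Refl [simp]: "finite Refl"
  using finite_W by (simp add: Refl_def)

lemma Refl_W: "w \<in> Refl \<Longrightarrow> w \<in> W"
  by (simp add: Refl_def)

lemma Refl_involution: "w \<in> Refl \<Longrightarrow> w * w = 1\<^sub>m n"
  by (simp add: Refl_def is_reflection_def)

lemma is_root_root:
  assumes "w \<in> Refl"
  shows "is_root w (root_vec w)"
  using assms is_reflection_iff[OF W_carrier] unfolding Refl_def root_vec_def
  by (auto intro: someI)

lemma root_carrier: "w \<in> Refl \<Longrightarrow> root_vec w \<in> carrier_vec n"
  and root_nonzero: "w \<in> Refl \<Longrightarrow> root_vec w \<noteq> 0\<^sub>v n"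
  and reflection_vec: "w \<in> Refl \<Longrightarrow> v \<in> carrier_vec n \<Longrightarrow> \<exists>c. w *\<^sub>v v = v + c \<cdot>\<^sub>v root_vec w"
  using is_root_root by (auto simp: is_root_def)

lemma involution_vec:
  "w \<in> Refl \<Longrightarrow> v \<in> carrier_vec n \<Longrightarrow> w *\<^sub>v (w *\<^sub>v v) = v"
  using Refl_involution W_carrier[OF Refl_W] by (metis assoc_mult_mat_vec one_mult_mat_vec)

lemma reflection_root:
  assumes w: "w \<in> Refl"
  shows "w *\<^sub>v root_vec w = - root_vec w"
proof -
  have W: "w \<in> carrier_mat n n"
    using W_carrier Refl_W w by blast
  obtain v where v: "v \<in> carrier_vec n" "w *\<^sub>v v = v + root_vec w"
    using is_root_root[OF w] by (auto simp: is_root_def)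
  have "v = w *\<^sub>v v + w *\<^sub>v root_vec w"
    using involution_vec[OF w v(1)] v W root_carrier[OF w]
    by (simp add: mult_add_distrib_mat_vec)
  then have "v = (v + root_vec w) + w *\<^sub>v root_vec w"
    unfolding v(2) .
  then show ?thesis
    using v(1) W root_carrier[OF w] by (auto simp: vec_eq_iff add.assoc add_eq_0_iff)
qed

text \<open>
  A reflection \<open>w\<close> with root \<open>a\<close> preserves the form, whence \<open>w v = v - 2 (v, a) / (a, a) a\<close>.  So
  distinct reflections have non-proportional roots.
\<close>

lemma reflection_formula:
  assumes w: "w \<in> Refl" and v: "v \<in> carrier_vec n"
  shows "form b (root_vec w) (root_vec w) \<noteq> 0"
    and "w *\<^sub>v v = v + (- 2 * form b v (root_vec w) / form b (root_vec w) (root_vec w)) \<cdot>\<^sub>v root_vec w"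
proof -
  let ?a = "root_vec w"
  have a: "?a \<in> carrier_vec n"
    by (rule root_carrier[OF w])
  have *: "\<exists>c. w *\<^sub>v v = v + c \<cdot>\<^sub>v ?a \<and> c * form b ?a ?a = - 2 * form b v ?a"
    if v: "v \<in> carrier_vec n" for v
  proof -
    obtain c where c: "w *\<^sub>v v = v + c \<cdot>\<^sub>v ?a"
      using reflection_vec[OF w v] by blast
    have "form b v ?a = form b (v + c \<cdot>\<^sub>v ?a) (- ?a)"
      using W_form[OF Refl_W[OF w] v a] c reflection_root[OF w] by simp
    also have "- ?a = (-1) \<cdot>\<^sub>v ?a"
      by auto
    also have "form b (v + c \<cdot>\<^sub>v ?a) \<dots> = - form b v ?a - c * form b ?a ?a"
      using v a by (simp only: form_add_left[OF b_carrier] form_smult_right form_smult_left[OF b_carrier]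
        smult_carrier_vec add_carrier_vec) (simp add: algebra_simps)
    finally show ?thesis
      using c by (intro exI[of _ c]) (simp add: algebra_simps add_eq_0_iff2)
  qed
  show nz: "form b ?a ?a \<noteq> 0"
  proof
    assume "form b ?a ?a = 0"
    then have "form b ?a v = 0" if "v \<in> carrier_vec n" for v
      using *[OF that] form_sym[OF a that] by auto
    then show False
      using form_nondeg[OF a] root_nonzero[OF w] by blast
  qed
  obtain c where c: "w *\<^sub>v v = v + c \<cdot>\<^sub>v ?a" "c * form b ?a ?a = - 2 * form b v ?a"
    using *[OF v] by blast
  then have "c = - 2 * form b v ?a / form b ?a ?a"
    using nz by (simp add: field_simps)
  then show "w *\<^sub>v v = v + (- 2 * form b v ?a / form b ?a ?a) \<cdot>\<^sub>v ?a"
    using c by simp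
qed

lemma roots_not_proportional:
  assumes w: "w \<in> Refl" and w': "w' \<in> Refl" and par: "root_vec w' = c \<cdot>\<^sub>v root_vec w"
  shows "w' = w"
proof (rule mat_eqI_vec)
  fix x :: "complex vec"
  assume x: "x \<in> carrier_vec n"
  have "c \<noteq> 0"
    using root_nonzero[OF w'] par root_carrier[OF w] by auto
  have "- 2 * form b x (root_vec w') / form b (root_vec w') (root_vec w') * c =
      - 2 * form b x (root_vec w) / form b (root_vec w) (root_vec w)"
    unfolding par using \<open>c \<noteq> 0\<close> x root_carrier[OF w] reflection_formula(1)[OF w x]
    by (simp add: form_smult_left[OF b_carrier] form_smult_right field_simps)
  then show "w' *\<^sub>v x = w *\<^sub>v x"
    using reflection_formula(2)[OF w' x] reflection_formula(2)[OF w x] 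
    by (simp add: par smult_smult_assoc)
qed (use W_carrier Refl_W w w' in auto)

text \<open>
  The conjugate \<open>g w g\<inverse>\<close> has root \<open>g a\<close>, so the group permutes the root lines.
\<close>

lemma conjugate_reflection:
  assumes g: "g \<in> W" "h \<in> W" "g * h = 1\<^sub>m n" "h * g = 1\<^sub>m n" and w: "w \<in> Refl"
  shows "g * w * h \<in> Refl" "\<exists>c. g *\<^sub>v root_vec w = c \<cdot>\<^sub>v root_vec (g * w * h)"
proof -
  define v where "v = g * w * h"
  have W: "g \<in> carrier_mat n n" "h \<in> carrier_mat n n" "w \<in> carrier_mat n n"
    using g W_carrier Refl_W w by auto
  have a: "root_vec w \<in> carrier_vec n"
    by (rule root_carrier[OF w])
  have cancel: "g *\<^sub>v (h *\<^sub>v x) = x" "h *\<^sub>v (g *\<^sub>v x) = x" if "x \<in> carrier_vec n" for x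
    using W g that by (metis assoc_mult_mat_vec one_mult_mat_vec)+
  have act: "v *\<^sub>v x = g *\<^sub>v (w *\<^sub>v (h *\<^sub>v x))" if "x \<in> carrier_vec n" for x
    using W that unfolding v_def by (simp add: assoc_mult_mat_vec[of _ n n _ n])
  have "v * v = g * (w * (h * g) * w) * h"
    using W unfolding v_def by (simp add: assoc_mult_mat[of _ n n _ n _ n])
  also have "\<dots> = 1\<^sub>m n"
    using W g Refl_involution[OF w] by simp
  finally have inv: "v * v = 1\<^sub>m n" .
  have "is_root v (g *\<^sub>v root_vec w)"
    unfolding is_root_def
  proof (intro conjI ballI)
    show "g *\<^sub>v root_vec w \<in> carrier_vec n"
      using W a by simp
    show "g *\<^sub>v root_vec w \<noteq> 0\<^sub>v n"
    proof
      assume "g *\<^sub>v root_vec w = 0\<^sub>v n"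
      moreover have "h *\<^sub>v 0\<^sub>v n = 0\<^sub>v n"
        using W by (auto simp: vec_eq_iff scalar_prod_def)
      ultimately show False
        using cancel(2)[OF a] root_nonzero[OF w] by simp
    qed
    obtain x where x: "x \<in> carrier_vec n" "w *\<^sub>v x = x + root_vec w"
      using is_root_root[OF w] by (auto simp: is_root_def)
    then have "v *\<^sub>v (g *\<^sub>v x) = g *\<^sub>v x + g *\<^sub>v root_vec w"
      using W a by (simp add: act cancel mult_add_distrib_mat_vec)
    then show "\<exists>x\<in>carrier_vec n. v *\<^sub>v x = x + g *\<^sub>v root_vec w"
      using W x by (intro bexI[of _ "g *\<^sub>v x"]) auto
    fix x :: "complex vec"
    assume x: "x \<in> carrier_vec n"
    obtain c where "w *\<^sub>v (h *\<^sub>v x) = h *\<^sub>v x + c \<cdot>\<^sub>v root_vec w"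
      using reflection_vec[OF w, of "h *\<^sub>v x"] W x by auto
    then have "v *\<^sub>v x = x + c \<cdot>\<^sub>v (g *\<^sub>v root_vec w)"
      using W a x by (simp add: act cancel mult_add_distrib_mat_vec[of g n n] mult_mat_vec[of g n n])
    then show "\<exists>c. v *\<^sub>v x = x + c \<cdot>\<^sub>v (g *\<^sub>v root_vec w)"
      by blast
  qed
  moreover have "v \<in> W"
    using g W_mult Refl_W w by (auto simp: v_def)
  ultimately have v: "v \<in> Refl"
    using inv is_reflection_iff[OF W_carrier] by (auto simp: Refl_def)
  obtain x where x: "x \<in> carrier_vec n" "v *\<^sub>v x = x + g *\<^sub>v root_vec w"
    using \<open>is_root v (g *\<^sub>v root_vec w)\<close> by (auto simp: is_root_def)
  obtain c where "v *\<^sub>v x = x + c \<cdot>\<^sub>v root_vec v"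
    using reflection_vec[OF v x(1)] by blast
  then have "x + g *\<^sub>v root_vec w = x + c \<cdot>\<^sub>v root_vec v"
    using x by simp
  then have "g *\<^sub>v root_vec w = c \<cdot>\<^sub>v root_vec v"
    using x W a root_carrier[OF v] by (auto simp: vec_eq_iff)
  then show "\<exists>c. g *\<^sub>v root_vec w = c \<cdot>\<^sub>v root_vec (g * w * h)"
    by (auto simp: v_def)
  show "g * w * h \<in> Refl"
    using v by (simp add: v_def)
qed

lemma simple_refl_vec:
  assumes i: "i < n" and v: "v \<in> carrier_vec n"
  shows "s i *\<^sub>v v = v + ((s i *\<^sub>v v) $ i - v $ i) \<cdot>\<^sub>v unit_vec n i"
proof (rule eq_vecI)
  fix r
  assume "r < dim_vec (v + ((s i *\<^sub>v v) $ i - v $ i) \<cdot>\<^sub>v unit_vec n i)"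
  then have r: "r < n"
    by simp
  have S: "s i \<in> carrier_mat n n"
    using s_W W_carrier i by blast
  show "(s i *\<^sub>v v) $ r = (v + ((s i *\<^sub>v v) $ i - v $ i) \<cdot>\<^sub>v unit_vec n i) $ r"
  proof (cases "r = i")
    case True
    then show ?thesis
      using r v by simp
  next
    case False
    have "(s i *\<^sub>v v) $ r = (\<Sum>j<n. s i $$ (r, j) * v $ j)"
      using r v S by (simp add: scalar_prod_def lessThan_atLeast0)
    also have "\<dots> = (\<Sum>j<n. if j = r then v $ j else 0)"
      using r i False s_entry by (intro sum.cong) auto
    finally show ?thesis
      using r i v False by (simp add: sum.delta)
  qed
qed (use s_W[OF i] W_carrier v in auto)

lemma s_Refl:
  assumes i: "i < n"
  shows "s i \<in> Refl"
proof -
  have S: "s i \<in> carrier_mat n n"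
    using s_W W_carrier i by blast
  have "is_root (s i) ((-2) \<cdot>\<^sub>v unit_vec n i)"
    unfolding is_root_def
  proof (intro conjI ballI)
    show "(-2) \<cdot>\<^sub>v unit_vec n i \<noteq> (0\<^sub>v n :: complex vec)"
      using i by (auto simp: vec_eq_iff unit_vec_def)
    have "(s i *\<^sub>v unit_vec n i) $ i = s i $$ (i, i)"
      using S i by simp
    then have "s i *\<^sub>v unit_vec n i = unit_vec n i + (-2) \<cdot>\<^sub>v unit_vec n i"
      using simple_refl_vec[OF i, of "unit_vec n i"] i s_diagonal[OF i] by simp
    then show "\<exists>v\<in>carrier_vec n. s i *\<^sub>v v = v + (-2) \<cdot>\<^sub>v unit_vec n i"
      by (intro bexI[of _ "unit_vec n i"]) auto
    fix v :: "complex vec"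
    assume v: "v \<in> carrier_vec n"
    show "\<exists>c. s i *\<^sub>v v = v + c \<cdot>\<^sub>v ((-2) \<cdot>\<^sub>v unit_vec n i)"
      by (subst simple_refl_vec[OF i v])
         (auto simp: smult_smult_assoc intro!: exI[of _ "((s i *\<^sub>v v) $ i - v $ i) / (-2)"])
  qed simp
  then show ?thesis
    using s_W[OF i] s_involution[OF i] is_reflection_iff[OF S] by (auto simp: Refl_def)
qed


lemma simple_root_vec:
  assumes i: "i < n"
  shows "\<exists>c. root_vec (s i) = c \<cdot>\<^sub>v unit_vec n i"
proof -
  let ?a = "root_vec (s i)"
  have a: "?a \<in> carrier_vec n" and neg: "s i *\<^sub>v ?a = - ?a"
    using s_Refl[OF i] root_carrier reflection_root by auto
  obtain c where c: "- ?a = ?a + c \<cdot>\<^sub>v unit_vec n i"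
    using simple_refl_vec[OF i a] unfolding neg by blast
  have "?a = (?a $ i) \<cdot>\<^sub>v unit_vec n i"
  proof (rule eq_vecI)
    fix k
    assume "k < dim_vec ((?a $ i) \<cdot>\<^sub>v unit_vec n i)"
    then have k: "k < n"
      by simp
    have "- (?a $ k) = ?a $ k + c * unit_vec n i $ k"
      using arg_cong[OF c, of "\<lambda>v. v $ k"] a k by simp
    then show "?a $ k = ((?a $ i) \<cdot>\<^sub>v unit_vec n i) $ k"
      using i k by (cases "k = i") (auto simp: complex_eq_iff)
  qed (use a in simp)
  then show ?thesis ..
qed

text \<open>
  The operator \<open>p \<mapsto> p - m p\<close> is a twisted derivation, \<open>p q - m (p q) = p (q - m q) + (p - m p) m q\<close>,
  so divisibility by \<open>a\<close> only has to be checked on linear polynomials.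
\<close>

lemma transvection_dvd:
  assumes m: "m \<in> carrier_mat n n" and a: "a \<in> carrier_vec n"
    and line: "\<And>v. v \<in> carrier_vec n \<Longrightarrow> \<exists>c. m *\<^sub>v v = v + c \<cdot>\<^sub>v a"
    and p: "p \<in> Pol n"
  shows "\<exists>q\<in>Pol n. p - sym_act m p = linear_poly a * q"
  using p
proof (induction p rule: Pol_induct)
  case (const c)
  show ?case
    by (intro bexI[of _ 0]) auto
next
  case (var i)
  obtain c where "m *\<^sub>v unit_vec n i = unit_vec n i + c \<cdot>\<^sub>v a"
    using line[of "unit_vec n i"] by auto
  then have "sym_act m (pol_var i) = pol_var i + pol_const c * linear_poly a"
    using var m a sym_act_linear_poly[OF m, of "unit_vec n i"]
    by (simp add: linear_poly_add linear_poly_smult linear_poly_unit_vec)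
  then show ?case
    by (intro bexI[of _ "- pol_const c"]) auto
next
  case (add p q)
  then obtain p' q' where "p' \<in> Pol n" "q' \<in> Pol n"
    "p - sym_act m p = linear_poly a * p'" "q - sym_act m q = linear_poly a * q'"
    by blast
  then show ?case
    by (intro bexI[of _ "p' + q'"]) (auto simp: sym_act_add algebra_simps)
next
  case (mult p q)
  then obtain p' q' where *: "p' \<in> Pol n" "q' \<in> Pol n"
    "p - sym_act m p = linear_poly a * p'" "q - sym_act m q = linear_poly a * q'"
    by blast
  have "p * q - sym_act m (p * q) = p * (q - sym_act m q) + (p - sym_act m p) * sym_act m q"
    by (simp add: sym_act_mult algebra_simps)
  also have "\<dots> = linear_poly a * (p * q' + p' * sym_act m q)"
    unfolding * by (simp add: algebra_simps)
  finally show ?case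
    using * mult m by (intro bexI[of _ "p * q' + p' * sym_act m q"]) (auto intro!: sym_act_Pol)
qed

lemma root_poly_Pol [simp]: "root_poly w \<in> Pol n"
  by (simp add: root_poly_def)

lemma root_poly_nonzero: "w \<in> Refl \<Longrightarrow> root_poly w \<noteq> 0"
  using root_carrier root_nonzero linear_poly_eq_0_iff by (auto simp: root_poly_def)

lemma reflection_dvd:
  assumes w: "w \<in> Refl" and p: "p \<in> Pol n"
  shows "\<exists>q\<in>Pol n. p - sym_act w p = root_poly w * q"
  unfolding root_poly_def
  by (rule transvection_dvd) (use w p W_carrier Refl_W root_carrier reflection_vec in auto)

text \<open>
  The polynomials that this projection kills, acting by substitution, are the multiples of the root
  of \<open>w\<close>.  As the symmetric algebra is a domain, this makes the root a prime element.
\<close>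

definition mirror_proj :: "complex mat \<Rightarrow> complex mat"
  where "mirror_proj w = (1 / 2) \<cdot>\<^sub>m (1\<^sub>m n + w)"

lemma mirror_proj_carrier: "w \<in> Refl \<Longrightarrow> mirror_proj w \<in> carrier_mat n n"
  using W_carrier[OF Refl_W] by (simp add: mirror_proj_def)

lemma mirror_proj_vec:
  assumes "w \<in> Refl" "v \<in> carrier_vec n"
  shows "mirror_proj w *\<^sub>v v = (1 / 2) \<cdot>\<^sub>v (v + w *\<^sub>v v)"
proof -
  have W: "w \<in> carrier_mat n n"
    using W_carrier Refl_W assms by blast
  have "((1 / 2) \<cdot>\<^sub>m A) *\<^sub>v v = (1 / 2) \<cdot>\<^sub>v (A *\<^sub>v v)" if "A \<in> carrier_mat n n" for A
    using that assms(2)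
    by (intro eq_vecI) (auto simp: scalar_prod_def sum_distrib_left mult.assoc intro!: sum.cong)
  then show ?thesis
    using W assms(2) by (simp add: mirror_proj_def add_mult_distrib_mat_vec[of _ n n])
qed

lemma mirror_proj_mult:
  assumes w: "w \<in> Refl"
  shows "mirror_proj w * w = mirror_proj w"
proof (rule mat_eqI_vec)
  fix x :: "complex vec"
  assume x: "x \<in> carrier_vec n"
  have W: "w \<in> carrier_mat n n"
    using W_carrier Refl_W w by blast
  have "mirror_proj w * w *\<^sub>v x = mirror_proj w *\<^sub>v (w *\<^sub>v x)"
    using W x mirror_proj_carrier[OF w] by simp
  also have "\<dots> = (1 / 2) \<cdot>\<^sub>v (w *\<^sub>v x + x)"
    using W x by (simp add: mirror_proj_vec w involution_vec)
  also have "\<dots> = mirror_proj w *\<^sub>v x"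
    using W x comm_add_vec[of "w *\<^sub>v x" n x] by (simp add: mirror_proj_vec w)
  finally show "mirror_proj w * w *\<^sub>v x = mirror_proj w *\<^sub>v x" .
qed (use mirror_proj_carrier[OF w] W_carrier[OF Refl_W[OF w]] in auto)

text \<open>
  If the projection kills the root of \<open>w'\<close>, then \<open>w\<close> negates that root, which is therefore
  proportional to the root of \<open>w\<close>.
\<close>

lemma mirror_proj_root_poly:
  assumes w: "w \<in> Refl" and w': "w' \<in> Refl"
  shows "sym_act (mirror_proj w) (root_poly w') = 0 \<longleftrightarrow> w' = w"
proof -
  have W: "w \<in> carrier_mat n n"
    using W_carrier Refl_W w by blast
  note a' = root_carrier[OF w'] and a = root_carrier[OF w]
  have "sym_act (mirror_proj w) (root_poly w') = linear_poly ((1 / 2) \<cdot>\<^sub>v (root_vec w' + w *\<^sub>v root_vec w'))"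
    using sym_act_linear_poly[OF mirror_proj_carrier[OF w] a'] a'
    by (simp add: root_poly_def mirror_proj_vec w)
  also have "\<dots> = 0 \<longleftrightarrow> (1 / 2) \<cdot>\<^sub>v (root_vec w' + w *\<^sub>v root_vec w') = 0\<^sub>v n"
    using a' W by (intro linear_poly_eq_0_iff) simp
  also have "\<dots> \<longleftrightarrow> w *\<^sub>v root_vec w' = - root_vec w'"
    using a' W by (auto simp: vec_eq_iff add_eq_0_iff)
  also have "\<dots> \<longleftrightarrow> w' = w"
  proof
    assume *: "w *\<^sub>v root_vec w' = - root_vec w'"
    obtain c where "w *\<^sub>v root_vec w' = root_vec w' + c \<cdot>\<^sub>v root_vec w"
      using reflection_vec[OF w a'] by blast
    then have eq: "- root_vec w' = root_vec w' + c \<cdot>\<^sub>v root_vec w"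
      using * by simp
    have "root_vec w' = (- c / 2) \<cdot>\<^sub>v root_vec w"
    proof (rule eq_vecI)
      fix i
      assume "i < dim_vec ((- c / 2) \<cdot>\<^sub>v root_vec w)"
      then have "i < n"
        using a by simp
      then have "- (root_vec w' $ i) = root_vec w' $ i + c * root_vec w $ i"
        using arg_cong[OF eq, of "\<lambda>v. v $ i"] a a' by simp
      moreover have "x = - y / 2" if "- x = x + y" for x y :: complex
      proof (rule complex_eqI)
        show "Re x = Re (- y / 2)"
          using arg_cong[OF that, of Re] by simp
        show "Im x = Im (- y / 2)"
          using arg_cong[OF that, of Im] by simp
      qed
      ultimately have "root_vec w' $ i = - (c * root_vec w $ i) / 2"
        by blast
      then show "root_vec w' $ i = ((- c / 2) \<cdot>\<^sub>v root_vec w) $ i"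
        using \<open>i < n\<close> a by (simp add: field_simps)
    qed (use a a' in auto)
    then show "w' = w"
      by (rule roots_not_proportional[OF w w'])
  qed (use reflection_root[OF w] in auto)
  finally show ?thesis .
qed

lemma root_poly_dvd_iff:
  assumes w: "w \<in> Refl" and p: "p \<in> Pol n"
  shows "(\<exists>q\<in>Pol n. p = root_poly w * q) \<longleftrightarrow> sym_act (mirror_proj w) p = 0"
proof
  assume "\<exists>q\<in>Pol n. p = root_poly w * q"
  then show "sym_act (mirror_proj w) p = 0"
    using mirror_proj_root_poly[OF w w] by (auto simp: sym_act_mult)
next
  assume *: "sym_act (mirror_proj w) p = 0"
  have W: "w \<in> carrier_mat n n" and a: "root_vec w \<in> carrier_vec n"
    using W_carrier Refl_W w root_carrier by auto
  have "\<exists>q\<in>Pol n. p - sym_act (mirror_proj w) p = root_poly w * q"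
    unfolding root_poly_def
  proof (rule transvection_dvd[OF mirror_proj_carrier[OF w] a _ p])
    fix v :: "complex vec"
    assume v: "v \<in> carrier_vec n"
    obtain c where c: "w *\<^sub>v v = v + c \<cdot>\<^sub>v root_vec w"
      using reflection_vec[OF w v] by blast
    have "mirror_proj w *\<^sub>v v = v + (c / 2) \<cdot>\<^sub>v root_vec w"
      unfolding mirror_proj_vec[OF w v] c using v a by (auto simp: vec_eq_iff field_simps)
    then show "\<exists>c. mirror_proj w *\<^sub>v v = v + c \<cdot>\<^sub>v root_vec w" ..
  qed
  then show "\<exists>q\<in>Pol n. p = root_poly w * q"
    by (simp add: *)
qed

definition Delta :: mpoly
  where "Delta = (\<Prod>w\<in>Refl. root_poly w)"

lemma Delta_Pol [simp]: "Delta \<in> Pol n"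
  unfolding Delta_def by (intro Pol_prod) auto

lemma Delta_nonzero: "Delta \<noteq> 0"
  by (simp add: Delta_def root_poly_nonzero)

lemma Delta_degree: "Delta \<in> sym_power n (card Refl)"
  using sym_power_prod[of Refl root_poly n "\<lambda>_. 1"] linear_poly_degree
  by (simp add: Delta_def root_poly_def)

text \<open>
  The roots of distinct reflections are primes that do not divide one another.
\<close>

lemma Delta_dvd:
  assumes p: "p \<in> Pol n" and dvd: "\<And>w. w \<in> Refl \<Longrightarrow> \<exists>q\<in>Pol n. p = root_poly w * q"
  shows "\<exists>q\<in>Pol n. p = Delta * q"
proof -
  have "\<exists>q\<in>Pol n. p = (\<Prod>w\<in>F. root_poly w) * q" if "finite F" "F \<subseteq> Refl" for F
    using that
  proof (induction F)
    case empty
    then show ?case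
      using p by simp
  next
    case (insert w F)
    then obtain q where q: "q \<in> Pol n" "p = (\<Prod>w\<in>F. root_poly w) * q"
      by auto
    have w: "w \<in> Refl"
      using insert by simp
    have "sym_act (mirror_proj w) p = 0"
      using root_poly_dvd_iff[OF w p] dvd[OF w] by simp
    then have "(\<Prod>w'\<in>F. sym_act (mirror_proj w) (root_poly w')) * sym_act (mirror_proj w) q = 0"
      by (simp add: q(2) sym_act_mult sym_act_prod)
    moreover have "sym_act (mirror_proj w) (root_poly w') \<noteq> 0" if "w' \<in> F" for w'
      using that insert mirror_proj_root_poly[OF w, of w'] by auto
    ultimately have "sym_act (mirror_proj w) q = 0"
      using insert by auto
    then obtain q' where "q' \<in> Pol n" "q = root_poly w * q'"
      using root_poly_dvd_iff[OF w q(1)] by auto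
    then show ?case
      using insert q by (intro bexI[of _ q']) (auto simp: algebra_simps)
  qed
  from this[of Refl] show ?thesis
    by (simp add: Delta_def)
qed

end


section \<open>The sign character and alternation\<close>

context reflection_group
begin

lemma sym_act_Delta:
  assumes g: "g \<in> W"
  shows "\<exists>c. sym_act g Delta = pol_const c * Delta"
proof -
  obtain h where h: "h \<in> W" "h * g = 1\<^sub>m n" "g * h = 1\<^sub>m n"
    using W_inv[OF g] by blast
  have W: "g \<in> carrier_mat n n" "h \<in> carrier_mat n n"
    using g h W_carrier by auto
  have "\<exists>c. sym_act g (root_poly w) = pol_const c * root_poly (g * w * h)" if w: "w \<in> Refl" for w
  proof -
    have v: "g * w * h \<in> Refl"
      by (rule conjugate_reflection[OF g h(1) h(3) h(2) w])
    obtain c where "g *\<^sub>v root_vec w = c \<cdot>\<^sub>v root_vec (g * w * h)"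
      using conjugate_reflection(2)[OF g h(1) h(3) h(2) w] by blast
    then show ?thesis
      using sym_act_linear_poly[OF W(1) root_carrier[OF w]] linear_poly_smult[OF root_carrier[OF v]]
      unfolding root_poly_def by metis
  qed
  then obtain c where c: "\<And>w. w \<in> Refl \<Longrightarrow>
      sym_act g (root_poly w) = pol_const (c w) * root_poly (g * w * h)"
    by metis
  have cancel: "g * (h * w * g) * h = w" "h * (g * w * h) * g = w" if "w \<in> carrier_mat n n" for w
  proof -
    have "g * (h * w * g) * h = (g * h) * w * (g * h)" "h * (g * w * h) * g = (h * g) * w * (h * g)"
      using W that by (simp_all add: assoc_mult_mat[of _ n n _ n _ n])
    then show "g * (h * w * g) * h = w" "h * (g * w * h) * g = w"
      using h that by simp_all
  qed
  have bij: "bij_betw (\<lambda>w. g * w * h) Refl Refl"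
    by (rule bij_betw_byWitness[of _ "\<lambda>w. h * w * g"])
       (use g h conjugate_reflection(1) cancel W_carrier[OF Refl_W] in auto)
  have "sym_act g Delta = (\<Prod>w\<in>Refl. pol_const (c w) * root_poly (g * w * h))"
    by (simp add: Delta_def sym_act_prod c)
  also have "\<dots> = (\<Prod>w\<in>Refl. pol_const (c w)) * (\<Prod>w\<in>Refl. root_poly (g * w * h))"
    by (rule prod.distrib)
  also have "(\<Prod>w\<in>Refl. root_poly (g * w * h)) = Delta"
    unfolding Delta_def by (rule prod.reindex_bij_betw[OF bij])
  also have "(\<Prod>w\<in>F. pol_const (c w)) = pol_const (\<Prod>w\<in>F. c w)" if "finite F" for F
    using that by (induction F) (simp_all add: mult_single)
  from this[OF finite_Refl] have "(\<Prod>w\<in>Refl. pol_const (c w)) = pol_const (\<Prod>w\<in>Refl. c w)" .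
  finally show ?thesis
    by blast
qed

text \<open>
  The character by which the group acts on \<open>\<Delta>\<close>.  It agrees with the determinant; in this form, its
  value on a reflection can be read off from the factorization of \<open>\<Delta>\<close>.
\<close>

definition sign :: "complex mat \<Rightarrow> complex"
  where "sign w = (SOME c. sym_act w Delta = pol_const c * Delta)"

lemma sym_act_Delta_sign: "w \<in> W \<Longrightarrow> sym_act w Delta = pol_const (sign w) * Delta"
  unfolding sign_def using sym_act_Delta by (rule someI_ex)

lemma sign_unique:
  assumes "w \<in> W" "sym_act w Delta = pol_const c * Delta"
  shows "sign w = c"
proof -
  have "pol_const (sign w) = pol_const c"
    using assms sym_act_Delta_sign Delta_nonzero by (metis mult_right_cancel)
  then show ?thesis
    by (metis lookup_single_eq)
qed

lemma sign_mult:
  assumes "v \<in> W" "w \<in> W"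
  shows "sign (v * w) = sign v * sign w"
proof (rule sign_unique)
  show "sym_act (v * w) Delta = pol_const (sign v * sign w) * Delta"
    using assms W_carrier sym_act_compose[of v n w Delta]
    by (simp add: sym_act_Delta_sign sym_act_scale pol_const_mult mult.commute[of "sign v"])
qed (use assms W_mult in auto)

lemma sign_one: "sign (1\<^sub>m n) = 1"
  by (rule sign_unique) (simp_all add: W_one sym_act_1[of _ n])

text \<open>
  With \<open>\<Delta> = a q\<close>, the projection onto the mirror of the reflection with root \<open>a\<close> does not kill
  the product \<open>q\<close> of the other roots, but it does not distinguish \<open>q\<close> and its mirror image.
\<close>

lemma sign_reflection:
  assumes w: "w \<in> Refl"
  shows "sign w = - 1"
proof -
  let ?q = "\<Prod>v\<in>Refl - {w}. root_poly v" and ?m = "mirror_proj w"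
  have W: "w \<in> carrier_mat n n"
    using W_carrier Refl_W w by blast
  have q: "?q \<in> Pol n"
    by (intro Pol_prod) auto
  have Delta: "Delta = root_poly w * ?q"
    using w by (simp add: Delta_def prod.remove)
  have "- root_vec w = (- 1) \<cdot>\<^sub>v root_vec w"
    by (auto simp: vec_eq_iff)
  then have "linear_poly (- root_vec w) = - root_poly w"
    using linear_poly_smult[OF root_carrier[OF w], of "- 1"]
    by (simp add: root_poly_def single_uminus)
  then have "sym_act w (root_poly w) = - root_poly w"
    using sym_act_linear_poly[OF W root_carrier[OF w]] reflection_root[OF w]
    by (simp add: root_poly_def)
  then have "root_poly w * (- sym_act w ?q) = root_poly w * (pol_const (sign w) * ?q)"
    using sym_act_Delta_sign[OF Refl_W[OF w]] by (simp add: Delta sym_act_mult algebra_simps)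
  then have "- sym_act w ?q = pol_const (sign w) * ?q"
    using root_poly_nonzero[OF w] by (metis mult_left_cancel)
  then have "sym_act ?m (- sym_act w ?q) = pol_const (sign w) * sym_act ?m ?q"
    by (simp add: sym_act_scale)
  moreover have "sym_act ?m (sym_act w ?q) = sym_act ?m ?q"
    using sym_act_compose[OF mirror_proj_carrier[OF w] W q] mirror_proj_mult[OF w] by simp
  ultimately have "pol_const (- 1) * sym_act ?m ?q = pol_const (sign w) * sym_act ?m ?q"
    by (simp add: sym_act_uminus single_uminus)
  moreover have "sym_act ?m ?q \<noteq> 0"
    using mirror_proj_root_poly[OF w] by (auto simp: sym_act_prod)
  ultimately have "pol_const (- 1) = pol_const (sign w)"
    by (metis mult_right_cancel)
  then show ?thesis
    by (metis lookup_single_eq)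
qed

lemma sign_s: "i < n \<Longrightarrow> sign (s i) = - 1"
  by (simp add: sign_reflection s_Refl)

lemma sign_cases: "w \<in> W \<Longrightarrow> sign w = 1 \<or> sign w = - 1"
  by (induction w rule: W_induct) (auto simp: sign_one sign_mult s_W sign_s)

lemma sign_square: "w \<in> W \<Longrightarrow> sign w * sign w = 1"
  using sign_cases by fastforce

lemma W_dim [simp]: "w \<in> W \<Longrightarrow> dim_row w = n"
  using W_carrier by blast

lemma W_sym_act_Pol [simp]: "w \<in> W \<Longrightarrow> sym_act w p \<in> Pol n"
  by (simp add: sym_act_Pol)

lemma W_sym_act_compose:
  "v \<in> W \<Longrightarrow> w \<in> W \<Longrightarrow> p \<in> Pol n \<Longrightarrow> sym_act (v * w) p = sym_act v (sym_act w p)"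
  using W_carrier sym_act_compose by blast

lemma anti_invariant_dvd:
  assumes p: "p \<in> Pol n" and anti: "\<And>w. w \<in> W \<Longrightarrow> sym_act w p = pol_const (sign w) * p"
  shows "\<exists>q\<in>Pol n. p = Delta * q"
proof (rule Delta_dvd[OF p])
  fix w
  assume w: "w \<in> Refl"
  obtain q where q: "q \<in> Pol n" "p - sym_act w p = root_poly w * q"
    using reflection_dvd[OF w p] by blast
  have "pol_const (1 / 2) + pol_const (1 / 2) = (1 :: mpoly)"
    by (simp flip: single_add)
  moreover have "p - sym_act w p = p + p"
    using anti[OF Refl_W[OF w]] sign_reflection[OF w] by (simp add: single_uminus)
  ultimately have "p = pol_const (1 / 2) * (p - sym_act w p)"
    by (metis distrib_left distrib_right mult_1)
  also have "\<dots> = root_poly w * (pol_const (1 / 2) * q)"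
    unfolding q(2) by (simp add: algebra_simps)
  finally show "\<exists>q\<in>Pol n. p = root_poly w * q"
    using q(1) by (intro bexI[of _ "pol_const (1 / 2) * q"]) auto
qed

definition alternation :: "mpoly \<Rightarrow> mpoly"
  where "alternation p = (\<Sum>w\<in>W. pol_const (sign w) * sym_act w p)"

lemma W_translate_left:
  assumes g: "g \<in> W"
  shows "bij_betw (\<lambda>w. g * w) W W"
proof -
  obtain h where h: "h \<in> W" "h * g = 1\<^sub>m n" "g * h = 1\<^sub>m n"
    using W_inv[OF g] by blast
  have "h * (g * w) = w" "g * (h * w) = w" if "w \<in> W" for w
  proof -
    have "h * (g * w) = h * g * w" "g * (h * w) = g * h * w"
      using W_carrier g h(1) that by (metis assoc_mult_mat)+
    then show "h * (g * w) = w" "g * (h * w) = w"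
      using h W_carrier[OF that] by simp_all
  qed
  then show ?thesis
    by (intro bij_betw_byWitness[of _ "\<lambda>w. h * w"]) (use g h W_mult in auto)
qed

lemma W_translate_right:
  assumes g: "g \<in> W"
  shows "bij_betw (\<lambda>w. w * g) W W"
proof -
  obtain h where h: "h \<in> W" "h * g = 1\<^sub>m n" "g * h = 1\<^sub>m n"
    using W_inv[OF g] by blast
  have "w * g * h = w" "w * h * g = w" if "w \<in> W" for w
  proof -
    have "w * g * h = w * (g * h)" "w * h * g = w * (h * g)"
      using W_carrier g h(1) that by (metis assoc_mult_mat)+
    then show "w * g * h = w" "w * h * g = w"
      using h W_carrier[OF that] by simp_all
  qed
  then show ?thesis
    by (intro bij_betw_byWitness[of _ "\<lambda>w. w * h"]) (use g h W_mult in auto)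
qed

lemma alternation_Pol [simp]: "p \<in> Pol n \<Longrightarrow> alternation p \<in> Pol n"
  unfolding alternation_def by (intro Pol_sum Pol_mult) auto

lemma sign_shift: "g \<in> W \<Longrightarrow> w \<in> W \<Longrightarrow> sign w = sign g * sign (g * w)"
  using sign_square[of g] by (simp add: sign_mult mult.assoc[symmetric])

lemma sym_act_alternation:
  assumes g: "g \<in> W" and p: "p \<in> Pol n"
  shows "sym_act g (alternation p) = pol_const (sign g) * alternation p"
proof -
  have "sym_act g (alternation p) = (\<Sum>w\<in>W. pol_const (sign w) * sym_act (g * w) p)"
    using g p by (simp add: alternation_def sym_act_sum sym_act_scale W_sym_act_compose)
  also have "\<dots> = (\<Sum>w\<in>W. pol_const (sign g) * (pol_const (sign (g * w)) * sym_act (g * w) p))"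
    using sign_shift[OF g] by (intro sum.cong) (simp_all add: pol_const_mult)
  also have "\<dots> = (\<Sum>w\<in>W. pol_const (sign g) * (pol_const (sign w) * sym_act w p))"
    by (rule sum.reindex_bij_betw[OF W_translate_left[OF g]])
  finally show ?thesis
    by (simp add: alternation_def sum_distrib_left)
qed

lemma alternation_sym_act:
  assumes g: "g \<in> W" and p: "p \<in> Pol n"
  shows "alternation (sym_act g p) = pol_const (sign g) * alternation p"
proof -
  have "alternation (sym_act g p) = (\<Sum>w\<in>W. pol_const (sign w) * sym_act (w * g) p)"
    using g p by (simp add: alternation_def W_sym_act_compose)
  also have "\<dots> = (\<Sum>w\<in>W. pol_const (sign g) * (pol_const (sign (w * g)) * sym_act (w * g) p))"
  proof (rule sum.cong[OF refl])
    fix w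
    assume w: "w \<in> W"
    have "sign g * sign (w * g) = sign w * (sign g * sign g)"
      unfolding sign_mult[OF w g] by (simp only: mult.left_commute)
    then show "pol_const (sign w) * sym_act (w * g) p =
        pol_const (sign g) * (pol_const (sign (w * g)) * sym_act (w * g) p)"
      using sign_square[OF g] by (simp add: pol_const_mult)
  qed
  also have "\<dots> = (\<Sum>w\<in>W. pol_const (sign g) * (pol_const (sign w) * sym_act w p))"
    by (rule sum.reindex_bij_betw[OF W_translate_right[OF g]])
  finally show ?thesis
    by (simp add: alternation_def sum_distrib_left)
qed

lemma alternation_add: "alternation (p + q) = alternation p + alternation q"
  by (simp add: alternation_def sym_act_add distrib_left sum.distrib)

lemma alternation_invariant_mult:
  assumes "\<And>w. w \<in> W \<Longrightarrow> sym_act w f = f"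
  shows "alternation (f * p) = f * alternation p"
  using assms by (simp add: alternation_def sym_act_mult sum_distrib_left algebra_simps)

text \<open>
  The quotient by \<open>\<Delta>\<close> exists because an alternating sum transforms by the sign character.
\<close>

definition alternation_quotient :: "mpoly \<Rightarrow> mpoly"
  where "alternation_quotient p = (SOME q. q \<in> Pol n \<and> alternation p = Delta * q)"

lemma alternation_quotient:
  assumes "p \<in> Pol n"
  shows "alternation_quotient p \<in> Pol n" "alternation p = Delta * alternation_quotient p"
proof -
  have "\<exists>q. q \<in> Pol n \<and> alternation p = Delta * q"
    using anti_invariant_dvd[of "alternation p"] sym_act_alternation assms by auto
  from someI_ex[OF this] show "alternation_quotient p \<in> Pol n"
    "alternation p = Delta * alternation_quotient p"
    by (simp_all add: alternation_quotient_def)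
qed

lemma alternation_quotient_unique:
  "p \<in> Pol n \<Longrightarrow> alternation p = Delta * q \<Longrightarrow> alternation_quotient p = q"
  using alternation_quotient(2) Delta_nonzero by (metis mult_left_cancel)

text \<open>
  The linear form \<open>\<phi>\<close> that induces the duality.  The name refers to the top degree of the coinvariant
  algebra, its socle, on which \<open>\<phi>\<close> is a coordinate.
\<close>

definition socle_form :: "mpoly \<Rightarrow> complex"
  where "socle_form p = lookup (alternation_quotient p) 0"

lemma socle_form_add:
  assumes "p \<in> Pol n" "q \<in> Pol n"
  shows "socle_form (p + q) = socle_form p + socle_form q"
proof -
  have "alternation_quotient (p + q) = alternation_quotient p + alternation_quotient q"
    using assms alternation_quotient(2)
    by (intro alternation_quotient_unique) (auto simp: alternation_add distrib_left)
  then show ?thesis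
    by (simp add: socle_form_def lookup_add)
qed

lemma socle_form_invariant_mult:
  assumes "p \<in> Pol n" "f \<in> Pol n" "\<And>w. w \<in> W \<Longrightarrow> sym_act w f = f"
  shows "socle_form (f * p) = lookup f 0 * socle_form p"
proof -
  have "alternation_quotient (f * p) = f * alternation_quotient p"
    using assms alternation_quotient(2)[OF assms(1)]
    by (intro alternation_quotient_unique) (auto simp: alternation_invariant_mult algebra_simps)
  then show ?thesis
    by (simp add: socle_form_def lookup_mult_0)
qed

lemma socle_form_scale: "p \<in> Pol n \<Longrightarrow> socle_form (pol_const c * p) = c * socle_form p"
  by (subst socle_form_invariant_mult) auto

lemma socle_form_zero [simp]: "socle_form 0 = 0"
  using socle_form_scale[of 0 0] by simp

lemma socle_form_sum:
  "(\<And>i. i \<in> A \<Longrightarrow> f i \<in> Pol n) \<Longrightarrow> socle_form (sum f A) = (\<Sum>i\<in>A. socle_form (f i))"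
  by (induction A rule: infinite_finite_induct) (auto simp: socle_form_add Pol_sum)

lemma socle_form_sym_act:
  assumes g: "g \<in> W" and p: "p \<in> Pol n"
  shows "socle_form (sym_act g p) = sign g * socle_form p"
proof -
  have "alternation_quotient (sym_act g p) = pol_const (sign g) * alternation_quotient p"
    using g p alternation_quotient(2)[OF p]
    by (intro alternation_quotient_unique) (auto simp: alternation_sym_act algebra_simps)
  then show ?thesis
    by (simp add: socle_form_def lookup_mult_0)
qed

text \<open>
  Both \<open>\<Delta>\<close> and its multiple, the alternating sum, transform by the sign character.
\<close>

lemma alternation_quotient_invariant:
  assumes g: "g \<in> W" and p: "p \<in> Pol n"
  shows "sym_act g (alternation_quotient p) = alternation_quotient p"
proof -
  have "pol_const (sign g) * alternation p = sym_act g (alternation p)"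
    by (rule sym_act_alternation[OF g p, symmetric])
  also have "\<dots> = sym_act g (Delta * alternation_quotient p)"
    by (rule arg_cong[OF alternation_quotient(2)[OF p]])
  also have "\<dots> = pol_const (sign g) * Delta * sym_act g (alternation_quotient p)"
    by (simp only: sym_act_mult sym_act_Delta_sign[OF g])
  finally have "pol_const (sign g) * alternation p =
      pol_const (sign g) * Delta * sym_act g (alternation_quotient p)" .
  moreover have "pol_const (sign g) \<noteq> 0"
    using sign_cases[OF g] by (metis lookup_single_eq lookup_zero neg_equal_0_iff_equal zero_neq_one)
  ultimately have "Delta * alternation_quotient p = Delta * sym_act g (alternation_quotient p)"
    using alternation_quotient(2)[OF p] by (metis mult.assoc mult_left_cancel)
  then show ?thesis
    using Delta_nonzero by simp
qed

text \<open>
  In \<open>\<Delta> h\<close> the constant term of \<open>h\<close> is visible in the degree of \<open>\<Delta>\<close> only.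
\<close>

lemma socle_form_degree:
  assumes p: "p \<in> sym_power n d" and d: "d \<noteq> card Refl"
  shows "socle_form p = 0"
proof -
  have P: "p \<in> Pol n"
    using p by (rule sym_power_Pol)
  have "alternation p \<in> sym_power n d"
    unfolding alternation_def by (intro sym_power_sum sym_power_scale sym_act_degree p) auto
  then have "homog (card Refl + 0) (alternation p) = 0"
    using d by (simp add: homog_of_sym_power)
  also have "homog (card Refl + 0) (alternation p) = Delta * pol_const (socle_form p)"
    using homog_mult(1)[OF Delta_degree alternation_quotient(1)[OF P], of 0] alternation_quotient(2)[OF P]
    by (simp add: homog_0 socle_form_def)
  finally have "pol_const (socle_form p) = 0"
    using Delta_nonzero by (metis mult_eq_0_iff)
  then show ?thesis
    by (metis lookup_single_eq lookup_zero)
qed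

end


section \<open>The coinvariant ideal\<close>

context reflection_group
begin

definition invariants :: "mpoly set"
  where "invariants = {p. (\<exists>k>0. p \<in> sym_power n k) \<and> (\<forall>w\<in>W. sym_act w p = p)}"

definition inv_ideal :: "mpoly set"
  where "inv_ideal = Idl\<^bsub>sym_algebra n\<^esub> invariants"

end

lemma sym_algebra_simps:
  "\<zero>\<^bsub>sym_algebra n\<^esub> = 0" "\<one>\<^bsub>sym_algebra n\<^esub> = 1" "add (sym_algebra n) = (+)" "mult (sym_algebra n) = (*)"
  "c \<odot>\<^bsub>sym_algebra n\<^esub> p = pol_const c * p"
  by (simp_all add: sym_algebra_def monoid_algebra_def mult_map_scale_conv_mult)

lemma sym_algebra_cring: "cring (sym_algebra n)"
proof (rule cringI)
  show "abelian_group (sym_algebra n)"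
    by (rule abelian_groupI)
       (auto simp: sym_algebra_simps add.assoc intro: add.commute bexI[of _ "- _"])
  show "comm_monoid (sym_algebra n)"
    by (rule comm_monoidI) (auto simp: sym_algebra_simps mult.assoc mult.commute)
qed (auto simp: sym_algebra_simps distrib_right)

lemma sym_algebra_minus: "p \<in> Pol n \<Longrightarrow> \<ominus>\<^bsub>sym_algebra n\<^esub> p = - p"
proof -
  assume p: "p \<in> Pol n"
  interpret cring "sym_algebra n"
    by (rule sym_algebra_cring)
  show ?thesis
    by (rule minus_equality) (use p in \<open>auto simp: sym_algebra_simps\<close>)
qed

lemma sym_algebra_ideal:
  assumes "J \<subseteq> Pol n" "0 \<in> J" "\<And>p q. p \<in> J \<Longrightarrow> q \<in> J \<Longrightarrow> p + q \<in> J"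
    and mult: "\<And>p q. p \<in> Pol n \<Longrightarrow> q \<in> J \<Longrightarrow> p * q \<in> J"
  shows "ideal J (sym_algebra n)"
proof -
  interpret cring "sym_algebra n"
    by (rule sym_algebra_cring)
  have neg: "- p \<in> J" if "p \<in> J" for p
    using mult[of "- 1" p] that by (simp add: Pol_uminus)
  have "subgroup J (add_monoid (sym_algebra n))"
    by (rule add.subgroupI)
       (use assms neg sym_algebra_minus in \<open>auto simp: sym_algebra_simps a_inv_def[symmetric]\<close>)
  moreover have "q * p \<in> J" if "p \<in> Pol n" "q \<in> J" for p q
    using mult[OF that] by (simp add: mult.commute)
  ultimately show ?thesis
    by (intro idealI) (use mult in \<open>auto simp: sym_algebra_simps intro: cring.axioms(1)[OF sym_algebra_cring]\<close>)
qed

context reflection_group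
begin

lemma invariants_Pol: "invariants \<subseteq> Pol n"
  using sym_power_Pol by (auto simp: invariants_def)

lemma ideal_inv_ideal: "ideal inv_ideal (sym_algebra n)"
  unfolding inv_ideal_def
  by (rule ring.genideal_ideal[OF cring.axioms(1)[OF sym_algebra_cring] invariants_Pol])

lemma inv_ideal_Pol: "p \<in> inv_ideal \<Longrightarrow> p \<in> Pol n"
  using additive_subgroup.a_Hcarr[OF ideal.axioms(1)[OF ideal_inv_ideal]] .

lemma inv_ideal_zero [simp]: "0 \<in> inv_ideal"
  using additive_subgroup.zero_closed[OF ideal.axioms(1)[OF ideal_inv_ideal]]
  by (simp add: sym_algebra_simps)

lemma inv_ideal_add: "p \<in> inv_ideal \<Longrightarrow> q \<in> inv_ideal \<Longrightarrow> p + q \<in> inv_ideal"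
  using additive_subgroup.a_closed[OF ideal.axioms(1)[OF ideal_inv_ideal]]
  by (simp add: sym_algebra_simps)

lemma inv_ideal_mult: "p \<in> Pol n \<Longrightarrow> q \<in> inv_ideal \<Longrightarrow> p * q \<in> inv_ideal"
  using ideal.I_l_closed[OF ideal_inv_ideal] by (simp add: sym_algebra_simps)

lemma inv_ideal_mult_right: "p \<in> Pol n \<Longrightarrow> q \<in> inv_ideal \<Longrightarrow> q * p \<in> inv_ideal"
  using inv_ideal_mult by (simp add: mult.commute)

lemma inv_ideal_uminus: "p \<in> inv_ideal \<Longrightarrow> - p \<in> inv_ideal"
  using inv_ideal_mult[of "- 1" p] by (simp add: Pol_uminus)

lemma inv_ideal_diff: "p \<in> inv_ideal \<Longrightarrow> q \<in> inv_ideal \<Longrightarrow> p - q \<in> inv_ideal"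
  using inv_ideal_add[OF _ inv_ideal_uminus] by fastforce

lemma inv_ideal_sum: "(\<And>i. i \<in> A \<Longrightarrow> f i \<in> inv_ideal) \<Longrightarrow> sum f A \<in> inv_ideal"
  by (induction A rule: infinite_finite_induct) (auto intro: inv_ideal_add)

lemma inv_ideal_generator: "p \<in> invariants \<Longrightarrow> p \<in> inv_ideal"
  using ring.genideal_self[OF cring.axioms(1)[OF sym_algebra_cring] invariants_Pol]
  by (auto simp: inv_ideal_def)

lemma inv_ideal_induct [consumes 1, case_names generator zero add mult]:
  assumes p: "p \<in> inv_ideal"
    and gen: "\<And>p. p \<in> invariants \<Longrightarrow> P p"
    and zero: "P 0"
    and add: "\<And>p q. p \<in> inv_ideal \<Longrightarrow> q \<in> inv_ideal \<Longrightarrow> P p \<Longrightarrow> P q \<Longrightarrow> P (p + q)"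
    and mult: "\<And>p q. p \<in> Pol n \<Longrightarrow> q \<in> inv_ideal \<Longrightarrow> P q \<Longrightarrow> P (p * q)"
  shows "P p"
proof -
  have "ideal {p \<in> inv_ideal. P p} (sym_algebra n)"
    by (rule sym_algebra_ideal) (use inv_ideal_Pol zero add mult inv_ideal_add inv_ideal_mult in auto)
  then have "inv_ideal \<subseteq> {p \<in> inv_ideal. P p}"
    unfolding inv_ideal_def[of]
    by (rule ring.genideal_minimal[OF cring.axioms(1)[OF sym_algebra_cring]])
       (use gen inv_ideal_generator in \<open>auto simp: inv_ideal_def\<close>)
  then show ?thesis
    using p by blast
qed

lemma inv_ideal_sym_act:
  assumes w: "w \<in> W" and p: "p \<in> inv_ideal"
  shows "sym_act w p \<in> inv_ideal"
  using p
proof (induction p rule: inv_ideal_induct)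
  case (generator p)
  then have "sym_act w p = p"
    using w by (auto simp: invariants_def)
  then show ?case
    using generator inv_ideal_generator by simp
qed (use w in \<open>auto simp: sym_act_add sym_act_mult intro: inv_ideal_add inv_ideal_mult\<close>)

lemma inv_ideal_pol_cnj:
  assumes p: "p \<in> inv_ideal"
  shows "pol_cnj p \<in> inv_ideal"
  using p
proof (induction p rule: inv_ideal_induct)
  case (generator p)
  have "sym_act w (pol_cnj p) = pol_cnj p" if "w \<in> W" for w
    using pol_cnj_sym_act[of w n p] generator that W_real sym_power_Pol
    by (auto simp: invariants_def)
  then have "pol_cnj p \<in> invariants"
    using generator by (auto simp: invariants_def)
  then show ?case
    by (rule inv_ideal_generator)
qed (auto simp: pol_cnj_add pol_cnj_mult intro: inv_ideal_add inv_ideal_mult)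

text \<open>
  An invariant of positive degree is a factor of the quotient \<open>h\<close>, whose constant term then vanishes.
\<close>

lemma socle_form_inv_ideal:
  assumes p: "p \<in> inv_ideal" and q: "q \<in> Pol n"
  shows "socle_form (p * q) = 0"
  using p q
proof (induction p arbitrary: q rule: inv_ideal_induct)
  case (generator p)
  then obtain k where k: "k > 0" "p \<in> sym_power n k" "\<And>w. w \<in> W \<Longrightarrow> sym_act w p = p"
    by (auto simp: invariants_def)
  then have "0 \<notin> keys p"
    by (auto simp: sym_power_iff)
  then have "lookup p 0 = 0"
    by (simp add: in_keys_iff)
  then show ?case
    using socle_form_invariant_mult[OF generator(2) _ k(3)] sym_power_Pol[OF k(2)] by simp
next
  case (add p p')
  then show ?case
    using inv_ideal_Pol by (simp add: distrib_right socle_form_add Pol_mult)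
next
  case (mult r p)
  then show ?case
    using mult.IH[of "r * q"] by (simp add: Pol_mult mult.assoc mult.left_commute)
qed simp

text \<open>
  The twisted Leibniz rule \<open>r p - s(r p) = (r - s r) p + s r (p - s p)\<close> shows that the divided
  difference along a root maps the ideal to itself.
\<close>

lemma divided_difference_inv_ideal:
  assumes i: "i < n" and p: "p \<in> inv_ideal"
  shows "\<exists>q\<in>inv_ideal. p - sym_act (s i) p = pol_var i * q"
  using p
proof (induction p rule: inv_ideal_induct)
  case (generator p)
  then have "sym_act (s i) p = p"
    using s_W[OF i] by (auto simp: invariants_def)
  then show ?case
    by (intro bexI[of _ 0]) auto
next
  case zero
  show ?case
    by (intro bexI[of _ 0]) auto
next
  case (add p p')
  then obtain q q' where "q \<in> inv_ideal" "q' \<in> inv_ideal"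
    "p - sym_act (s i) p = pol_var i * q" "p' - sym_act (s i) p' = pol_var i * q'"
    by blast
  then show ?case
    by (intro bexI[of _ "q + q'"]) (auto simp: sym_act_add inv_ideal_add algebra_simps)
next
  case (mult r p)
  then obtain q where q: "q \<in> inv_ideal" "p - sym_act (s i) p = pol_var i * q"
    by blast
  obtain r' where r': "r' \<in> Pol n" "r - sym_act (s i) r = root_poly (s i) * r'"
    using reflection_dvd[OF s_Refl[OF i] mult(1)] by blast
  obtain c where "root_vec (s i) = c \<cdot>\<^sub>v unit_vec n i"
    using simple_root_vec[OF i] by blast
  then have root: "root_poly (s i) = pol_const c * pol_var i"
    using i by (simp add: root_poly_def linear_poly_smult linear_poly_unit_vec)
  have "r * p - sym_act (s i) (r * p) = (r - sym_act (s i) r) * p + sym_act (s i) r * (p - sym_act (s i) p)"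
    by (simp add: sym_act_mult algebra_simps)
  also have "\<dots> = pol_var i * (pol_const c * r' * p + sym_act (s i) r * q)"
    unfolding q(2) r'(2) root by (simp add: algebra_simps)
  finally show ?case
    using q r' mult s_W[OF i]
    by (intro bexI[of _ "pol_const c * r' * p + sym_act (s i) r * q"])
       (auto intro!: inv_ideal_add inv_ideal_mult)
qed

text \<open>
  The reflection negates its root \<open>x\<close>, so \<open>x p - s (x p) = x (p + s p)\<close>, and the divided difference of
  \<open>x p\<close> is \<open>p + s p\<close>.
\<close>

lemma reflection_sum_inv_ideal:
  assumes i: "i < n" and p: "p \<in> Pol n" and ideal: "pol_var i * p \<in> inv_ideal"
  shows "p + sym_act (s i) p \<in> inv_ideal"
proof -
  obtain q where q: "q \<in> inv_ideal" "pol_var i * p - sym_act (s i) (pol_var i * p) = pol_var i * q"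
    using divided_difference_inv_ideal[OF i ideal] by blast
  have "(s i *\<^sub>v unit_vec n i) $ i = s i $$ (i, i)"
    using i W_carrier[OF s_W[OF i]] by simp
  then have "s i *\<^sub>v unit_vec n i = unit_vec n i + (- 2) \<cdot>\<^sub>v unit_vec n i"
    using simple_refl_vec[OF i, of "unit_vec n i"] i s_diagonal[OF i] by simp
  also have "\<dots> = (- 1) \<cdot>\<^sub>v unit_vec n i"
    by (auto simp: vec_eq_iff)
  finally have "sym_act (s i) (pol_var i) = - pol_var i"
    using sym_act_linear_poly[OF W_carrier[OF s_W[OF i]], of "unit_vec n i"] i
    by (simp add: linear_poly_unit_vec linear_poly_smult single_uminus)
  then have "pol_var i * (p + sym_act (s i) p) = pol_var i * q"
    using q(2) by (simp add: sym_act_mult algebra_simps)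
  moreover have "pol_var i \<noteq> 0"
    by (metis pol_var_def lookup_single_eq lookup_zero zero_neq_one)
  ultimately show ?thesis
    using q by simp
qed

text \<open>
  A variable is a root of the monic polynomial with roots its conjugates, whose lower coefficients
  are invariants of positive degree.
\<close>

lemma var_power_inv_ideal:
  assumes i: "i < n"
  shows "pol_var i ^ card W \<in> inv_ideal"
proof -
  define x where "x = pol_var i"
  have x: "x \<in> Pol n" "x \<in> sym_power n 1"
    using i sym_power_var by (auto simp: x_def)
  define e where "e j = (\<Sum>A | A \<subseteq> W \<and> card A = j. \<Prod>w\<in>A. - sym_act w x)" for j
  have fin: "finite {A. A \<subseteq> W \<and> card A = j}" for j
    using finite_W by simp
  have "0 = (\<Prod>w\<in>W. x + - sym_act w x)"
    using finite_W W_one x by (intro prod_zero[symmetric]) (auto simp: sym_act_1 intro!: bexI[of _ "1\<^sub>m n"])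
  also have "\<dots> = (\<Sum>A\<in>Pow W. (\<Prod>w\<in>A. - sym_act w x) * (\<Prod>w\<in>W - A. x))"
    using prod_add[OF finite_W, of "\<lambda>w. - sym_act w x" "\<lambda>_. x"] by (simp add: add.commute)
  also have "\<dots> = (\<Sum>A\<in>Pow W. (\<Prod>w\<in>A. - sym_act w x) * x ^ (card W - card A))"
    using finite_W by (intro sum.cong refl) (auto simp: card_Diff_subset finite_subset)
  also have "\<dots> = (\<Sum>j\<in>{..card W}. \<Sum>A | A \<in> Pow W \<and> card A = j.
      (\<Prod>w\<in>A. - sym_act w x) * x ^ (card W - card A))"
    using finite_W by (intro sum.group[symmetric]) (auto intro: card_mono)
  also have "\<dots> = (\<Sum>j\<in>{..card W}. e j * x ^ (card W - j))"
    by (simp add: e_def sum_distrib_right)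
  also have "\<dots> = x ^ card W + (\<Sum>j\<in>{1..card W}. e j * x ^ (card W - j))"
  proof -
    have "{A. A \<subseteq> W \<and> card A = 0} = {{}}"
      using finite_W by (auto simp: card_eq_0_iff finite_subset)
    then have "e 0 = 1"
      by (simp add: e_def)
    moreover have "{..card W} = insert 0 {1..card W}"
      by auto
    ultimately show ?thesis
      by simp
  qed
  finally have "x ^ card W = - (\<Sum>j\<in>{1..card W}. e j * x ^ (card W - j))"
    by (simp add: eq_neg_iff_add_eq_0)
  moreover have "e j \<in> inv_ideal" if "j \<in> {1..card W}" for j
  proof (rule inv_ideal_generator)
    have "(\<Prod>w\<in>A. - sym_act w x) \<in> sym_power n j" if A: "A \<subseteq> W" "card A = j" for A
    proof -
      have "- sym_act w x \<in> sym_power n 1" if "w \<in> A" for w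
        using A that x by (intro sym_power_uminus sym_act_degree) auto
      then show ?thesis
        using sym_power_prod[of A "\<lambda>w. - sym_act w x" n "\<lambda>_. 1"] A by simp
    qed
    then have "e j \<in> sym_power n j"
      unfolding e_def by (intro sym_power_sum) auto
    moreover have "sym_act g (e j) = e j" if g: "g \<in> W" for g
    proof -
      let ?S = "{A. A \<subseteq> W \<and> card A = j}"
      have inj: "inj_on (\<lambda>w. g * w) W" and im: "(\<lambda>w. g * w) ` W = W"
        using W_translate_left[OF g] by (auto simp: bij_betw_def)
      have "inj_on (image (\<lambda>w. g * w)) ?S"
        by (rule inj_on_subset[OF inj_on_image_Pow[OF inj]]) auto
      moreover have "image (\<lambda>w. g * w) ` ?S \<subseteq> ?S"
        using im inj by (auto intro!: card_image intro: inj_on_subset)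
      ultimately have bij: "bij_betw (image (\<lambda>w. g * w)) ?S ?S"
        using endo_inj_surj[OF fin] by (simp add: bij_betw_def)
      have "sym_act g (e j) = (\<Sum>A\<in>?S. \<Prod>w\<in>A. - sym_act (g * w) x)"
        unfolding e_def sym_act_sum sym_act_prod sym_act_uminus
        using g x by (intro sum.cong prod.cong) (auto simp: W_sym_act_compose)
      also have "\<dots> = (\<Sum>A\<in>?S. \<Prod>w\<in>(\<lambda>w. g * w) ` A. - sym_act w x)"
        using inj by (intro sum.cong refl prod.reindex_cong[symmetric, OF _ refl])
          (auto intro: inj_on_subset)
      also have "\<dots> = e j"
        unfolding e_def by (rule sum.reindex_bij_betw[OF bij])
      finally show ?thesis .
    qed
    ultimately show "e j \<in> invariants"
      using that by (auto simp: invariants_def intro!: exI[of _ j])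
  qed
  ultimately show ?thesis
    using x unfolding x_def[symmetric]
    by (auto intro!: inv_ideal_uminus inv_ideal_sum inv_ideal_mult_right Pol_power)
qed

text \<open>
  By the pigeonhole principle a monomial of high degree contains a high power of some variable.
\<close>

lemma high_degree_inv_ideal:
  assumes p: "p \<in> Pol n" and deg: "\<And>e. e \<in> keys p \<Longrightarrow> mdeg e \<ge> n * card W"
  shows "p \<in> inv_ideal"
proof -
  have "single e c \<in> inv_ideal" if e: "keys e \<subseteq> {..<n}" "mdeg e \<ge> n * card W" for e c
  proof -
    have "\<exists>i\<in>{..<n}. lookup e i \<ge> card W"
    proof (rule ccontr)
      assume *: "\<not> ?thesis"
      have "mdeg e = (\<Sum>i<n. lookup e i)"
        using e(1) by (intro mdeg_superset) auto
      also have "\<dots> < (\<Sum>i<n. card W)"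
        using * n_pos by (intro sum_strict_mono) (auto simp: not_le)
      finally show False
        using e(2) by simp
    qed
    then obtain i where i: "i < n" "lookup e i \<ge> card W"
      by auto
    have "card W > 0"
      using finite_W W_one by (auto simp: card_gt_0_iff)
    with i have "i \<in> keys e"
      by (auto simp: in_keys_iff)
    have "single e c = pol_const c * (\<Prod>j\<in>keys e. pol_var j ^ lookup e j)"
      by (rule single_as_monomial)
    also have "\<dots> = pol_const c * (\<Prod>j\<in>keys e - {i}. pol_var j ^ lookup e j)
        * pol_var i ^ (lookup e i - card W) * pol_var i ^ card W"
      using \<open>i \<in> keys e\<close> i(2) by (simp add: prod.remove[of "keys e" i] power_add[symmetric] algebra_simps)
    finally show ?thesis
      using i e(1) by (auto intro!: inv_ideal_mult var_power_inv_ideal Pol_mult Pol_prod Pol_power)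
  qed
  then have "(\<Sum>e\<in>keys p. single e (lookup p e)) \<in> inv_ideal"
    using p deg by (intro inv_ideal_sum) (auto simp: Pol_iff)
  then show ?thesis
    using sum_singles[of p] by simp
qed

text \<open>
  The group preserves degrees, so the homogeneous components of an invariant are invariant.
\<close>

lemma invariant_inv_ideal:
  assumes p: "p \<in> Pol n" and inv: "\<And>w. w \<in> W \<Longrightarrow> sym_act w p = p" and zero: "lookup p 0 = 0"
  shows "p \<in> inv_ideal"
proof -
  have "homog d p \<in> inv_ideal" for d
  proof (cases "d = 0")
    case True
    then show ?thesis
      by (simp add: homog_0 zero)
  next
    case False
    have "sym_act w (homog d p) = homog d p" if "w \<in> W" for w
      using homog_sym_act[of w n p d] inv[OF that] that p by simp
    then show ?thesis
      using False p by (intro inv_ideal_generator)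
        (auto simp: invariants_def intro!: exI[of _ d] homog_sym_power)
  qed
  moreover obtain D where "p = (\<Sum>d<D. homog d p)"
    by (rule sum_homog[of p]) blast
  ultimately show ?thesis
    by (metis inv_ideal_sum)
qed

text \<open>
  The radical of the pairing given by \<open>\<phi>\<close> is shown to lie in the ideal by descending induction on
  the order, starting where the ideal contains all polynomials.  The induction step multiplies by a
  variable, which raises the order, and recovers information on \<open>p\<close> by a divided difference.
\<close>

theorem inv_ideal_iff_socle_form:
  assumes p: "p \<in> Pol n"
  shows "p \<in> inv_ideal \<longleftrightarrow> (\<forall>q\<in>Pol n. socle_form (p * q) = 0)"
proof
  assume "p \<in> inv_ideal"
  then show "\<forall>q\<in>Pol n. socle_form (p * q) = 0"
    using socle_form_inv_ideal by blast
next
  have descent: "p \<in> inv_ideal"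
    if "p \<in> Pol n" "\<forall>e\<in>keys p. mdeg e \<ge> n * card W - k" "\<forall>q\<in>Pol n. socle_form (p * q) = 0" for k p
    using that
  proof (induction k arbitrary: p)
    case 0
    then show ?case
      using high_degree_inv_ideal by simp
  next
    case (Suc k)
    note p = Suc.prems(1)
    have "pol_var i * p \<in> inv_ideal" if i: "i < n" for i
    proof (rule Suc.IH)
      show "\<forall>e\<in>keys (pol_var i * p). n * card W - k \<le> mdeg e"
      proof
        fix e
        assume "e \<in> keys (pol_var i * p)"
        then obtain f where "f \<in> keys p" "e = single i 1 + f"
          using keys_mult[of "pol_var i" p] by (auto simp: pol_var_def split: if_splits)
        moreover from this have "n * card W - Suc k \<le> mdeg f"
          using Suc.prems(2) by blast
        ultimately show "n * card W - k \<le> mdeg e"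
          by (simp add: mdeg_add)
      qed
      show "\<forall>q\<in>Pol n. socle_form (pol_var i * p * q) = 0"
        using Suc.prems(3) i by (simp add: mult.assoc mult.left_commute[of _ p] Pol_mult)
    qed (use i p in \<open>auto intro: Pol_mult\<close>)
    then have refl: "p + sym_act (s i) p \<in> inv_ideal" if "i < n" for i
      using reflection_sum_inv_ideal that p by blast
    \<comment> \<open>Modulo the ideal, each \<open>s i\<close> negates \<open>p\<close>; hence the whole group acts on \<open>p\<close> by the sign.\<close>
    have sign: "sym_act w p - pol_const (sign w) * p \<in> inv_ideal" if "w \<in> W" for w
      using that
    proof (induction w rule: W_induct)
      case one
      then show ?case
        using p by (simp add: sym_act_1 sign_one)
    next
      case (step i w)
      have "sym_act (s i) (sym_act w p - pol_const (sign w) * p) =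
          sym_act (s i) (sym_act w p) - pol_const (sign w) * sym_act (s i) p"
        by (simp add: sym_act_diff sym_act_scale)
      then have "sym_act (s i * w) p - pol_const (sign (s i * w)) * p =
          sym_act (s i) (sym_act w p - pol_const (sign w) * p) + pol_const (sign w) * (p + sym_act (s i) p)"
        using step p
        by (simp add: W_sym_act_compose s_W sign_mult sign_s single_uminus algebra_simps)
      moreover have "sym_act (s i) (sym_act w p - pol_const (sign w) * p) \<in> inv_ideal"
        using step by (intro inv_ideal_sym_act s_W)
      moreover have "pol_const (sign w) * (p + sym_act (s i) p) \<in> inv_ideal"
        using refl[OF step(1)] by (intro inv_ideal_mult) auto
      ultimately show ?case
        by (metis inv_ideal_add)
    qed
    have "lookup (alternation_quotient p) 0 = 0"
      using Suc.prems(3)[rule_format, of 1] by (simp add: socle_form_def)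
    then have "alternation_quotient p \<in> inv_ideal"
      using alternation_quotient(1)[OF p] alternation_quotient_invariant[OF _ p]
      by (intro invariant_inv_ideal)
    then have "alternation p \<in> inv_ideal"
      unfolding alternation_quotient(2)[OF p] by (intro inv_ideal_mult) auto
    moreover have "(\<Sum>w\<in>W. pol_const (sign w) * (sym_act w p - pol_const (sign w) * p)) \<in> inv_ideal"
      by (intro inv_ideal_sum inv_ideal_mult sign) auto
    moreover have "(\<Sum>w\<in>W. pol_const (sign w) * (sym_act w p - pol_const (sign w) * p)) =
        alternation p - (\<Sum>w\<in>W. p)"
      unfolding alternation_def sum_subtractf[symmetric]
      by (intro sum.cong) (simp_all add: right_diff_distrib pol_const_mult sign_square)
    \<comment> \<open>So \<open>p\<close> is congruent to its alternating sum divided by the order of the group.\<close>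
    ultimately have "alternation p - (alternation p - (\<Sum>w\<in>W. p)) \<in> inv_ideal"
      by (metis inv_ideal_diff)
    then have "of_nat (card W) * p \<in> inv_ideal"
      by simp
    then have "pol_const (1 / of_nat (card W)) * (of_nat (card W) * p) \<in> inv_ideal"
      by (rule inv_ideal_mult[OF Pol_const])
    moreover have "pol_const (1 / of_nat (card W)) * of_nat (card W) = 1"
    proof -
      have "card W > 0"
        using finite_W W_one by (auto simp: card_gt_0_iff)
      moreover have "of_nat (card W) = pol_const (of_nat (card W))"
        by simp
      ultimately show ?thesis
        by (simp only: mult_single) simp
    qed
    ultimately show ?case
      by (simp add: mult.assoc[symmetric])
  qed
  assume "\<forall>q\<in>Pol n. socle_form (p * q) = 0"
  then show "p \<in> inv_ideal"
    using descent[of p "n * card W"] p by simp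
qed

end


section \<open>Poincare duality\<close>

context reflection_group
begin

definition monomials :: "nat \<Rightarrow> (nat \<Rightarrow>\<^sub>0 nat) set"
  where "monomials m = {e. keys e \<subseteq> {..<n} \<and> mdeg e = m}"

lemma finite_monomials: "finite (monomials m)"
proof (rule inj_on_finite)
  show "inj_on (\<lambda>e. restrict (lookup e) {..<n}) (monomials m)"
  proof (rule inj_onI)
    fix e f
    assume e: "e \<in> monomials m" and f: "f \<in> monomials m"
      and eq: "restrict (lookup e) {..<n} = restrict (lookup f) {..<n}"
    show "e = f"
    proof (rule poly_mapping_eqI)
      fix j
      show "lookup e j = lookup f j"
      proof (cases "j < n")
        case True
        then show ?thesis
          using fun_cong[OF eq, of j] by simp
      next
        case False
        then have "j \<notin> keys e" "j \<notin> keys f"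
          using e f by (auto simp: monomials_def)
        then show ?thesis
          by (simp add: in_keys_iff)
      qed
    qed
  qed
  show "(\<lambda>e. restrict (lookup e) {..<n}) ` monomials m \<subseteq> PiE {..<n} (\<lambda>_. {..m})"
  proof (rule image_subsetI)
    fix e
    assume e: "e \<in> monomials m"
    have "lookup e i \<le> m" if "i < n" for i
    proof (cases "i \<in> keys e")
      case True
      then have "lookup e i \<le> mdeg e"
        unfolding mdeg_def by (intro member_le_sum) auto
      then show ?thesis
        using e by (simp add: monomials_def)
    qed (simp add: in_keys_iff)
    then show "restrict (lookup e) {..<n} \<in> PiE {..<n} (\<lambda>_. {..m})"
      by auto
  qed
  show "finite (PiE {..<n} (\<lambda>_. {..m}))"
    by (intro finite_PiE) auto
qed

lemma sym_power_keys: "p \<in> sym_power n m \<Longrightarrow> keys p \<subseteq> monomials m"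
  by (auto simp: sym_power_iff Pol_iff monomials_def)

definition conjugate_monomial :: "complex mat \<Rightarrow> (nat \<Rightarrow>\<^sub>0 nat) \<Rightarrow> mpoly"
  where "conjugate_monomial w e = sym_act w (single e 1)"

text \<open>
  The Gram operator of the family of all \<open>W\<close>-conjugates \<open>z\<close> of monomials of degree \<open>m\<close> with respect
  to the pairing \<open>(p, z) \<mapsto> socle_form (p z)\<close>.
\<close>

definition duality :: "nat \<Rightarrow> mpoly \<Rightarrow> mpoly"
  where "duality m p = (\<Sum>w\<in>W. \<Sum>e\<in>monomials m.
    pol_const (socle_form (p * conjugate_monomial w e)) * conjugate_monomial w e)"

lemma conjugate_monomial_Pol [simp]: "w \<in> W \<Longrightarrow> conjugate_monomial w e \<in> Pol n"
  by (simp add: conjugate_monomial_def)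

lemma conjugate_monomial_degree:
  assumes "w \<in> W" "e \<in> monomials m"
  shows "conjugate_monomial w e \<in> sym_power n m"
proof -
  have "single e 1 \<in> sym_power n m"
    using assms sym_power_single[of e n 1] by (auto simp: monomials_def)
  then show ?thesis
    using assms by (simp add: conjugate_monomial_def sym_act_degree)
qed

lemma pol_cnj_conjugate_monomial:
  assumes "w \<in> W" "e \<in> monomials m"
  shows "pol_cnj (conjugate_monomial w e) = conjugate_monomial w e"
proof -
  have "single e 1 \<in> Pol n"
    using assms by (intro Pol_single) (auto simp: monomials_def)
  then show ?thesis
    using assms pol_cnj_sym_act[of w n "single e 1"] W_real by (simp add: conjugate_monomial_def)
qed

lemma duality_degree: "duality m p \<in> sym_power n m"
  unfolding duality_def by (intro sym_power_sum sym_power_scale conjugate_monomial_degree)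

lemma duality_add:
  assumes "p \<in> Pol n" "q \<in> Pol n"
  shows "duality m (p + q) = duality m p + duality m q"
proof -
  have "socle_form ((p + q) * conjugate_monomial w e) =
      socle_form (p * conjugate_monomial w e) + socle_form (q * conjugate_monomial w e)" if "w \<in> W" for w e
    using that assms by (simp add: distrib_right socle_form_add Pol_mult)
  then show ?thesis
    by (simp add: duality_def single_add distrib_right sum.distrib cong: sum.cong)
qed

lemma duality_scale:
  assumes "p \<in> Pol n"
  shows "duality m (pol_const c * p) = pol_const c * duality m p"
proof -
  have "socle_form (pol_const c * p * conjugate_monomial w e) =
      c * socle_form (p * conjugate_monomial w e)" if "w \<in> W" for w e
    using that assms by (simp add: mult.assoc socle_form_scale Pol_mult)
  then show ?thesis
    by (simp add: duality_def sum_distrib_left pol_const_mult cong: sum.cong)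
qed

text \<open>
  A reflection changes the sign of \<open>\<phi>\<close> and permutes the conjugates \<open>z\<close> over which the sum extends.
\<close>

lemma duality_sym_act:
  assumes i: "i < n" and p: "p \<in> Pol n"
  shows "duality m (sym_act (s i) p) = - sym_act (s i) (duality m p)"
proof -
  let ?t = "\<lambda>w. \<Sum>e\<in>monomials m.
    pol_const (socle_form (sym_act (s i) p * conjugate_monomial w e)) * conjugate_monomial w e"
  have "sym_act (s i) (conjugate_monomial w e) = conjugate_monomial (s i * w) e"
    if "w \<in> W" "e \<in> monomials m" for w e
    using that s_W[OF i] W_sym_act_compose[of "s i" w "single e 1"]
    by (simp add: conjugate_monomial_def monomials_def Pol_single)
  moreover have "socle_form (sym_act (s i) p * conjugate_monomial (s i * w) e) =
      - socle_form (p * conjugate_monomial w e)"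
    if "w \<in> W" "e \<in> monomials m" for w e
    using that p s_W[OF i] calculation[OF that, symmetric]
      socle_form_sym_act[of "s i" "p * conjugate_monomial w e"]
    by (simp add: sym_act_mult sign_s[OF i] Pol_mult)
  ultimately have "- sym_act (s i) (duality m p) = (\<Sum>w\<in>W. ?t (s i * w))"
    by (simp add: duality_def sym_act_sum sym_act_scale single_uminus sum_negf cong: sum.cong)
  also have "\<dots> = (\<Sum>w\<in>W. ?t w)"
    by (rule sum.reindex_bij_betw[OF W_translate_left[OF s_W[OF i]]])
  finally show ?thesis
    by (simp add: duality_def)
qed

lemma socle_form_components:
  assumes p: "p \<in> Pol n" and q: "q \<in> Pol n" and zero: "\<And>d. socle_form (p * homog d q) = 0"
  shows "socle_form (p * q) = 0"
proof -
  obtain D where D: "q = (\<Sum>d<D. homog d q)"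
    by (rule sum_homog[of q]) blast
  have "p * q = (\<Sum>d<D. p * homog d q)"
    using arg_cong[OF D, of "\<lambda>q. p * q"] by (simp add: sum_distrib_left)
  also have "socle_form \<dots> = (\<Sum>d<D. socle_form (p * homog d q))"
    using p homog_sym_power[OF q, THEN sym_power_Pol] by (intro socle_form_sum) auto
  finally show ?thesis
    by (simp add: zero)
qed

text \<open>
  If \<open>\<Sum> \<phi>(p z) z\<close> lies in the ideal, then so does its complex conjugate; pairing the latter with
  \<open>p\<close> gives \<open>\<Sum> |\<phi>(p z)|\<^sup>2 = 0\<close>.
\<close>

lemma duality_inv_ideal_iff:
  assumes p: "p \<in> sym_power n k" and km: "k + m = card Refl"
  shows "duality m p \<in> inv_ideal \<longleftrightarrow> p \<in> inv_ideal"
proof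
  have P: "p \<in> Pol n"
    using p by (rule sym_power_Pol)
  let ?z = conjugate_monomial
  show "duality m p \<in> inv_ideal" if "p \<in> inv_ideal"
    using inv_ideal_iff_socle_form[OF P] that
    by (simp add: duality_def cong: sum.cong)
  assume "duality m p \<in> inv_ideal"
  then have "pol_cnj (duality m p) \<in> inv_ideal"
    by (rule inv_ideal_pol_cnj)
  then have "socle_form (pol_cnj (duality m p) * p) = 0"
    by (rule socle_form_inv_ideal) (rule P)
  also have "pol_cnj (duality m p) * p =
      (\<Sum>w\<in>W. \<Sum>e\<in>monomials m. pol_const (cnj (socle_form (p * ?z w e))) * (p * ?z w e))"
    by (simp add: duality_def pol_cnj_sum pol_cnj_mult pol_cnj_conjugate_monomial sum_distrib_right
        mult.assoc mult.commute[of p] cong: sum.cong)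
  also have "socle_form \<dots> =
      (\<Sum>w\<in>W. \<Sum>e\<in>monomials m. cnj (socle_form (p * ?z w e)) * socle_form (p * ?z w e))"
    using P by (simp add: socle_form_sum socle_form_scale Pol_sum Pol_mult cong: sum.cong)
  also have "\<dots> = of_real (\<Sum>w\<in>W. \<Sum>e\<in>monomials m. (cmod (socle_form (p * ?z w e)))\<^sup>2)"
  proof -
    have "cnj z * z = of_real ((cmod z)\<^sup>2)" for z
      by (simp only: complex_norm_square mult.commute)
    then show ?thesis
      by (simp only: of_real_sum)
  qed
  finally have "(\<Sum>w\<in>W. \<Sum>e\<in>monomials m. (cmod (socle_form (p * ?z w e)))\<^sup>2) = 0"
    by (metis of_real_eq_0_iff)
  then have "\<forall>w\<in>W. (\<Sum>e\<in>monomials m. (cmod (socle_form (p * ?z w e)))\<^sup>2) = 0"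
    using finite_W by (subst (asm) sum_nonneg_eq_0_iff) (auto intro!: sum_nonneg)
  then have "(\<Sum>e\<in>monomials m. (cmod (socle_form (p * ?z (1\<^sub>m n) e)))\<^sup>2) = 0"
    using W_one by blast
  then have "\<forall>e\<in>monomials m. socle_form (p * ?z (1\<^sub>m n) e) = 0"
    using finite_monomials by (subst (asm) sum_nonneg_eq_0_iff) auto
  then have mono: "socle_form (p * single e 1) = 0" if "e \<in> monomials m" for e
    using that sym_act_1[of "single e 1" n]
    by (auto simp: conjugate_monomial_def monomials_def Pol_single)
  have "socle_form (p * q) = 0" if q: "q \<in> Pol n" for q
  proof -
    have "socle_form (p * homog d q) = 0" for d
    proof (cases "d = m")
      case True
      have h: "homog m q \<in> sym_power n m"
        by (rule homog_sym_power[OF q])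
      have "p * homog m q = (\<Sum>e\<in>keys (homog m q). p * single e (lookup (homog m q) e))"
        by (subst sum_singles) (rule sum_distrib_left)
      also have "\<dots> = (\<Sum>e\<in>keys (homog m q). pol_const (lookup (homog m q) e) * (p * single e 1))"
        by (intro sum.cong refl) (simp add: mult.left_commute[of _ p] mult_single)
      finally have sum: "p * homog m q =
          (\<Sum>e\<in>keys (homog m q). pol_const (lookup (homog m q) e) * (p * single e 1))" .
      have Pe: "p * single e 1 \<in> Pol n" if "e \<in> keys (homog m q)" for e
        using P sym_power_keys[OF h] that by (intro Pol_mult Pol_single) (auto simp: monomials_def)
      have "socle_form (p * homog m q) =
          (\<Sum>e\<in>keys (homog m q). socle_form (pol_const (lookup (homog m q) e) * (p * single e 1)))"
        unfolding sum using Pe by (intro socle_form_sum) auto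
      also have "\<dots> = (\<Sum>e\<in>keys (homog m q). lookup (homog m q) e * socle_form (p * single e 1))"
        by (intro sum.cong refl socle_form_scale Pe)
      also have "\<dots> = 0"
        using sym_power_keys[OF h] mono by (intro sum.neutral) auto
      finally show ?thesis
        using True by simp
    next
      case False
      then show ?thesis
        using km by (intro socle_form_degree[of _ "k + d"] sym_power_mult p homog_sym_power q) auto
    qed
    then show ?thesis
      by (rule socle_form_components[OF P q])
  qed
  then show "p \<in> inv_ideal"
    using inv_ideal_iff_socle_form[OF P] by blast
qed

lemma sym_power_subset_inv_ideal:
  assumes k: "k > card Refl"
  shows "sym_power n k \<subseteq> inv_ideal"
proof
  fix p
  assume p: "p \<in> sym_power n k"
  then have P: "p \<in> Pol n"
    by (rule sym_power_Pol)
  have "socle_form (p * q) = 0" if q: "q \<in> Pol n" for q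
  proof -
    have "socle_form (p * homog d q) = 0" for d
      using k by (intro socle_form_degree[of _ "k + d"] sym_power_mult p homog_sym_power q) auto
    then show ?thesis
      by (rule socle_form_components[OF P q])
  qed
  then show "p \<in> inv_ideal"
    using inv_ideal_iff_socle_form[OF P] by blast
qed

text \<open>
  There are more vectors than monomials of degree \<open>m\<close>; the family may however repeat a vector, which
  is a relation of its own.
\<close>

lemma linear_relation:
  assumes v: "\<And>i. v i \<in> sym_power n m"
  obtains c :: "nat \<Rightarrow> complex" and D where "(\<Sum>i\<le>D. pol_const (c i) * v i) = 0" "\<exists>i\<le>D. c i \<noteq> 0"
proof -
  interpret vector_space "\<lambda>c p. pol_const c * (p :: mpoly)"
    by unfold_locales (simp_all add: distrib_left single_add distrib_right pol_const_mult)
  define D where "D = card (monomials m)"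
  have span: "v i \<in> span ((\<lambda>e. single e 1) ` monomials m)" for i
  proof -
    have "v i = (\<Sum>e\<in>keys (v i). pol_const (lookup (v i) e) * single e 1)"
      by (subst sum_singles) (simp add: mult_single)
    also have "\<dots> \<in> span ((\<lambda>e. single e 1) ` monomials m)"
      using sym_power_keys[OF v] by (intro span_sum span_scale span_base) auto
    finally show ?thesis .
  qed
  show ?thesis
  proof (cases "inj_on v {..D}")
    case False
    then obtain a a' where a: "a \<le> D" "a' \<le> D" "a \<noteq> a'" "v a = v a'"
      by (auto simp: inj_on_def)
    have "(\<Sum>i\<le>D. pol_const (if i = a then 1 else if i = a' then - 1 else 0) * v i) =
        (\<Sum>i\<in>{a, a'}. pol_const (if i = a then 1 else if i = a' then - 1 else 0) * v i)"
      using a by (intro sum.mono_neutral_right) auto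
    also have "\<dots> = 0"
      using a by (simp add: single_uminus)
    finally show ?thesis
      using a by (intro that[of "\<lambda>i. if i = a then 1 else if i = a' then - 1 else 0" D]) auto
  next
    case True
    have "card (v ` {..D}) > card ((\<lambda>e. single e 1 :: mpoly) ` monomials m)"
      using card_image[OF True] card_image_le[OF finite_monomials, of "\<lambda>e. single e 1 :: mpoly" m]
      by (simp add: D_def)
    then have "dependent (v ` {..D})"
      using independent_span_bound[of "(\<lambda>e. single e 1) ` monomials m" "v ` {..D}"] span finite_monomials
      by (metis finite_imageI image_subsetI not_le)
    then obtain u where u: "\<exists>x\<in>v ` {..D}. u x \<noteq> 0" "(\<Sum>x\<in>v ` {..D}. pol_const (u x) * x) = 0"
      using dependent_finite[of "v ` {..D}"] by auto
    then have "(\<Sum>i\<le>D. pol_const (u (v i)) * v i) = 0"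
      using True by (simp add: sum.reindex)
    then show ?thesis
      using u(1) by (intro that[of "\<lambda>i. u (v i)" D]) auto
  qed
qed

text \<open>
  The iterates of \<open>f\<close> at \<open>p\<close> satisfy a linear relation.  As \<open>f\<close> reflects membership in the ideal, its
  lowest power can be cancelled from the relation modulo the ideal.  The new relation involves \<open>p\<close>
  itself, and so exhibits \<open>p\<close> as a value of \<open>f\<close>.
\<close>

lemma surjective_mod_inv_ideal:
  assumes closed: "\<And>p. p \<in> sym_power n m \<Longrightarrow> f p \<in> sym_power n m"
    and add: "\<And>p q. p \<in> sym_power n m \<Longrightarrow> q \<in> sym_power n m \<Longrightarrow> f (p + q) = f p + f q"
    and scale: "\<And>c p. p \<in> sym_power n m \<Longrightarrow> f (pol_const c * p) = pol_const c * f p"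
    and inj: "\<And>p. p \<in> sym_power n m \<Longrightarrow> f p \<in> inv_ideal \<Longrightarrow> p \<in> inv_ideal"
    and p: "p \<in> sym_power n m"
  shows "\<exists>q\<in>sym_power n m. p - f q \<in> inv_ideal"
proof -
  define v where "v i = (f ^^ i) p" for i
  have v: "v i \<in> sym_power n m" for i
    unfolding v_def by (induction i) (auto intro: closed p)
  have f_zero: "f 0 = 0"
    using scale[of 0 0] by simp
  have f_sum: "f (sum g A) = (\<Sum>i\<in>A. f (g i))"
    if "\<And>i. i \<in> A \<Longrightarrow> g i \<in> sym_power n m" for g :: "nat \<Rightarrow> mpoly" and A
    using that
  proof (induction A rule: infinite_finite_induct)
    case (insert x F)
    then have "sum g F \<in> sym_power n m"
      by (intro sym_power_sum) auto
    then show ?case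
      using insert by (simp add: add)
  qed (simp_all add: f_zero)
  obtain c :: "nat \<Rightarrow> complex" and D
    where rel: "(\<Sum>i\<le>D. pol_const (c i) * v i) = 0" "\<exists>i\<le>D. c i \<noteq> 0"
    by (rule linear_relation[of v, OF v]) blast
  define j where "j = (LEAST i. c i \<noteq> 0)"
  have j: "c j \<noteq> 0" "\<And>i. i < j \<Longrightarrow> c i = 0"
    using rel(2) not_less_Least LeastI_ex[of "\<lambda>i. c i \<noteq> 0"] unfolding j_def by blast+
  have "j \<le> D"
    using rel(2) j by (metis le_less_linear le_trans less_imp_le)
  define u where "u = (\<Sum>i\<le>D - j. pol_const (c (i + j)) * v i)"
  have u: "u \<in> sym_power n m"
    unfolding u_def by (intro sym_power_sum sym_power_scale v)
  have iter: "(f ^^ l) u = (\<Sum>i\<le>D - j. pol_const (c (i + j)) * v (i + l))" for l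
  proof (induction l)
    case (Suc l)
    have "v (i + Suc l) = f (v (i + l))" for i
      by (simp add: v_def)
    then show ?case
      using v by (simp add: Suc f_sum scale sym_power_scale)
  qed (simp add: u_def)
  have "(\<Sum>i\<le>D. pol_const (c i) * v i) = (\<Sum>i=j..D. pol_const (c i) * v i)"
    using j(2) by (intro sum.mono_neutral_right) auto
  also have "\<dots> = (\<Sum>i\<le>D - j. pol_const (c (i + j)) * v (i + j))"
    using \<open>j \<le> D\<close> sum.shift_bounds_cl_nat_ivl[of "\<lambda>i. pol_const (c i) * v i" 0 j "D - j"]
    by (simp add: atLeast0AtMost)
  finally have "(f ^^ j) u \<in> inv_ideal"
    using rel(1) iter by simp
  moreover have "(f ^^ l) u \<in> sym_power n m" for l
    by (induction l) (auto intro: closed u)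
  then have "(f ^^ l) u \<in> inv_ideal \<Longrightarrow> u \<in> inv_ideal" for l
    by (induction l) (auto intro: inj)
  ultimately have "u \<in> inv_ideal"
    by blast
  define q where "q = pol_const (- 1 / c j) * (\<Sum>i<D - j. pol_const (c (Suc i + j)) * v i)"
  have sum: "(\<Sum>i<D - j. pol_const (c (Suc i + j)) * v i) \<in> sym_power n m"
    by (intro sym_power_sum sym_power_scale v)
  have "f q = pol_const (- 1 / c j) * (\<Sum>i<D - j. pol_const (c (Suc i + j)) * v (Suc i))"
    unfolding q_def using sum v by (simp add: scale f_sum sym_power_scale v_def)
  also have "(\<Sum>i<D - j. pol_const (c (Suc i + j)) * v (Suc i)) = u - pol_const (c j) * p"
    unfolding u_def by (subst sum.atMost_shift) (simp add: v_def)
  finally have "p - f q = pol_const (1 / c j) * u"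
    using j(1) by (simp add: right_diff_distrib pol_const_mult single_uminus)
  then have "p - f q \<in> inv_ideal"
    using \<open>u \<in> inv_ideal\<close> by (auto intro: inv_ideal_mult)
  moreover have "q \<in> sym_power n m"
    unfolding q_def by (intro sym_power_scale sum)
  ultimately show ?thesis
    by blast
qed

text \<open>
  The composition of the duality maps for \<open>k\<close> and \<open>m\<close> is an endomorphism to which the preceding lemma
  applies.
\<close>

lemma duality_surjective:
  assumes km: "k + m = card Refl" and p: "p \<in> sym_power n m"
  shows "\<exists>q\<in>sym_power n k. p - duality m q \<in> inv_ideal"
proof -
  have Pol: "duality l q \<in> Pol n" for l q
    using duality_degree sym_power_Pol by blast
  have "\<exists>q\<in>sym_power n m. p - duality m (duality k q) \<in> inv_ideal"
  proof (rule surjective_mod_inv_ideal[where f = "\<lambda>q. duality m (duality k q)", OF _ _ _ _ p])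
    fix q
    assume "q \<in> sym_power n m" "duality m (duality k q) \<in> inv_ideal"
    then show "q \<in> inv_ideal"
      using duality_inv_ideal_iff[OF duality_degree km] duality_inv_ideal_iff[of q m k] km
      by (simp add: add.commute)
  qed (use Pol in \<open>auto simp: duality_degree duality_add duality_scale sym_power_Pol\<close>)
  then show ?thesis
    using duality_degree by blast
qed

end


section \<open>Linear maps and dimension\<close>

abbreviation linear_maps ::
    "(complex, 'a, 'x) module_scheme \<Rightarrow> (complex, 'b, 'y) module_scheme \<Rightarrow> ('a \<Rightarrow> 'b) set"
  where "linear_maps \<equiv> LinearCombinations.module_hom \<C>"

lemma linear_maps_iff: "f \<in> linear_maps V W \<longleftrightarrow>
    (\<forall>x\<in>carrier V. f x \<in> carrier W) \<and>
    (\<forall>x\<in>carrier V. \<forall>y\<in>carrier V. f (x \<oplus>\<^bsub>V\<^esub> y) = f x \<oplus>\<^bsub>W\<^esub> f y) \<and>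
    (\<forall>c. \<forall>x\<in>carrier V. f (c \<odot>\<^bsub>V\<^esub> x) = c \<odot>\<^bsub>W\<^esub> f x)"
  by (auto simp: LinearCombinations.module_hom_def)

lemma linear_maps_closed: "f \<in> linear_maps V W \<Longrightarrow> x \<in> carrier V \<Longrightarrow> f x \<in> carrier W"
  and linear_maps_add: "f \<in> linear_maps V W \<Longrightarrow> x \<in> carrier V \<Longrightarrow> y \<in> carrier V \<Longrightarrow>
    f (x \<oplus>\<^bsub>V\<^esub> y) = f x \<oplus>\<^bsub>W\<^esub> f y"
  and linear_maps_smult: "f \<in> linear_maps V W \<Longrightarrow> x \<in> carrier V \<Longrightarrow> f (c \<odot>\<^bsub>V\<^esub> x) = c \<odot>\<^bsub>W\<^esub> f x"
  by (simp_all add: linear_maps_iff)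

text \<open>
  The preimage of the span of the images is a subspace that contains the generators.
\<close>

lemma linear_image_gen_set:
  assumes V: "vectorspace \<C> V" and W: "vectorspace \<C> W"
    and f: "f \<in> linear_maps V W" and surj: "f ` carrier V = carrier W"
    and A: "A \<subseteq> carrier V" "LinearCombinations.module.span \<C> V A = carrier V"
  shows "LinearCombinations.module.span \<C> W (f ` A) = carrier W"
proof -
  interpret V: vectorspace \<C> V by (rule V)
  interpret W: vectorspace \<C> W by (rule W)
  interpret mod_hom \<C> V W f
    using f by unfold_locales
  have fA: "f ` A \<subseteq> carrier W"
    using A surj by blast
  have sub: "LinearCombinations.submodule \<C> (W.span (f ` A)) W"
    by (rule W.span_is_submodule[OF fA])
  interpret S: LinearCombinations.submodule \<C> "W.span (f ` A)" W
    by (rule sub)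
  have "LinearCombinations.submodule \<C> {x \<in> carrier V. f x \<in> W.span (f ` A)} V"
    by (rule submodule.intro) (auto simp: V.module_axioms intro: S.smult_closed)
  moreover have "A \<subseteq> {x \<in> carrier V. f x \<in> W.span (f ` A)}"
    using A W.in_own_span[OF fA] by auto
  ultimately have "V.span A \<subseteq> {x \<in> carrier V. f x \<in> W.span (f ` A)}"
    by (intro V.span_is_subset)
  then have "f ` carrier V \<subseteq> W.span (f ` A)"
    using A(2) by auto
  then show ?thesis
    using surj S.subset by blast
qed

lemma linear_bij_gen_set:
  assumes V: "vectorspace \<C> V" and W: "vectorspace \<C> W"
    and f: "f \<in> linear_maps V W" and bij: "bij_betw f (carrier V) (carrier W)"
    and A: "finite A" "card A = k" "A \<subseteq> carrier V" "LinearCombinations.module.span \<C> V A = carrier V"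
  shows "finite (f ` A) \<and> card (f ` A) = k \<and> f ` A \<subseteq> carrier W \<and>
    LinearCombinations.module.span \<C> W (f ` A) = carrier W"
proof -
  have "inj_on f (carrier V)" and surj: "f ` carrier V = carrier W"
    using bij by (auto simp: bij_betw_def)
  then show ?thesis
    using linear_image_gen_set[OF V W f surj A(3,4)] A(1,2) image_mono[OF A(3), of f]
    by (auto simp: card_image inj_on_subset[OF _ A(3)])
qed

lemma linear_maps_inv:
  assumes V: "vectorspace \<C> V" and f: "f \<in> linear_maps V W" and bij: "bij_betw f (carrier V) (carrier W)"
  shows "inv_into (carrier V) f \<in> linear_maps W V"
proof -
  interpret V: vectorspace \<C> V by (rule V)
  let ?g = "inv_into (carrier V) f"
  have g: "?g y \<in> carrier V" "f (?g y) = y" if "y \<in> carrier W" for y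
    using bij that by (auto simp: bij_betw_def inv_into_into f_inv_into_f)
  have eq: "?g y = x" if "x \<in> carrier V" "f x = y" for x y
    using bij that by (auto simp: bij_betw_def inv_into_f_f)
  show ?thesis
    unfolding linear_maps_iff
    using g f by (auto intro!: eq simp: linear_maps_add linear_maps_smult)
qed

text \<open>
  The dimension is the least size of a finite generating set.  Comparing generating sets instead of
  bases covers the infinite-dimensional case, where there is none of finite size.
\<close>

lemma dim_eq_of_linear_bij:
  assumes V: "vectorspace \<C> V" and W: "vectorspace \<C> W"
    and f: "f \<in> linear_maps V W" and bij: "bij_betw f (carrier V) (carrier W)"
  shows "vectorspace.dim \<C> V = vectorspace.dim \<C> W"
proof -
  have g: "inv_into (carrier V) f \<in> linear_maps W V"
    by (rule linear_maps_inv[OF V f bij])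
  have g_bij: "bij_betw (inv_into (carrier V) f) (carrier W) (carrier V)"
    by (rule bij_betw_inv_into[OF bij])
  have "(\<exists>A. finite A \<and> card A = k \<and> A \<subseteq> carrier V \<and> LinearCombinations.module.span \<C> V A = carrier V) \<longleftrightarrow>
    (\<exists>A. finite A \<and> card A = k \<and> A \<subseteq> carrier W \<and> LinearCombinations.module.span \<C> W A = carrier W)" for k
    using linear_bij_gen_set[OF V W f bij] linear_bij_gen_set[OF W V g g_bij] by metis
  then show ?thesis
    using V W by (simp add: vectorspace.dim_def)
qed


section \<open>Quotients of spaces of finitely supported functions\<close>

abbreviation scale :: "complex \<Rightarrow> ('k \<Rightarrow>\<^sub>0 complex) \<Rightarrow> ('k \<Rightarrow>\<^sub>0 complex)"
  where "scale c \<equiv> Poly_Mapping.map ((*) c)"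

text \<open>
  Both the symmetric algebra and the space on which a tensor product is built consist of finitely
  supported functions, with pointwise operations.
\<close>

locale pm_space = Module.module \<C> V for V :: "(complex, 'k \<Rightarrow>\<^sub>0 complex, 'x) module_scheme" +
  assumes add_V: "add V = (+)" and zero_V: "zero V = 0"
    and smult_V: "module.smult V = (\<lambda>c. scale c)"

lemma lookup_scale [simp]: "lookup (scale c p) k = c * lookup p k"
  by (simp add: Poly_Mapping.map.rep_eq when_def)

lemma scale_single: "scale c (single k d) = single k (c * d)"
  by (rule poly_mapping_eqI) (simp add: lookup_single when_def)

lemma scale_add: "scale c (p + q) = scale c p + scale c q"
  by (rule poly_mapping_eqI) (simp add: lookup_add distrib_left)

lemma scale_zero [simp]: "scale c 0 = 0"
  by (rule poly_mapping_eqI) simp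

lemma keys_scale: "keys (scale c p) \<subseteq> keys p"
  by (auto simp: in_keys_iff)

definition coset :: "('k \<Rightarrow>\<^sub>0 complex) set \<Rightarrow> ('k \<Rightarrow>\<^sub>0 complex) \<Rightarrow> ('k \<Rightarrow>\<^sub>0 complex) set"
  where "coset N x = (\<lambda>h. h + x) ` N"

locale pm_quotient = pm_space V for V :: "(complex, 'k \<Rightarrow>\<^sub>0 complex, 'x) module_scheme" +
  fixes N :: "('k \<Rightarrow>\<^sub>0 complex) set"
  assumes N_submodule: "LinearCombinations.submodule \<C> N V"
begin

lemma N_zero: "0 \<in> N"
  and N_add: "x \<in> N \<Longrightarrow> y \<in> N \<Longrightarrow> x + y \<in> N"
  and N_scale: "x \<in> N \<Longrightarrow> scale c x \<in> N"
  using submodule.zero_closed[OF N_submodule]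
    submodule.m_closed[OF N_submodule] submodule.smult_closed[OF N_submodule, of c]
  by (auto simp: add_V zero_V smult_V)

lemma V_zero: "0 \<in> carrier V"
  and V_add: "x \<in> carrier V \<Longrightarrow> y \<in> carrier V \<Longrightarrow> x + y \<in> carrier V"
  and V_scale: "x \<in> carrier V \<Longrightarrow> scale c x \<in> carrier V"
  using zero_closed add.m_closed smult_closed[of c] by (auto simp: add_V zero_V smult_V)

lemma scale_minus_1: "scale (- 1) x = - x" for x :: "'k \<Rightarrow>\<^sub>0 complex"
  by (rule poly_mapping_eqI) simp

lemma N_uminus: "x \<in> N \<Longrightarrow> - x \<in> N"
  using N_scale[of x "- 1"] by (simp add: scale_minus_1)

lemma V_uminus: "x \<in> carrier V \<Longrightarrow> - x \<in> carrier V"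
  using V_scale[of x "- 1"] by (simp add: scale_minus_1)

lemma N_diff: "x \<in> N \<Longrightarrow> y \<in> N \<Longrightarrow> x - y \<in> N"
  using N_add[of x "- y"] N_uminus by simp

lemma r_coset: "N +>\<^bsub>V\<^esub> x = coset N x"
  by (auto simp: a_r_coset_def r_coset_def coset_def add_V)

lemma mem_coset_iff: "y \<in> coset N x \<longleftrightarrow> y - x \<in> N"
  by (force simp: coset_def image_iff)

lemma self_mem_coset: "x \<in> coset N x"
  by (simp add: mem_coset_iff N_zero)

lemma coset_eq_iff: "coset N x = coset N y \<longleftrightarrow> x - y \<in> N"
proof
  assume "coset N x = coset N y"
  then show "x - y \<in> N"
    using self_mem_coset[of x] by (simp add: mem_coset_iff)
next
  assume xy: "x - y \<in> N"
  have "z - x \<in> N \<longleftrightarrow> z - y \<in> N" for z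
    using N_add[OF _ xy, of "z - x"] N_diff[OF _ xy, of "z - y"] by auto
  then show "coset N x = coset N y"
    by (auto simp: mem_coset_iff)
qed

lemma quot_carrier: "carrier (quot V N) = coset N ` carrier V"
  by (auto simp: quot_def FactRing_def A_RCOSETS_def RCOSETS_def r_coset[unfolded a_r_coset_def]
      ring.defs module.defs)

lemma quot_zero: "\<zero>\<^bsub>quot V N\<^esub> = coset N 0"
  by (auto simp: quot_def FactRing_def ring.defs module.defs coset_def)

lemma quot_add: "coset N x \<oplus>\<^bsub>quot V N\<^esub> coset N y = coset N (x + y)"
proof -
  have "coset N x \<oplus>\<^bsub>quot V N\<^esub> coset N y = (\<Union>h\<in>coset N x. \<Union>k\<in>coset N y. {h + k})"
    by (simp add: quot_def FactRing_def ring.defs module.defs set_add_def set_mult_def add_V)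
  also have "\<dots> = coset N (x + y)"
  proof (intro equalityI subsetI)
    fix z
    assume "z \<in> (\<Union>h\<in>coset N x. \<Union>k\<in>coset N y. {h + k})"
    then obtain h k where "h - x \<in> N" "k - y \<in> N" "z = h + k"
      by (auto simp: mem_coset_iff)
    moreover from this have "(h - x) + (k - y) \<in> N"
      by (intro N_add)
    ultimately show "z \<in> coset N (x + y)"
      by (simp add: mem_coset_iff algebra_simps)
  next
    fix z
    assume "z \<in> coset N (x + y)"
    then have "z - y \<in> coset N x"
      by (simp add: mem_coset_iff algebra_simps)
    then show "z \<in> (\<Union>h\<in>coset N x. \<Union>k\<in>coset N y. {h + k})"
      using self_mem_coset[of y] by (intro UN_I[of "z - y"] UN_I[of y]) auto
  qed
  finally show ?thesis .
qed

lemma quot_smult: "c \<odot>\<^bsub>quot V N\<^esub> coset N x = coset N (scale c x)"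
proof -
  have "coset N (scale c y) = coset N (scale c x)" if "y \<in> coset N x" for y
  proof -
    have "scale c y - scale c x = scale c (y - x)"
      by (rule poly_mapping_eqI) (simp add: lookup_minus right_diff_distrib)
    then show ?thesis
      using that N_scale by (simp add: coset_eq_iff mem_coset_iff)
  qed
  then have "(\<Union>y\<in>coset N x. coset N (scale c y)) = coset N (scale c x)"
    using self_mem_coset[of x] by (intro SUP_eq_const) blast+
  then show ?thesis
    by (simp add: quot_def ring.defs module.defs smult_V r_coset)
qed

lemma quot_vectorspace: "vectorspace \<C> (quot V N)"
proof (rule vs_criteria)
  show "field \<C>"
    by (rule class_field)
  show "\<forall>v\<in>carrier (quot V N). \<exists>w\<in>carrier (quot V N). v \<oplus>\<^bsub>quot V N\<^esub> w = \<zero>\<^bsub>quot V N\<^esub>"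
  proof
    fix v
    assume "v \<in> carrier (quot V N)"
    then obtain x where x: "x \<in> carrier V" "v = coset N x"
      by (auto simp: quot_carrier)
    then show "\<exists>w\<in>carrier (quot V N). v \<oplus>\<^bsub>quot V N\<^esub> w = \<zero>\<^bsub>quot V N\<^esub>"
      using V_uminus[of x] by (intro bexI[of _ "coset N (- x)"]) (auto simp: quot_carrier quot_add quot_zero)
  qed
  have scale: "scale (a + b) x = scale a x + scale b x"
    "scale (a * b) x = scale a (scale b x)"
    "scale 1 x = x"
    "scale a (x + y) = scale a x + scale a y"
    for a b :: complex and x y :: "'k \<Rightarrow>\<^sub>0 complex"
    by (rule poly_mapping_eqI; simp add: lookup_add algebra_simps)+
  show "\<forall>a b v. a \<in> carrier \<C> \<and> b \<in> carrier \<C> \<and> v \<in> carrier (quot V N) \<longrightarrow>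
      (a \<oplus>\<^bsub>\<C>\<^esub> b) \<odot>\<^bsub>quot V N\<^esub> v = a \<odot>\<^bsub>quot V N\<^esub> v \<oplus>\<^bsub>quot V N\<^esub> b \<odot>\<^bsub>quot V N\<^esub> v"
    by (auto simp: quot_carrier quot_add quot_smult scale)
  show "\<forall>a b v. a \<in> carrier \<C> \<and> b \<in> carrier \<C> \<and> v \<in> carrier (quot V N) \<longrightarrow>
      (a \<otimes>\<^bsub>\<C>\<^esub> b) \<odot>\<^bsub>quot V N\<^esub> v = a \<odot>\<^bsub>quot V N\<^esub> (b \<odot>\<^bsub>quot V N\<^esub> v)"
    by (auto simp: quot_carrier quot_smult scale)
  show "\<forall>v\<in>carrier (quot V N). \<one>\<^bsub>\<C>\<^esub> \<odot>\<^bsub>quot V N\<^esub> v = v"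
    by (auto simp: quot_carrier quot_smult scale)
  show "\<forall>a v w. a \<in> carrier \<C> \<and> v \<in> carrier (quot V N) \<and> w \<in> carrier (quot V N) \<longrightarrow>
      a \<odot>\<^bsub>quot V N\<^esub> (v \<oplus>\<^bsub>quot V N\<^esub> w) = a \<odot>\<^bsub>quot V N\<^esub> v \<oplus>\<^bsub>quot V N\<^esub> a \<odot>\<^bsub>quot V N\<^esub> w"
    by (auto simp: quot_carrier quot_add quot_smult scale)
qed (auto simp: quot_carrier quot_add quot_smult quot_zero V_zero V_add V_scale algebra_simps)

end


section \<open>Tensor products\<close>

lemma free_space_simps:
  "p \<in> carrier (free_space S) \<longleftrightarrow> keys p \<subseteq> S" "\<zero>\<^bsub>free_space S\<^esub> = 0"
  "add (free_space S) = (+)" "module.smult (free_space S) = (\<lambda>c. scale c)"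
  by (simp_all add: free_space_def)

lemma free_space_vectorspace: "vectorspace \<C> (free_space S)"
proof (rule vs_criteria)
  show "field \<C>"
    by (rule class_field)
  show "\<forall>v\<in>carrier (free_space S). \<exists>w\<in>carrier (free_space S). v \<oplus>\<^bsub>free_space S\<^esub> w = \<zero>\<^bsub>free_space S\<^esub>"
  proof
    fix v
    assume "v \<in> carrier (free_space S)"
    then show "\<exists>w\<in>carrier (free_space S). v \<oplus>\<^bsub>free_space S\<^esub> w = \<zero>\<^bsub>free_space S\<^esub>"
      by (intro bexI[of _ "- v"]) (auto simp: free_space_simps)
  qed
  show "\<forall>v w. v \<in> carrier (free_space S) \<and> w \<in> carrier (free_space S) \<longrightarrow>
      v \<oplus>\<^bsub>free_space S\<^esub> w \<in> carrier (free_space S)"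
    using keys_add by (fastforce simp: free_space_simps)
  show "\<forall>c v. c \<in> carrier \<C> \<and> v \<in> carrier (free_space S) \<longrightarrow>
      c \<odot>\<^bsub>free_space S\<^esub> v \<in> carrier (free_space S)"
    using keys_scale by (fastforce simp: free_space_simps)
qed (auto simp: free_space_simps lookup_add algebra_simps intro!: poly_mapping_eqI)

lemma free_space_pm_space: "pm_space (free_space S)"
proof -
  interpret vectorspace \<C> "free_space S"
    by (rule free_space_vectorspace)
  show ?thesis
    by unfold_locales (simp_all add: free_space_simps)
qed

lemma free_space_single: "k \<in> S \<Longrightarrow> single k c \<in> carrier (free_space S)"
  by (simp add: free_space_simps)

lemma free_space_add: "p \<in> carrier (free_space S) \<Longrightarrow> q \<in> carrier (free_space S) \<Longrightarrow>
    p + q \<in> carrier (free_space S)"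
  using keys_add[of p q] by (auto simp: free_space_simps)

lemma free_space_diff: "p \<in> carrier (free_space S) \<Longrightarrow> q \<in> carrier (free_space S) \<Longrightarrow>
    p - q \<in> carrier (free_space S)"
  using keys_diff[of p q] by (auto simp: free_space_simps)

lemma tensor_relators_subset:
  assumes "vectorspace \<C> M" "vectorspace \<C> U"
  shows "tensor_relators M U \<subseteq> carrier (free_space (carrier M \<times> carrier U))"
proof -
  interpret M: vectorspace \<C> M by (rule assms)
  interpret U: vectorspace \<C> U by (rule assms)
  show ?thesis
    by (auto simp: tensor_relators_def Let_def intro!: free_space_diff free_space_single)
qed

lemma tensor_pm_quotient:
  assumes "vectorspace \<C> M" "vectorspace \<C> U"
  shows "pm_quotient (free_space (carrier M \<times> carrier U)) (tensor_null M U)"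
proof -
  interpret F: vectorspace \<C> "free_space (carrier M \<times> carrier U)"
    by (rule free_space_vectorspace)
  show ?thesis
    unfolding pm_quotient_def pm_quotient_axioms_def tensor_null_def
    by (intro conjI free_space_pm_space F.span_is_submodule tensor_relators_subset assms)
qed

lemma tensor_space_vectorspace:
  "vectorspace \<C> M \<Longrightarrow> vectorspace \<C> U \<Longrightarrow> vectorspace \<C> (tensor_space M U)"
  unfolding tensor_space_def by (rule pm_quotient.quot_vectorspace[OF tensor_pm_quotient])

lemma tensor_relators_null:
  assumes "vectorspace \<C> M" "vectorspace \<C> U"
  shows "tensor_relators M U \<subseteq> tensor_null M U"
proof -
  interpret F: vectorspace \<C> "free_space (carrier M \<times> carrier U)"
    by (rule free_space_vectorspace)
  show ?thesis
    unfolding tensor_null_def by (rule F.in_own_span[OF tensor_relators_subset[OF assms]])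
qed

text \<open>
  The map \<open>f \<otimes> g\<close> before passing to the quotient by the tensor relations.
\<close>

definition push :: "('m \<Rightarrow> 'n) \<Rightarrow> ('u \<Rightarrow> 'v) \<Rightarrow> ('m \<times> 'u \<Rightarrow>\<^sub>0 complex) \<Rightarrow> ('n \<times> 'v \<Rightarrow>\<^sub>0 complex)"
  where "push f g p = (\<Sum>(m, u)\<in>keys p. single (f m, g u) (lookup p (m, u)))"

lemma push_superset:
  "finite S \<Longrightarrow> keys p \<subseteq> S \<Longrightarrow> push f g p = (\<Sum>(m, u)\<in>S. single (f m, g u) (lookup p (m, u)))"
  unfolding push_def by (rule sum.mono_neutral_left) (auto simp: in_keys_iff)

lemma push_add: "push f g (p + q) = push f g p + push f g q"
proof -
  have "keys (p + q) \<subseteq> keys p \<union> keys q"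
    by (rule keys_add)
  then show ?thesis
    by (simp add: push_superset[of "keys p \<union> keys q"] lookup_add single_add sum.distrib case_prod_beta)
qed

lemma push_zero [simp]: "push f g 0 = 0"
  by (simp add: push_def)

lemma push_single [simp]: "push f g (single (m, u) c) = single (f m, g u) c"
  by (cases "c = 0") (simp_all add: push_def)

lemma push_scale: "push f g (scale c p) = scale c (push f g p)"
proof (induction p rule: single_induct)
  case (single e d)
  then show ?case
    by (cases e) (simp add: scale_single)
qed (simp_all add: scale_add push_add)

lemma push_uminus: "push f g (- p) = - push f g p"
  using push_add[of f g p "- p"] by (simp add: eq_neg_iff_add_eq_0 add.commute)

lemma push_diff: "push f g (p - q) = push f g p - push f g q"
  using push_add[of f g p "- q"] by (simp add: push_uminus)

lemma push_push: "push f' g' (push f g p) = push (f' \<circ> f) (g' \<circ> g) p"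
proof (induction p rule: single_induct)
  case (single e d)
  then show ?case
    by (cases e) simp
qed (simp_all add: push_add)

lemma push_cong:
  assumes "p \<in> carrier (free_space (S \<times> S'))" "\<And>m. m \<in> S \<Longrightarrow> f m = f' m" "\<And>u. u \<in> S' \<Longrightarrow> g u = g' u"
  shows "push f g p = push f' g' p"
  unfolding push_def using assms by (intro sum.cong) (auto simp: free_space_simps)

lemma push_id: "push (\<lambda>m. m) (\<lambda>u. u) p = p"
  using sum_singles[of p] by (simp add: push_def case_prod_beta)

lemma push_carrier:
  assumes p: "p \<in> carrier (free_space (S \<times> S'))" and f: "\<And>m. m \<in> S \<Longrightarrow> f m \<in> R" and g: "\<And>u. u \<in> S' \<Longrightarrow> g u \<in> R'"
  shows "push f g p \<in> carrier (free_space (R \<times> R'))"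
proof -
  have "(\<Sum>(m, u)\<in>K. single (f m, g u) (lookup p (m, u))) \<in> carrier (free_space (R \<times> R'))"
    if "finite K" "K \<subseteq> S \<times> S'" for K
    using that
  proof (induction K)
    case (insert k K)
    then show ?case
      using f g by (auto intro!: free_space_add free_space_single)
  qed (simp add: free_space_simps)
  then show ?thesis
    using p unfolding push_def by (simp add: free_space_simps)
qed

text \<open>
  Linear maps send tensor relators to tensor relators, so the preimage of the null space is a
  subspace that contains the relators.
\<close>

lemma push_null:
  assumes V: "vectorspace \<C> M" "vectorspace \<C> U" "vectorspace \<C> M'" "vectorspace \<C> U'"
    and f: "f \<in> linear_maps M M'" and g: "g \<in> linear_maps U U'" and p: "p \<in> tensor_null M U"
  shows "push f g p \<in> tensor_null M' U'"
proof -
  let ?F = "free_space (carrier M \<times> carrier U)"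
  interpret F: vectorspace \<C> ?F
    by (rule free_space_vectorspace)
  interpret M: vectorspace \<C> M by (rule V)
  interpret U: vectorspace \<C> U by (rule V)
  interpret Q: pm_quotient "free_space (carrier M' \<times> carrier U')" "tensor_null M' U'"
    by (rule tensor_pm_quotient[OF V(3,4)])
  have "LinearCombinations.submodule \<C> {p \<in> carrier ?F. push f g p \<in> tensor_null M' U'} ?F"
    by (rule submodule.intro)
       (use F.module_axioms F.add.m_closed F.smult_closed F.zero_closed
         in \<open>auto simp: free_space_simps(2-4) push_add push_scale Q.N_add Q.N_scale Q.N_zero\<close>)
  moreover have "tensor_relators M U \<subseteq> {p \<in> carrier ?F. push f g p \<in> tensor_null M' U'}"
  proof
    fix r
    assume r: "r \<in> tensor_relators M U"
    then have "push f g r \<in> tensor_relators M' U'"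
      unfolding tensor_relators_def Let_def
      using linear_maps_closed[OF f] linear_maps_closed[OF g]
      by (elim UnE CollectE exE conjE)
         (simp_all add: push_diff linear_maps_add[OF f] linear_maps_add[OF g] linear_maps_smult[OF f]
            linear_maps_smult[OF g], blast+)
    then show "r \<in> {p \<in> carrier ?F. push f g p \<in> tensor_null M' U'}"
      using r tensor_relators_subset[OF V(1,2)] tensor_relators_null[OF V(3,4)] by blast
  qed
  ultimately have "tensor_null M U \<subseteq> {p \<in> carrier ?F. push f g p \<in> tensor_null M' U'}"
    unfolding tensor_null_def[of M U] by (intro F.span_is_subset)
  then show ?thesis
    using p by blast
qed

text \<open>
  The map \<open>f \<otimes> g\<close> between tensor products of possibly different spaces; \<^const>\<open>tensor_map\<close> is the case
  of endomorphisms.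
\<close>

definition tensor_hom ::
    "(complex, 'n, 'x) module_scheme \<Rightarrow> (complex, 'v, 'y) module_scheme \<Rightarrow>
     ('m \<Rightarrow> 'n) \<Rightarrow> ('u \<Rightarrow> 'v) \<Rightarrow> ('m \<times> 'u \<Rightarrow>\<^sub>0 complex) set \<Rightarrow> ('n \<times> 'v \<Rightarrow>\<^sub>0 complex) set"
  where "tensor_hom M' U' f g Y = (\<Union>y\<in>Y. tensor_null M' U'
    +>\<^bsub>free_space (carrier M' \<times> carrier U')\<^esub> push f g y)"

lemma tensor_map_tensor_hom: "tensor_map M U f g = tensor_hom M U f g"
  by (simp add: fun_eq_iff tensor_map_def tensor_hom_def push_def)

lemma tensor_hom_coset:
  assumes V: "vectorspace \<C> M" "vectorspace \<C> U" "vectorspace \<C> M'" "vectorspace \<C> U'"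
    and f: "f \<in> linear_maps M M'" and g: "g \<in> linear_maps U U'"
  shows "tensor_hom M' U' f g (coset (tensor_null M U) p) = coset (tensor_null M' U') (push f g p)"
proof -
  interpret Q: pm_quotient "free_space (carrier M \<times> carrier U)" "tensor_null M U"
    by (rule tensor_pm_quotient[OF V(1,2)])
  interpret Q': pm_quotient "free_space (carrier M' \<times> carrier U')" "tensor_null M' U'"
    by (rule tensor_pm_quotient[OF V(3,4)])
  have "coset (tensor_null M' U') (push f g y) = coset (tensor_null M' U') (push f g p)"
    if "y \<in> coset (tensor_null M U) p" for y
    using that push_null[OF V f g] by (simp add: Q.mem_coset_iff Q'.coset_eq_iff push_diff[symmetric])
  then show ?thesis
    unfolding tensor_hom_def Q'.r_coset using Q.self_mem_coset[of p] by (intro SUP_eq_const) blast+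
qed

lemma tensor_space_carrier:
  assumes "vectorspace \<C> M" "vectorspace \<C> U"
  shows "carrier (tensor_space M U) = coset (tensor_null M U) ` carrier (free_space (carrier M \<times> carrier U))"
  unfolding tensor_space_def by (rule pm_quotient.quot_carrier[OF tensor_pm_quotient[OF assms]])

lemma tensor_hom_linear:
  assumes V: "vectorspace \<C> M" "vectorspace \<C> U" "vectorspace \<C> M'" "vectorspace \<C> U'"
    and f: "f \<in> linear_maps M M'" and g: "g \<in> linear_maps U U'"
  shows "tensor_hom M' U' f g \<in> linear_maps (tensor_space M U) (tensor_space M' U')"
proof -
  interpret Q: pm_quotient "free_space (carrier M \<times> carrier U)" "tensor_null M U"
    by (rule tensor_pm_quotient[OF V(1,2)])
  interpret Q': pm_quotient "free_space (carrier M' \<times> carrier U')" "tensor_null M' U'"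
    by (rule tensor_pm_quotient[OF V(3,4)])
  have "push f g p \<in> carrier (free_space (carrier M' \<times> carrier U'))"
    if "p \<in> carrier (free_space (carrier M \<times> carrier U))" for p
    using that by (rule push_carrier) (use linear_maps_closed[OF f] linear_maps_closed[OF g] in auto)
  then show ?thesis
    unfolding linear_maps_iff tensor_space_def Q.quot_carrier Q'.quot_carrier
    by (auto simp: tensor_hom_coset[OF V f g] Q.quot_add Q.quot_smult Q'.quot_add Q'.quot_smult
        push_add push_scale)
qed

lemma linear_maps_compose:
  "f \<in> linear_maps V W \<Longrightarrow> g \<in> linear_maps W X \<Longrightarrow> g \<circ> f \<in> linear_maps V X"
  by (simp add: linear_maps_iff)

lemma tensor_hom_bij:
  assumes V: "vectorspace \<C> M" "vectorspace \<C> U" "vectorspace \<C> M'" "vectorspace \<C> U'"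
    and f: "f \<in> linear_maps M M'" "bij_betw f (carrier M) (carrier M')"
    and g: "g \<in> linear_maps U U'" "bij_betw g (carrier U) (carrier U')"
  shows "bij_betw (tensor_hom M' U' f g) (carrier (tensor_space M U)) (carrier (tensor_space M' U'))"
proof -
  let ?f = "inv_into (carrier M) f" and ?g = "inv_into (carrier U) g"
  have f': "?f \<in> linear_maps M' M" and g': "?g \<in> linear_maps U' U"
    by (intro linear_maps_inv V f g)+
  have inv: "\<And>m. m \<in> carrier M \<Longrightarrow> ?f (f m) = m" "\<And>u. u \<in> carrier U \<Longrightarrow> ?g (g u) = u"
    "\<And>m. m \<in> carrier M' \<Longrightarrow> f (?f m) = m" "\<And>u. u \<in> carrier U' \<Longrightarrow> g (?g u) = u"
    using f g by (auto simp: bij_betw_def f_inv_into_f)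
  have "push (?f \<circ> f) (?g \<circ> g) p = p" if "p \<in> carrier (free_space (carrier M \<times> carrier U))" for p
    using push_cong[OF that, of "?f \<circ> f" "\<lambda>m. m" "?g \<circ> g" "\<lambda>u. u"] inv by (simp add: push_id)
  moreover have "push (f \<circ> ?f) (g \<circ> ?g) p = p" if "p \<in> carrier (free_space (carrier M' \<times> carrier U'))" for p
    using push_cong[OF that, of "f \<circ> ?f" "\<lambda>m. m" "g \<circ> ?g" "\<lambda>u. u"] inv by (simp add: push_id)
  ultimately have
    "\<And>y. y \<in> carrier (tensor_space M U) \<Longrightarrow> tensor_hom M U ?f ?g (tensor_hom M' U' f g y) = y"
    "\<And>y. y \<in> carrier (tensor_space M' U') \<Longrightarrow> tensor_hom M' U' f g (tensor_hom M U ?f ?g y) = y"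
    by (auto simp: tensor_space_carrier[OF V(1,2)] tensor_space_carrier[OF V(3,4)]
        tensor_hom_coset[OF V f(1) g(1)] tensor_hom_coset[OF V(3,4,1,2) f' g'] push_push)
  then show ?thesis
    using linear_maps_closed[OF tensor_hom_linear[OF V f(1) g(1)]]
      linear_maps_closed[OF tensor_hom_linear[OF V(3,4,1,2) f' g']]
    by (intro bij_betw_byWitness[of _ "tensor_hom M U ?f ?g"]) blast+
qed

text \<open>Signs cancel in a tensor product: \<open>(-m) \<otimes> (-u) = m \<otimes> u\<close>.\<close>

lemma push_sign_cancel:
  assumes V: "vectorspace \<C> M" "vectorspace \<C> U"
    and p: "p \<in> carrier (free_space (S \<times> S'))"
    and f: "\<And>m. m \<in> S \<Longrightarrow> f m \<in> carrier M \<and> f' m = (- 1) \<odot>\<^bsub>M\<^esub> f m"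
    and g: "\<And>u. u \<in> S' \<Longrightarrow> g u \<in> carrier U \<and> g' u = (- 1) \<odot>\<^bsub>U\<^esub> g u"
  shows "push f' g' p - push f g p \<in> tensor_null M U"
proof -
  interpret Q: pm_quotient "free_space (carrier M \<times> carrier U)" "tensor_null M U"
    by (rule tensor_pm_quotient[OF V])
  interpret M: vectorspace \<C> M by (rule V)
  interpret U: vectorspace \<C> U by (rule V)
  have cancel: "single ((- 1) \<odot>\<^bsub>M\<^esub> m, (- 1) \<odot>\<^bsub>U\<^esub> u) c - single (m, u) c \<in> tensor_null M U"
    if m: "m \<in> carrier M" and u: "u \<in> carrier U" for m u c
  proof -
    let ?m = "(- 1) \<odot>\<^bsub>M\<^esub> m" and ?u = "(- 1) \<odot>\<^bsub>U\<^esub> u"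
    have u': "?u \<in> carrier U"
      using u by simp
    have "single (?m, ?u) 1 - single (m, ?u) (- 1) \<in> tensor_null M U"
      using tensor_relators_null[OF V] m u' unfolding tensor_relators_def Let_def by blast
    moreover have "single (m, ?u) 1 - single (m, u) (- 1) \<in> tensor_null M U"
      using tensor_relators_null[OF V] m u unfolding tensor_relators_def Let_def by blast
    ultimately have "(single (?m, ?u) 1 - single (m, ?u) (- 1)) - (single (m, ?u) 1 - single (m, u) (- 1))
        \<in> tensor_null M U"
      by (rule Q.N_diff)
    then have "single (?m, ?u) 1 - single (m, u) 1 \<in> tensor_null M U"
      by (simp add: single_uminus)
    from Q.N_scale[OF this, of c] show ?thesis
      by (simp add: scale_single scale_add diff_conv_add_uminus single_uminus[symmetric] del: add_uminus_conv_diff)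
  qed
  have "push f' g' p - push f g p = (\<Sum>(m, u)\<in>keys p.
      single (f' m, g' u) (lookup p (m, u)) - single (f m, g u) (lookup p (m, u)))"
    by (simp add: push_def sum_subtractf case_prod_beta)
  also have "\<dots> \<in> tensor_null M U"
  proof -
    have "(\<Sum>(m, u)\<in>K. single (f' m, g' u) (lookup p (m, u)) - single (f m, g u) (lookup p (m, u)))
        \<in> tensor_null M U" if "finite K" "K \<subseteq> S \<times> S'" for K
      using that
    proof (induction K)
      case (insert k K)
      then show ?case
        using f g by (auto intro!: Q.N_add cancel)
    qed (simp add: Q.N_zero)
    then show ?thesis
      using p by (simp add: free_space_simps)
  qed
  finally show ?thesis .
qed

text \<open>
  This is where the twist of the basic spin module meets the twist of the coinvariant algebra: \<open>d\<close>
  anticommutes with \<open>t\<close> and \<open>F\<close> with \<open>r\<close>, hence \<open>d \<otimes> F\<close> commutes with \<open>t \<otimes> r\<close>.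
\<close>

lemma tensor_hom_intertwine:
  assumes V: "vectorspace \<C> M" "vectorspace \<C> U" "vectorspace \<C> U'"
    and d: "d \<in> linear_maps M M" and t: "t \<in> linear_maps M M"
    and F: "F \<in> linear_maps U U'" and r: "r \<in> linear_maps U U" and r': "r' \<in> linear_maps U' U'"
    and dt: "\<And>m. m \<in> carrier M \<Longrightarrow> d (t m) = (- 1) \<odot>\<^bsub>M\<^esub> t (d m)"
    and Fr: "\<And>u. u \<in> carrier U \<Longrightarrow> F (r u) = (- 1) \<odot>\<^bsub>U'\<^esub> r' (F u)"
    and y: "y \<in> carrier (tensor_space M U)"
  shows "tensor_hom M U' d F (tensor_hom M U t r y) = tensor_hom M U' t r' (tensor_hom M U' d F y)"
proof -
  interpret Q: pm_quotient "free_space (carrier M \<times> carrier U')" "tensor_null M U'"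
    by (rule tensor_pm_quotient[OF V(1,3)])
  obtain p where p: "p \<in> carrier (free_space (carrier M \<times> carrier U))" "y = coset (tensor_null M U) p"
    using y by (auto simp: tensor_space_carrier[OF V(1,2)])
  have "push (d \<circ> t) (F \<circ> r) p - push (t \<circ> d) (r' \<circ> F) p \<in> tensor_null M U'"
    using linear_maps_closed[OF t] linear_maps_closed[OF d] linear_maps_closed[OF F] linear_maps_closed[OF r']
    by (intro push_sign_cancel[OF V(1,3) p(1)]) (auto simp: dt Fr)
  then show ?thesis
    unfolding p(2)
    by (simp add: tensor_hom_coset[OF V(1,2,1,2) t r] tensor_hom_coset[OF V(1,2,1,3) d F]
        tensor_hom_coset[OF V(1,3,1,3) t r'] push_push Q.coset_eq_iff)
qed

text \<open>
  The relator \<open>m \<otimes> (0 \<cdot> 0) - 0 (m \<otimes> 0)\<close> kills the pure tensor \<open>m \<otimes> 0\<close>.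
\<close>

lemma tensor_space_trivial:
  assumes M: "vectorspace \<C> M" and U: "vectorspace \<C> U" and zero: "carrier U = {\<zero>\<^bsub>U\<^esub>}"
  shows "carrier (tensor_space M U) = {\<zero>\<^bsub>tensor_space M U\<^esub>}"
proof -
  interpret M: vectorspace \<C> M by (rule M)
  interpret U: vectorspace \<C> U by (rule U)
  interpret T: pm_quotient "free_space (carrier M \<times> carrier U)" "tensor_null M U"
    by (rule tensor_pm_quotient[OF M U])
  have gen: "single (m, \<zero>\<^bsub>U\<^esub>) c \<in> tensor_null M U" if m: "m \<in> carrier M" for m c
  proof -
    have "single (m, (0::complex) \<odot>\<^bsub>U\<^esub> \<zero>\<^bsub>U\<^esub>) 1 - single (m, \<zero>\<^bsub>U\<^esub>) 0 \<in> tensor_null M U"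
      using tensor_relators_null[OF M U] m U.zero_closed unfolding tensor_relators_def Let_def by blast
    then have "single (m, \<zero>\<^bsub>U\<^esub>) 1 \<in> tensor_null M U"
      by simp
    from T.N_scale[OF this, of c] show ?thesis
      by (simp add: scale_single)
  qed
  have "p \<in> tensor_null M U" if p: "p \<in> carrier (free_space (carrier M \<times> carrier U))" for p
  proof -
    have "(\<Sum>k\<in>K. single k (lookup p k)) \<in> tensor_null M U" if "finite K" "K \<subseteq> carrier M \<times> carrier U" for K
      using that by (induction K) (auto simp: T.N_zero zero gen intro!: T.N_add)
    then show ?thesis
      using p by (subst sum_singles) (simp add: free_space_simps)
  qed
  then have "coset (tensor_null M U) p = coset (tensor_null M U) 0"
    if "p \<in> carrier (free_space (carrier M \<times> carrier U))" for p
    using that by (simp add: T.coset_eq_iff)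
  then have "carrier (tensor_space M U) =
      (\<lambda>_. coset (tensor_null M U) 0) ` carrier (free_space (carrier M \<times> carrier U))"
    unfolding tensor_space_carrier[OF M U] by (rule image_cong[OF refl])
  also have "\<dots> = {coset (tensor_null M U) 0}"
    using T.V_zero by (rule image_constant)
  finally show ?thesis
    by (simp add: T.quot_zero[folded tensor_space_def])
qed


section \<open>Hom spaces\<close>

lemma linear_maps_zero:
  assumes V: "vectorspace \<C> V" and W: "vectorspace \<C> W" and f: "f \<in> linear_maps V W"
  shows "f \<zero>\<^bsub>V\<^esub> = \<zero>\<^bsub>W\<^esub>"
proof -
  interpret V: vectorspace \<C> V by (rule V)
  interpret W: vectorspace \<C> W by (rule W)
  interpret mod_hom \<C> V W f
    using f by unfold_locales
  show ?thesis
    by (rule f0_is_0)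
qed

lemma hom_space_carrier: "f \<in> carrier (hom_space A M N) \<longleftrightarrow>
    f \<in> linear_maps M N \<and> f \<in> extensional (carrier M) \<and>
    (\<forall>a\<in>carrier A. \<forall>m\<in>carrier M. f (act M a m) = act N a (f m))"
  by (simp add: hom_space_def)

lemma hom_space_simps:
  "\<zero>\<^bsub>hom_space A M N\<^esub> = (\<lambda>m\<in>carrier M. \<zero>\<^bsub>N\<^esub>)"
  "f \<oplus>\<^bsub>hom_space A M N\<^esub> g = (\<lambda>m\<in>carrier M. f m \<oplus>\<^bsub>N\<^esub> g m)"
  "c \<odot>\<^bsub>hom_space A M N\<^esub> f = (\<lambda>m\<in>carrier M. c \<odot>\<^bsub>N\<^esub> f m)"
  by (simp_all add: hom_space_def)

lemma hom_space_vectorspace: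
  assumes M: "alg_module A M" and N: "vectorspace \<C> N"
    and act: "\<And>a. a \<in> carrier A \<Longrightarrow> act N a \<in> linear_maps N N"
  shows "vectorspace \<C> (hom_space A M N)"
proof -
  interpret M: alg_module A M by (rule M)
  interpret N: vectorspace \<C> N by (rule N)
  note ext = extensionalityI[of _ "carrier M"]
  have closed: "f m \<in> carrier N" if "f \<in> carrier (hom_space A M N)" "m \<in> carrier M" for f m
    using that linear_maps_closed by (auto simp: hom_space_carrier)
  have zero: "(\<lambda>m\<in>carrier M. \<zero>\<^bsub>N\<^esub>) \<in> carrier (hom_space A M N)"
    using linear_maps_zero[OF N N act] by (simp add: hom_space_carrier linear_maps_iff M.act_closed)
  have add: "(\<lambda>m\<in>carrier M. f m \<oplus>\<^bsub>N\<^esub> g m) \<in> carrier (hom_space A M N)"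
    if "f \<in> carrier (hom_space A M N)" "g \<in> carrier (hom_space A M N)" for f g
    using that closed[OF that(1)] closed[OF that(2)] linear_maps_add[OF act]
    by (auto simp: hom_space_carrier linear_maps_iff M.act_closed N.a_ac N.smult_r_distr)
  have smult: "(\<lambda>m\<in>carrier M. c \<odot>\<^bsub>N\<^esub> f m) \<in> carrier (hom_space A M N)"
    if "f \<in> carrier (hom_space A M N)" for f c
    using that closed[OF that] linear_maps_smult[OF act]
    by (auto simp: hom_space_carrier linear_maps_iff M.act_closed N.smult_r_distr
        N.smult_assoc1[symmetric] mult.commute)
  have eq: "f = (\<lambda>m\<in>carrier M. g m)"
    if "f \<in> carrier (hom_space A M N)" "\<And>m. m \<in> carrier M \<Longrightarrow> f m = g m" for f g
    using that by (intro ext) (auto simp: hom_space_carrier)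
  show ?thesis
  proof (rule vs_criteria)
    show "field \<C>"
      by (rule class_field)
    show "\<forall>f\<in>carrier (hom_space A M N). \<exists>g\<in>carrier (hom_space A M N).
        f \<oplus>\<^bsub>hom_space A M N\<^esub> g = \<zero>\<^bsub>hom_space A M N\<^esub>"
    proof
      fix f
      assume f: "f \<in> carrier (hom_space A M N)"
      have "f m \<oplus>\<^bsub>N\<^esub> (- 1) \<odot>\<^bsub>N\<^esub> f m = \<zero>\<^bsub>N\<^esub>" if "m \<in> carrier M" for m
        using closed[OF f that] N.smult_minus_1[of "f m"] by (simp add: class_ring_simps N.r_neg)
      then show "\<exists>g\<in>carrier (hom_space A M N). f \<oplus>\<^bsub>hom_space A M N\<^esub> g = \<zero>\<^bsub>hom_space A M N\<^esub>"
        using smult[OF f, of "- 1"]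
        by (intro bexI[of _ "\<lambda>m\<in>carrier M. (- 1) \<odot>\<^bsub>N\<^esub> f m"])
           (auto simp: hom_space_simps intro!: restrict_ext)
    qed
    show "\<forall>f\<in>carrier (hom_space A M N). f \<oplus>\<^bsub>hom_space A M N\<^esub> \<zero>\<^bsub>hom_space A M N\<^esub> = f"
      using closed by (auto simp: hom_space_simps intro!: eq[symmetric])
    show "\<forall>f\<in>carrier (hom_space A M N). \<one>\<^bsub>\<C>\<^esub> \<odot>\<^bsub>hom_space A M N\<^esub> f = f"
      using closed N.smult_one by (auto simp: hom_space_simps intro!: eq[symmetric])
  qed (use closed in \<open>auto simp: hom_space_simps zero add smult N.a_ac N.smult_r_distr N.smult_l_distr
      N.smult_assoc1 intro!: restrict_ext\<close>,
      insert N.smult_l_distr N.smult_assoc1, simp_all)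
qed

text \<open>
  Composition with \<open>F\<close> is invertible, since the inverse of \<open>F\<close> commutes with the actions as well.
\<close>

lemma hom_space_dim_eq:
  assumes M: "alg_module A M" and N: "vectorspace \<C> N" "vectorspace \<C> N'"
    and act: "\<And>a. a \<in> carrier A \<Longrightarrow> act N a \<in> linear_maps N N"
      "\<And>a. a \<in> carrier A \<Longrightarrow> act N' a \<in> linear_maps N' N'"
    and F: "F \<in> linear_maps N N'" "bij_betw F (carrier N) (carrier N')"
    and act_F: "\<And>a v. a \<in> carrier A \<Longrightarrow> v \<in> carrier N \<Longrightarrow> F (act N a v) = act N' a (F v)"
  shows "vectorspace.dim \<C> (hom_space A M N) = vectorspace.dim \<C> (hom_space A M N')"
proof (rule dim_eq_of_linear_bij)
  interpret M: alg_module A M by (rule M)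
  let ?G = "inv_into (carrier N) F"
  have G: "?G \<in> linear_maps N' N"
    by (rule linear_maps_inv[OF N(1) F])
  have inv: "?G (F v) = v" if "v \<in> carrier N" for v
    using F(2) that by (auto simp: bij_betw_def)
  have inv': "F (?G v) = v" if "v \<in> carrier N'" for v
    using F(2) that by (auto simp: bij_betw_def f_inv_into_f)
  have act_G: "?G (act N' a v) = act N a (?G v)" if "a \<in> carrier A" "v \<in> carrier N'" for a v
  proof -
    have "F (act N a (?G v)) = act N' a v"
      using that act_F inv' linear_maps_closed[OF G] by simp
    then show ?thesis
      using inv[of "act N a (?G v)"] linear_maps_closed[OF act(1)[OF that(1)]] linear_maps_closed[OF G that(2)]
      by simp
  qed
  have comp: "(\<lambda>m\<in>carrier M. H (f m)) \<in> carrier (hom_space A M K')"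
    if "f \<in> carrier (hom_space A M K)" "H \<in> linear_maps K K'"
      "\<And>a v. a \<in> carrier A \<Longrightarrow> v \<in> carrier K \<Longrightarrow> H (act K a v) = act K' a (H v)"
    for f H and K :: "('a, 'k, 'x) alg_module_scheme" and K' :: "('a, 'l, 'y) alg_module_scheme"
    using that by (auto simp: hom_space_carrier linear_maps_iff M.act_closed)
  show "vectorspace \<C> (hom_space A M N)" "vectorspace \<C> (hom_space A M N')"
    by (rule hom_space_vectorspace[OF M N(1) act(1)], assumption)
       (rule hom_space_vectorspace[OF M N(2) act(2)])
  show "(\<lambda>f. \<lambda>m\<in>carrier M. F (f m)) \<in> linear_maps (hom_space A M N) (hom_space A M N')"
    unfolding linear_maps_iff
  proof (intro conjI ballI allI)
    fix f
    assume f: "f \<in> carrier (hom_space A M N)"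
    then have fm: "f m \<in> carrier N" if "m \<in> carrier M" for m
      using that linear_maps_closed by (auto simp: hom_space_carrier)
    show "(\<lambda>m\<in>carrier M. F (f m)) \<in> carrier (hom_space A M N')"
      by (rule comp[OF f F(1) act_F])
    show "(\<lambda>m\<in>carrier M. F ((c \<odot>\<^bsub>hom_space A M N\<^esub> f) m)) =
        c \<odot>\<^bsub>hom_space A M N'\<^esub> (\<lambda>m\<in>carrier M. F (f m))" for c
      using fm by (auto simp: hom_space_simps linear_maps_smult[OF F(1)] intro!: restrict_ext)
    fix g
    assume g: "g \<in> carrier (hom_space A M N)"
    then have gm: "g m \<in> carrier N" if "m \<in> carrier M" for m
      using that linear_maps_closed by (auto simp: hom_space_carrier)
    show "(\<lambda>m\<in>carrier M. F ((f \<oplus>\<^bsub>hom_space A M N\<^esub> g) m)) =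
        (\<lambda>m\<in>carrier M. F (f m)) \<oplus>\<^bsub>hom_space A M N'\<^esub> (\<lambda>m\<in>carrier M. F (g m))"
      using fm gm by (auto simp: hom_space_simps linear_maps_add[OF F(1)] intro!: restrict_ext)
  qed
  show "bij_betw (\<lambda>f. \<lambda>m\<in>carrier M. F (f m)) (carrier (hom_space A M N)) (carrier (hom_space A M N'))"
  proof (rule bij_betw_byWitness[of _ "\<lambda>f. \<lambda>m\<in>carrier M. ?G (f m)"])
    show "\<forall>f\<in>carrier (hom_space A M N). (\<lambda>m\<in>carrier M. ?G ((\<lambda>m\<in>carrier M. F (f m)) m)) = f"
      (is "\<forall>f\<in>_. ?H f")
    proof
      fix f
      assume f: "f \<in> carrier (hom_space A M N)"
      then have "f m \<in> carrier N" if "m \<in> carrier M" for m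
        using that linear_maps_closed by (auto simp: hom_space_carrier)
      then show "?H f"
        using f inv by (auto simp: hom_space_carrier intro!: extensionalityI[of _ "carrier M"])
    qed
    show "\<forall>f\<in>carrier (hom_space A M N'). (\<lambda>m\<in>carrier M. F ((\<lambda>m\<in>carrier M. ?G (f m)) m)) = f"
      (is "\<forall>f\<in>_. ?H f")
    proof
      fix f
      assume f: "f \<in> carrier (hom_space A M N')"
      then have "f m \<in> carrier N'" if "m \<in> carrier M" for m
        using that linear_maps_closed by (auto simp: hom_space_carrier)
      then show "?H f"
        using f inv' by (auto simp: hom_space_carrier intro!: extensionalityI[of _ "carrier M"])
    qed
  qed (use comp[OF _ F(1) act_F] comp[OF _ G act_G] in auto)
qed

lemma hom_space_dim_zero:
  assumes M: "alg_module A M" and N: "vectorspace \<C> N" and zero: "carrier N = {\<zero>\<^bsub>N\<^esub>}"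
    and act: "\<And>a. a \<in> carrier A \<Longrightarrow> act N a \<in> linear_maps N N"
  shows "vectorspace.dim \<C> (hom_space A M N) = 0"
proof -
  interpret H: vectorspace \<C> "hom_space A M N"
    by (rule hom_space_vectorspace[OF M N act])
  have "f = \<zero>\<^bsub>hom_space A M N\<^esub>" if "f \<in> carrier (hom_space A M N)" for f
    using that zero linear_maps_closed[of f M N] 
    by (auto simp: hom_space_simps hom_space_carrier intro!: extensionalityI[of _ "carrier M"])
  then have "carrier (hom_space A M N) = {\<zero>\<^bsub>hom_space A M N\<^esub>}"
    using H.zero_closed by blast
  then have "H.gen_set {}"
    using H.span_is_submodule[of "{}"] submodule.subset submodule.zero_closed by fastforce
  then have "\<exists>S. finite S \<and> card S = 0 \<and> S \<subseteq> carrier (hom_space A M N) \<and> H.gen_set S"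
    by (intro exI[of _ "{}"]) auto
  then show ?thesis
    unfolding H.dim_def by (rule Least_eq_0)
qed


section \<open>Modules over presented algebras\<close>

lemma foldr_linear:
  assumes V: "vectorspace \<C> V" and T: "\<And>i. i \<in> set is \<Longrightarrow> T i \<in> linear_maps V V"
  shows "foldr T is \<in> linear_maps V V"
  using T
proof (induction "is")
  case Nil
  then show ?case
    by (simp add: linear_maps_iff)
next
  case (Cons i "is")
  then have "T i \<circ> foldr T is \<in> linear_maps V V"
    by (intro linear_maps_compose) auto
  then show ?case
    by (simp only: foldr.simps)
qed

text \<open>
  An element \<open>a\<close> of a presented algebra acts through a representative that is picked by a choice
  operator.  The operators of the generators are under control for the first \<open>n\<close> letters only, so the
  representative must not involve any other letter.
\<close>

definition proper_element :: "nat \<Rightarrow> free set \<Rightarrow> bool"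
  where "proper_element n a \<longleftrightarrow> (\<forall>w\<in>keys (SOME p. p \<in> a). set (letters w) \<subseteq> {..<n})"

lemma presented_act_linear:
  assumes V: "vectorspace \<C> V" and T: "\<And>i. i < n \<Longrightarrow> T i \<in> linear_maps V V"
    and a: "proper_element n a"
  shows "presented_act V T a \<in> linear_maps V V"
proof -
  interpret V: vectorspace \<C> V by (rule V)
  define p where "p = (SOME p. p \<in> a)"
  have fold: "foldr T (letters w) \<in> linear_maps V V" if "w \<in> keys p" for w
    using that a T by (intro foldr_linear V) (auto simp: proper_element_def p_def)
  have eq: "presented_act V T a v =
      (\<Oplus>\<^bsub>V\<^esub>w\<in>keys p. lookup p w \<odot>\<^bsub>V\<^esub> foldr T (letters w) v)" for v
    by (simp add: presented_act_def p_def Let_def)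
  have closed: "(\<lambda>w. lookup p w \<odot>\<^bsub>V\<^esub> foldr T (letters w) v) \<in> keys p \<rightarrow> carrier V" if "v \<in> carrier V" for v
    using that linear_maps_closed[OF fold] by auto
  show ?thesis
    unfolding linear_maps_iff
  proof (intro conjI ballI allI)
    fix u
    assume u: "u \<in> carrier V"
    show "presented_act V T a u \<in> carrier V"
      unfolding eq using closed[OF u] by (rule V.finsum_closed)
    show "presented_act V T a (c \<odot>\<^bsub>V\<^esub> u) = c \<odot>\<^bsub>V\<^esub> presented_act V T a u" for c
    proof -
      have "presented_act V T a (c \<odot>\<^bsub>V\<^esub> u) =
          (\<Oplus>\<^bsub>V\<^esub>w\<in>keys p. c \<odot>\<^bsub>V\<^esub> (lookup p w \<odot>\<^bsub>V\<^esub> foldr T (letters w) u))"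
        unfolding eq
      proof (rule V.finsum_cong')
        fix w
        assume w: "w \<in> keys p"
        have "foldr T (letters w) u \<in> carrier V"
          using linear_maps_closed[OF fold[OF w] u] .
        then show "lookup p w \<odot>\<^bsub>V\<^esub> foldr T (letters w) (c \<odot>\<^bsub>V\<^esub> u) =
            c \<odot>\<^bsub>V\<^esub> (lookup p w \<odot>\<^bsub>V\<^esub> foldr T (letters w) u)"
          using V.smult_assoc1[of c "lookup p w"] V.smult_assoc1[of "lookup p w" c]
          by (simp add: linear_maps_smult[OF fold[OF w] u] mult.commute)
      qed (use closed[OF u] in auto)
      also have "\<dots> = c \<odot>\<^bsub>V\<^esub> presented_act V T a u"
        unfolding eq using closed[OF u] by (intro V.finsum_smult[symmetric]) auto
      finally show ?thesis .
    qed
    fix v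
    assume v: "v \<in> carrier V"
    have "presented_act V T a (u \<oplus>\<^bsub>V\<^esub> v) =
        (\<Oplus>\<^bsub>V\<^esub>w\<in>keys p. lookup p w \<odot>\<^bsub>V\<^esub> foldr T (letters w) u \<oplus>\<^bsub>V\<^esub> lookup p w \<odot>\<^bsub>V\<^esub> foldr T (letters w) v)"
      unfolding eq
    proof (rule V.finsum_cong')
      fix w
      assume w: "w \<in> keys p"
      show "lookup p w \<odot>\<^bsub>V\<^esub> foldr T (letters w) (u \<oplus>\<^bsub>V\<^esub> v) =
          lookup p w \<odot>\<^bsub>V\<^esub> foldr T (letters w) u \<oplus>\<^bsub>V\<^esub> lookup p w \<odot>\<^bsub>V\<^esub> foldr T (letters w) v"
        using linear_maps_closed[OF fold[OF w] u] linear_maps_closed[OF fold[OF w] v]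
        by (simp add: linear_maps_add[OF fold[OF w] u v] V.smult_r_distr)
    qed (use closed[OF u] closed[OF v] in auto)
    also have "\<dots> = presented_act V T a u \<oplus>\<^bsub>V\<^esub> presented_act V T a v"
      unfolding eq using closed[OF u] closed[OF v] by (rule V.finsum_addf)
    finally show "presented_act V T a (u \<oplus>\<^bsub>V\<^esub> v) = presented_act V T a u \<oplus>\<^bsub>V\<^esub> presented_act V T a v" .
  qed
qed

lemma presented_act_intertwine:
  assumes V: "vectorspace \<C> V" "vectorspace \<C> V'"
    and T: "\<And>i. i < n \<Longrightarrow> T i \<in> linear_maps V V"
    and F: "F \<in> linear_maps V V'"
    and TF: "\<And>i v. i < n \<Longrightarrow> v \<in> carrier V \<Longrightarrow> F (T i v) = T' i (F v)"
    and a: "proper_element n a" and v: "v \<in> carrier V"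
  shows "F (presented_act V T a v) = presented_act V' T' a (F v)"
proof -
  interpret V: vectorspace \<C> V by (rule V)
  interpret V': vectorspace \<C> V' by (rule V)
  interpret mod_hom \<C> V V' F
    using F by unfold_locales
  define p where "p = (SOME p. p \<in> a)"
  have letters: "set (letters w) \<subseteq> {..<n}" if "w \<in> keys p" for w
    using that a by (auto simp: proper_element_def p_def)
  have fold: "foldr T is v \<in> carrier V \<and> F (foldr T is v) = foldr T' is (F v)"
    if "set is \<subseteq> {..<n}" for "is"
    using that by (induction "is") (auto simp: v TF linear_maps_closed[OF T])
  have closed: "(\<lambda>w. lookup p w \<odot>\<^bsub>V\<^esub> foldr T (letters w) v) \<in> keys p \<rightarrow> carrier V"
    using fold letters by auto
  have "F (presented_act V T a v) =
      (\<Oplus>\<^bsub>V'\<^esub>w\<in>keys p. F (lookup p w \<odot>\<^bsub>V\<^esub> foldr T (letters w) v))"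
  proof -
    have "F (\<Oplus>\<^bsub>V\<^esub>w\<in>K. g w) = (\<Oplus>\<^bsub>V'\<^esub>w\<in>K. F (g w))"
      if "finite K" "g \<in> K \<rightarrow> carrier V" for K and g :: "word \<Rightarrow> 'a"
      using that
    proof (induction K)
      case (insert w K)
      then have "finsum V g K \<in> carrier V" "g w \<in> carrier V" "(\<lambda>w. F (g w)) \<in> K \<rightarrow> carrier V'"
        using linear_maps_closed[OF F] by auto
      with insert show ?case
        using linear_maps_closed[OF F] by simp
    qed simp
    from this[OF finite_keys closed] show ?thesis
      by (simp add: presented_act_def p_def Let_def)
  qed
  also have "\<dots> = (\<Oplus>\<^bsub>V'\<^esub>w\<in>keys p. lookup p w \<odot>\<^bsub>V'\<^esub> foldr T' (letters w) (F v))"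
    using fold letters linear_maps_closed[OF F]
    by (intro V'.finsum_cong') (auto simp: linear_maps_smult[OF F] simp flip: fold[THEN conjunct2])
  also have "\<dots> = presented_act V' T' a (F v)"
    by (simp add: presented_act_def p_def Let_def)
  finally show ?thesis .
qed


section \<open>The spin Weyl group algebra and the Clifford algebra\<close>

lemma free_algebra_iff: "p \<in> carrier (free_algebra n) \<longleftrightarrow> (\<forall>w\<in>keys p. set (letters w) \<subseteq> {..<n})"
  by (auto simp: free_algebra_def monoid_algebra_def)

lemma free_algebra_simps:
  "\<zero>\<^bsub>free_algebra n\<^esub> = 0" "\<one>\<^bsub>free_algebra n\<^esub> = 1" "add (free_algebra n) = (+)" "mult (free_algebra n) = (*)"
  by (simp_all add: free_algebra_def monoid_algebra_def)

lemma free_algebra_zero: "0 \<in> carrier (free_algebra n)"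
  and free_algebra_one: "1 \<in> carrier (free_algebra n)"
  by (simp_all add: free_algebra_iff zero_word_def)

lemma free_algebra_add:
  "p \<in> carrier (free_algebra n) \<Longrightarrow> q \<in> carrier (free_algebra n) \<Longrightarrow> p + q \<in> carrier (free_algebra n)"
  using keys_add[of p q] by (auto simp: free_algebra_iff)

lemma free_algebra_uminus: "p \<in> carrier (free_algebra n) \<Longrightarrow> - p \<in> carrier (free_algebra n)"
  by (simp add: free_algebra_iff)

lemma free_algebra_mult:
  assumes "p \<in> carrier (free_algebra n)" "q \<in> carrier (free_algebra n)"
  shows "p * q \<in> carrier (free_algebra n)"
  unfolding free_algebra_iff
proof
  fix w
  assume "w \<in> keys (p * q)"
  then obtain u v where "u \<in> keys p" "v \<in> keys q" "w = u + v"
    using keys_mult[of p q] by blast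
  then show "set (letters w) \<subseteq> {..<n}"
    using assms by (simp add: free_algebra_iff plus_word_def)
qed

lemma free_algebra_power: "p \<in> carrier (free_algebra n) \<Longrightarrow> p ^ k \<in> carrier (free_algebra n)"
  by (induction k) (simp_all add: free_algebra_one free_algebra_mult)

lemma free_algebra_letter: "i < n \<Longrightarrow> letter i \<in> carrier (free_algebra n)"
  by (simp add: free_algebra_iff letter_def)

lemma free_algebra_ring: "ring (free_algebra n)"
proof (rule ringI)
  show "abelian_group (free_algebra n)"
  proof (rule abelian_groupI)
    fix p
    assume "p \<in> carrier (free_algebra n)"
    then show "\<exists>q\<in>carrier (free_algebra n). q \<oplus>\<^bsub>free_algebra n\<^esub> p = \<zero>\<^bsub>free_algebra n\<^esub>"
      by (intro bexI[of _ "- p"]) (simp_all add: free_algebra_simps free_algebra_uminus)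
  qed (simp_all add: free_algebra_simps free_algebra_add free_algebra_zero algebra_simps)
  show "Group.monoid (free_algebra n)"
    by (rule monoidI) (simp_all add: free_algebra_simps free_algebra_mult free_algebra_one mult.assoc)
qed (simp_all add: free_algebra_simps algebra_simps)

lemma presented_carrier:
  "a \<in> carrier (presented n R) \<longleftrightarrow>
    (\<exists>p\<in>carrier (free_algebra n). a = (Idl\<^bsub>free_algebra n\<^esub> R) +>\<^bsub>free_algebra n\<^esub> p)"
  by (auto simp: presented_def Let_def quot_def FactRing_def A_RCOSETS_def RCOSETS_def a_r_coset_def
      ring.defs module.defs)

lemma generator_carrier: "i < n \<Longrightarrow> generator n R i \<in> carrier (presented n R)"
  by (auto simp: presented_carrier generator_def intro: free_algebra_letter)

lemma generator_odd: "i < n \<Longrightarrow> generator n R i \<in> part (presented n R) 1"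
  by (auto simp: presented_def Let_def generator_def module.defs superalgebra.defs letter_def
      intro!: exI[of _ "letter i"] free_algebra_letter[unfolded letter_def])

text \<open>
  As the relators belong to the free algebra on \<open>n\<close> letters, so does their ideal, and with it every
  member of the coset \<open>a\<close>.
\<close>

lemma presented_proper_element:
  assumes R: "R \<subseteq> carrier (free_algebra n)" and a: "a \<in> carrier (presented n R)"
  shows "proper_element n a"
proof -
  let ?I = "Idl\<^bsub>free_algebra n\<^esub> R"
  have ideal: "ideal ?I (free_algebra n)"
    by (rule ring.genideal_ideal[OF free_algebra_ring R])
  obtain p where p: "p \<in> carrier (free_algebra n)" "a = ?I +>\<^bsub>free_algebra n\<^esub> p"
    using a by (auto simp: presented_carrier)
  have "a = (\<lambda>h. h + p) ` ?I"
    by (auto simp: p(2) a_r_coset_def r_coset_def free_algebra_simps)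
  moreover have "?I \<subseteq> carrier (free_algebra n)" "?I \<noteq> {}"
    using additive_subgroup.a_subset[OF ideal.axioms(1)[OF ideal]]
      additive_subgroup.zero_closed[OF ideal.axioms(1)[OF ideal]] by auto
  ultimately have "a \<noteq> {}" "a \<subseteq> carrier (free_algebra n)"
    using p free_algebra_add by auto
  then have "(SOME p. p \<in> a) \<in> carrier (free_algebra n)"
    by (meson ex_in_conv someI_ex subsetD)
  then show ?thesis
    by (simp add: proper_element_def free_algebra_iff)
qed

lemma spin_relators_free_algebra: "spin_relators X \<subseteq> carrier (free_algebra (rank X))"
  unfolding spin_relators_def diff_conv_add_uminus
  by (auto intro!: free_algebra_add free_algebra_uminus free_algebra_power free_algebra_mult
      free_algebra_letter free_algebra_one simp del: add_uminus_conv_diff)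

lemma vectorspace_cong:
  assumes V: "vectorspace \<C> V"
    and eq: "carrier V' = carrier V" "\<zero>\<^bsub>V'\<^esub> = \<zero>\<^bsub>V\<^esub>" "add V' = add V" "module.smult V' = module.smult V"
  shows "vectorspace \<C> V'"
proof -
  interpret V: vectorspace \<C> V by (rule V)
  show ?thesis
  proof (rule vs_criteria)
    show "field \<C>"
      by (rule class_field)
    show "\<forall>v\<in>carrier V'. \<exists>w\<in>carrier V'. v \<oplus>\<^bsub>V'\<^esub> w = \<zero>\<^bsub>V'\<^esub>"
      unfolding eq using V.r_neg V.a_inv_closed by blast
  qed (use V.a_ac V.smult_l_distr V.smult_r_distr V.smult_assoc1 V.smult_one in \<open>auto simp: eq\<close>)
qed

text \<open>
  The involution is \<open>1\<close> on the even part and \<open>-1\<close> on the odd part, and odd elements exchange these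
  parts.  This is why a twist by the sign character does not change the isomorphism class of the
  basic spin module.
\<close>

lemma parity_involution:
  assumes M: "supermodule A M"
  obtains d where "d \<in> linear_maps M M" "bij_betw d (carrier M) (carrier M)"
    "\<And>a m. a \<in> carrier A \<Longrightarrow> a \<in> part A 1 \<Longrightarrow> m \<in> carrier M \<Longrightarrow>
      d (act M a m) = (- 1) \<odot>\<^bsub>M\<^esub> act M a (d m)"
proof -
  interpret M: supermodule A M by (rule M)
  let ?E = "mpart M 0" and ?O = "mpart M 1"
  interpret E: LinearCombinations.submodule \<C> ?E M
    by (rule M.mpart_submodule)
  interpret O: LinearCombinations.submodule \<C> ?O M
    by (rule M.mpart_submodule)
  have decomp: "\<exists>x\<in>?E. \<exists>y\<in>?O. m = x \<oplus>\<^bsub>M\<^esub> y" if "m \<in> carrier M" for m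
    using that unfolding M.mpart_sum[symmetric] by (auto simp: set_add_def set_mult_def)
  have closed: "x \<in> carrier M" if "x \<in> ?E \<or> x \<in> ?O" for x
    using that E.subset O.subset by blast
  have neg: "(- 1) \<odot>\<^bsub>M\<^esub> x = \<ominus>\<^bsub>M\<^esub> x" if "x \<in> carrier M" for x
    using M.smult_minus_1[OF that] by (simp add: class_ring_simps)
  have unique: "x = x' \<and> y = y'"
    if "x \<in> ?E" "y \<in> ?O" "x' \<in> ?E" "y' \<in> ?O" "x \<oplus>\<^bsub>M\<^esub> y = x' \<oplus>\<^bsub>M\<^esub> y'" for x y x' y'
  proof -
    have c: "x \<in> carrier M" "y \<in> carrier M" "x' \<in> carrier M" "y' \<in> carrier M"
      using that closed by blast+
    have "x \<oplus>\<^bsub>M\<^esub> (- 1) \<odot>\<^bsub>M\<^esub> x' = y' \<oplus>\<^bsub>M\<^esub> (- 1) \<odot>\<^bsub>M\<^esub> y"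
    proof -
      have "x \<oplus>\<^bsub>M\<^esub> (\<ominus>\<^bsub>M\<^esub> x') = (x \<oplus>\<^bsub>M\<^esub> y) \<oplus>\<^bsub>M\<^esub> (\<ominus>\<^bsub>M\<^esub> y \<oplus>\<^bsub>M\<^esub> \<ominus>\<^bsub>M\<^esub> x')"
        using c by (simp add: M.a_assoc M.r_neg2)
      also have "\<dots> = (x' \<oplus>\<^bsub>M\<^esub> y') \<oplus>\<^bsub>M\<^esub> (\<ominus>\<^bsub>M\<^esub> y \<oplus>\<^bsub>M\<^esub> \<ominus>\<^bsub>M\<^esub> x')"
        using that by simp
      also have "\<dots> = y' \<oplus>\<^bsub>M\<^esub> (\<ominus>\<^bsub>M\<^esub> y)"
        using c by (simp add: M.a_comm[of x' y'] M.a_comm[of "\<ominus>\<^bsub>M\<^esub> y" "\<ominus>\<^bsub>M\<^esub> x'"] M.a_assoc M.r_neg2)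
      finally show ?thesis
        using c by (simp add: neg)
    qed
    moreover have "x \<oplus>\<^bsub>M\<^esub> (- 1) \<odot>\<^bsub>M\<^esub> x' \<in> ?E" "y' \<oplus>\<^bsub>M\<^esub> (- 1) \<odot>\<^bsub>M\<^esub> y \<in> ?O"
      using that by (auto intro: E.smult_closed O.smult_closed)
    ultimately have "x \<oplus>\<^bsub>M\<^esub> (\<ominus>\<^bsub>M\<^esub> x') = \<zero>\<^bsub>M\<^esub>" "y' \<oplus>\<^bsub>M\<^esub> (\<ominus>\<^bsub>M\<^esub> y) = \<zero>\<^bsub>M\<^esub>"
      using M.mpart_disjoint c by (auto simp: neg)
    then show ?thesis
      using c by (metis M.add.inv_closed M.add.inv_unique' M.minus_equality M.minus_minus M.a_comm)
  qed
  \<comment> \<open>The choice is unambiguous, as the decomposition into homogeneous parts is unique.\<close>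
  define d where "d m = (SOME z. \<exists>x\<in>?E. \<exists>y\<in>?O. m = x \<oplus>\<^bsub>M\<^esub> y \<and> z = x \<oplus>\<^bsub>M\<^esub> (- 1) \<odot>\<^bsub>M\<^esub> y)" for m
  have d: "d (x \<oplus>\<^bsub>M\<^esub> y) = x \<oplus>\<^bsub>M\<^esub> (- 1) \<odot>\<^bsub>M\<^esub> y" if "x \<in> ?E" "y \<in> ?O" for x y
  proof -
    have "\<exists>x'\<in>?E. \<exists>y'\<in>?O. x \<oplus>\<^bsub>M\<^esub> y = x' \<oplus>\<^bsub>M\<^esub> y' \<and> d (x \<oplus>\<^bsub>M\<^esub> y) = x' \<oplus>\<^bsub>M\<^esub> (- 1) \<odot>\<^bsub>M\<^esub> y'"
      unfolding d_def by (rule someI_ex) (use that in blast)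
    then show ?thesis
      using unique that by blast
  qed
  have d_closed: "d m \<in> carrier M" if "m \<in> carrier M" for m
    using decomp[OF that] closed by (auto simp: d)
  have linear: "d \<in> linear_maps M M"
    unfolding linear_maps_iff
  proof (intro conjI ballI allI)
    fix m
    assume m: "m \<in> carrier M"
    obtain x y where xy: "x \<in> ?E" "y \<in> ?O" "m = x \<oplus>\<^bsub>M\<^esub> y"
      using decomp[OF m] by blast
    have c: "x \<in> carrier M" "y \<in> carrier M"
      using xy closed by blast+
    show "d m \<in> carrier M"
      by (rule d_closed[OF m])
    show "d (c \<odot>\<^bsub>M\<^esub> m) = c \<odot>\<^bsub>M\<^esub> d m" for c
    proof -
      have "d (c \<odot>\<^bsub>M\<^esub> x \<oplus>\<^bsub>M\<^esub> c \<odot>\<^bsub>M\<^esub> y) = c \<odot>\<^bsub>M\<^esub> x \<oplus>\<^bsub>M\<^esub> (- 1) \<odot>\<^bsub>M\<^esub> (c \<odot>\<^bsub>M\<^esub> y)"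
        using xy by (intro d) auto
      then show ?thesis
        using c xy M.smult_assoc1[of "- 1" c y] M.smult_assoc1[of c "- 1" y]
        by (simp add: M.smult_r_distr d)
    qed
    fix m'
    assume m': "m' \<in> carrier M"
    obtain x' y' where xy': "x' \<in> ?E" "y' \<in> ?O" "m' = x' \<oplus>\<^bsub>M\<^esub> y'"
      using decomp[OF m'] by blast
    have c': "x' \<in> carrier M" "y' \<in> carrier M"
      using xy' closed by blast+
    have "m \<oplus>\<^bsub>M\<^esub> m' = (x \<oplus>\<^bsub>M\<^esub> x') \<oplus>\<^bsub>M\<^esub> (y \<oplus>\<^bsub>M\<^esub> y')"
      using c c' xy xy' by (simp add: M.a_ac)
    also have "d \<dots> = (x \<oplus>\<^bsub>M\<^esub> x') \<oplus>\<^bsub>M\<^esub> (- 1) \<odot>\<^bsub>M\<^esub> (y \<oplus>\<^bsub>M\<^esub> y')"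
      using xy xy' by (intro d) auto
    also have "\<dots> = d m \<oplus>\<^bsub>M\<^esub> d m'"
      using c c' xy xy' by (simp add: d M.smult_r_distr M.a_ac)
    finally show "d (m \<oplus>\<^bsub>M\<^esub> m') = d m \<oplus>\<^bsub>M\<^esub> d m'" .
  qed
  have "d (d m) = m" if m: "m \<in> carrier M" for m
  proof -
    obtain x y where xy: "x \<in> ?E" "y \<in> ?O" "m = x \<oplus>\<^bsub>M\<^esub> y"
      using decomp[OF m] by blast
    have "(- 1) \<odot>\<^bsub>M\<^esub> ((- 1) \<odot>\<^bsub>M\<^esub> y) = y"
      using closed xy M.smult_assoc1[of "- 1" "- 1" y] M.smult_one[of y] by simp
    then show ?thesis
      using xy d[of x "(- 1) \<odot>\<^bsub>M\<^esub> y"] by (simp add: d)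
  qed
  then have bij: "bij_betw d (carrier M) (carrier M)"
    using d_closed by (intro bij_betw_byWitness[of _ d]) auto
  have anti: "d (act M a m) = (- 1) \<odot>\<^bsub>M\<^esub> act M a (d m)"
    if a: "a \<in> carrier A" "a \<in> part A 1" and m: "m \<in> carrier M" for a m
  proof -
    obtain x y where xy: "x \<in> ?E" "y \<in> ?O" "m = x \<oplus>\<^bsub>M\<^esub> y"
      using decomp[OF m] by blast
    have c: "x \<in> carrier M" "y \<in> carrier M"
      using xy closed by blast+
    have p: "act M a x \<in> ?O" "act M a y \<in> ?E"
      using M.act_mpart[OF a(2) xy(1)] M.act_mpart[OF a(2) xy(2)] by simp_all
    have ca: "act M a x \<in> carrier M" "act M a y \<in> carrier M"
      using a c M.act_closed by auto
    have "act M a m = act M a y \<oplus>\<^bsub>M\<^esub> act M a x"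
      using a c ca xy by (simp add: M.act_add_right M.a_comm)
    then have "d (act M a m) = act M a y \<oplus>\<^bsub>M\<^esub> (- 1) \<odot>\<^bsub>M\<^esub> act M a x"
      using p by (simp add: d)
    moreover have "(- 1) \<odot>\<^bsub>M\<^esub> ((- 1) \<odot>\<^bsub>M\<^esub> act M a y) = act M a y"
      using ca M.smult_assoc1[of "- 1" "- 1" "act M a y"] M.smult_one[of "act M a y"] by simp
    ultimately show ?thesis
      using a c ca xy by (simp add: d M.act_add_right M.act_smult_right M.smult_r_distr M.a_comm)
  qed
  show ?thesis
    by (rule that[OF linear bij anti])
qed


text \<open>
  Each \<open>t\<^sub>i\<close> acts on \<open>B\<close> as a scalar multiple of a simple root, which is an odd element of the Clifford
  algebra, so the parity involution of the Clifford module serves for \<open>B\<close>.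
\<close>

lemma basic_spin_module_involution:
  assumes B: "basic_spin_module X b B"
  obtains d where "vectorspace \<C> B" "\<And>i. i < rank X \<Longrightarrow> act B (spin_gen X i) \<in> linear_maps B B"
    "d \<in> linear_maps B B" "bij_betw d (carrier B) (carrier B)"
    "\<And>i m. i < rank X \<Longrightarrow> m \<in> carrier B \<Longrightarrow>
      d (act B (spin_gen X i) m) = (- 1) \<odot>\<^bsub>B\<^esub> act B (spin_gen X i) (d m)"
proof -
  let ?A = "clifford_algebra X b"
  define k where "k i = 1 / csqrt (form b (unit_vec (rank X) i) (unit_vec (rank X) i))" for i
  obtain f C where f: "\<forall>i<rank X. f (spin_gen X i) = k i \<odot>\<^bsub>?A\<^esub> clifford_root X b i"
    and simple: "simple_supermodule ?A C" and BC: "B = pullback f C"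
    using B unfolding basic_spin_module_def k_def by blast
  have C: "supermodule ?A C"
    using simple by (simp add: simple_supermodule_def)
  interpret C: supermodule ?A C by (rule C)
  have simps: "carrier B = carrier C" "\<zero>\<^bsub>B\<^esub> = \<zero>\<^bsub>C\<^esub>" "add B = add C" "module.smult B = module.smult C"
    by (simp_all add: BC pullback_def)
  have root: "clifford_root X b i \<in> carrier ?A" "clifford_root X b i \<in> part ?A 1" if "i < rank X" for i
    unfolding clifford_root_def clifford_algebra_def
    by (rule generator_carrier[OF that], rule generator_odd[OF that])
  have act: "act B (spin_gen X i) m = k i \<odot>\<^bsub>C\<^esub> act C (clifford_root X b i) m"
    if "i < rank X" "m \<in> carrier C" for i m
    using that root by (simp add: BC pullback_def f C.act_smult_left)
  obtain d where d: "d \<in> linear_maps C C" "bij_betw d (carrier C) (carrier C)"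
    "\<And>a m. a \<in> carrier ?A \<Longrightarrow> a \<in> part ?A 1 \<Longrightarrow> m \<in> carrier C \<Longrightarrow>
      d (act C a m) = (- 1) \<odot>\<^bsub>C\<^esub> act C a (d m)"
    by (rule parity_involution[OF C]) blast
  have lin: "linear_maps B B = linear_maps C C"
    by (auto simp: linear_maps_iff simps)
  show ?thesis
  proof (rule that)
    show "vectorspace \<C> B"
      using C.vectorspace_axioms simps by (rule vectorspace_cong)
    show "d \<in> linear_maps B B" "bij_betw d (carrier B) (carrier B)"
      using d by (simp_all add: lin simps)
    fix i
    assume i: "i < rank X"
    note r = root[OF i]
    show "act B (spin_gen X i) \<in> linear_maps B B"
      unfolding lin linear_maps_iff
      using r i C.smult_assoc1[of "k i"] C.smult_assoc1[of _ "k i"]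
      by (auto simp: act C.act_closed C.act_add_right C.act_smult_right C.smult_r_distr mult.commute)
    fix m
    assume "m \<in> carrier B"
    then have m: "m \<in> carrier C" "d m \<in> carrier C"
      using linear_maps_closed[OF d(1)] by (simp_all add: simps)
    have c: "act C (clifford_root X b i) m \<in> carrier C" "act C (clifford_root X b i) (d m) \<in> carrier C"
      using r m C.act_closed by auto
    have "d (act B (spin_gen X i) m) = k i \<odot>\<^bsub>C\<^esub> ((- 1) \<odot>\<^bsub>C\<^esub> act C (clifford_root X b i) (d m))"
      using r i m c by (simp add: act linear_maps_smult[OF d(1)] d(3))
    also have "\<dots> = (- 1) \<odot>\<^bsub>B\<^esub> act B (spin_gen X i) (d m)"
      using i m c C.smult_assoc1[of "k i" "- 1" "act C (clifford_root X b i) (d m)"]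
        C.smult_assoc1[of "- 1" "k i" "act C (clifford_root X b i) (d m)"]
      by (simp add: act simps)
    finally show "d (act B (spin_gen X i) m) = (- 1) \<odot>\<^bsub>B\<^esub> act B (spin_gen X i) (d m)" .
  qed
qed


section \<open>The graded pieces of the coinvariant algebra\<close>

lemma sym_algebra_pm_space: "pm_space (sym_algebra n)"
proof -
  have "vectorspace \<C> (sym_algebra n)"
  proof (rule vs_criteria)
    show "field \<C>"
      by (rule class_field)
    show "\<forall>p\<in>Pol n. \<exists>q\<in>Pol n. p \<oplus>\<^bsub>sym_algebra n\<^esub> q = \<zero>\<^bsub>sym_algebra n\<^esub>"
    proof
      fix p
      assume "p \<in> Pol n"
      then show "\<exists>q\<in>Pol n. p \<oplus>\<^bsub>sym_algebra n\<^esub> q = \<zero>\<^bsub>sym_algebra n\<^esub>"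
        by (intro bexI[of _ "- p"]) (simp_all add: sym_algebra_simps Pol_uminus)
    qed
  qed (simp_all add: sym_algebra_simps Pol_add Pol_mult pol_const_mult single_add distrib_left
      distrib_right add.commute add.assoc)
  then interpret vectorspace \<C> "sym_algebra n" .
  show ?thesis
    by unfold_locales (simp_all add: sym_algebra_def monoid_algebra_def)
qed

context reflection_group
begin

lemma inv_ideal_pm_quotient: "pm_quotient (sym_algebra n) inv_ideal"
proof -
  interpret pm_space "sym_algebra n"
    by (rule sym_algebra_pm_space)
  show ?thesis
    unfolding pm_quotient_def pm_quotient_axioms_def
    by (intro conjI sym_algebra_pm_space submodule.intro module_axioms)
       (auto simp: sym_algebra_simps inv_ideal_Pol inv_ideal_add inv_ideal_mult)
qed

interpretation Q: pm_quotient "sym_algebra n" inv_ideal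
  by (rule inv_ideal_pm_quotient)

definition coinv :: "nat \<Rightarrow> (complex, mpoly set) module"
  where "coinv k = (quot (sym_algebra n) inv_ideal)
    \<lparr>carrier := {inv_ideal +>\<^bsub>sym_algebra n\<^esub> p | p. p \<in> sym_power n k}\<rparr>"

lemma coinv_carrier: "carrier (coinv k) = coset inv_ideal ` sym_power n k"
  by (auto simp: coinv_def Q.r_coset)

lemma coinv_zero: "\<zero>\<^bsub>coinv k\<^esub> = coset inv_ideal 0"
  by (simp add: coinv_def Q.quot_zero)

lemma coinv_add: "coset inv_ideal p \<oplus>\<^bsub>coinv k\<^esub> coset inv_ideal q = coset inv_ideal (p + q)"
  by (simp add: coinv_def Q.quot_add)

lemma coinv_smult: "c \<odot>\<^bsub>coinv k\<^esub> coset inv_ideal p = coset inv_ideal (pol_const c * p)"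
  by (simp add: coinv_def Q.quot_smult mult_map_scale_conv_mult)

lemma coinv_vectorspace: "vectorspace \<C> (coinv k)"
proof -
  interpret V: vectorspace \<C> "quot (sym_algebra n) inv_ideal"
    by (rule Q.quot_vectorspace)
  have "LinearCombinations.submodule \<C> (carrier (coinv k)) (quot (sym_algebra n) inv_ideal)"
    by (rule submodule.intro)
       (auto simp: V.module_axioms coinv_carrier Q.quot_carrier Q.quot_zero Q.quot_add Q.quot_smult
         mult_map_scale_conv_mult sym_power_Pol intro!: imageI sym_power_add sym_power_scale)
  then have "vectorspace \<C> ((quot (sym_algebra n) inv_ideal)\<lparr>carrier := carrier (coinv k)\<rparr>)"
    by (intro V.subspace_is_vs) (simp add: subspace_def V.vectorspace_axioms)
  then show ?thesis
    by (simp add: coinv_def)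
qed

text \<open>
  The image of a coset under \<open>w\<close> is a full coset because \<open>w\<close> is invertible on the ideal.
\<close>

lemma coinvariant_act_coset:
  assumes w: "w \<in> W" and p: "p \<in> Pol n"
  shows "coinvariant_act w (coset inv_ideal p) = coset inv_ideal (sym_act w p)"
proof -
  obtain v where v: "v \<in> W" "w * v = 1\<^sub>m n"
    using W_inv[OF w] by blast
  have "sym_act w ` inv_ideal = inv_ideal"
  proof
    show "sym_act w ` inv_ideal \<subseteq> inv_ideal"
      using inv_ideal_sym_act[OF w] by blast
    show "inv_ideal \<subseteq> sym_act w ` inv_ideal"
    proof
      fix h
      assume h: "h \<in> inv_ideal"
      then have "sym_act w (sym_act v h) = h"
        using W_sym_act_compose[OF w v(1) inv_ideal_Pol[OF h]] v(2) sym_act_1[OF inv_ideal_Pol[OF h]]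
        by simp
      then show "h \<in> sym_act w ` inv_ideal"
        using inv_ideal_sym_act[OF v(1) h] by (metis imageI)
    qed
  qed
  moreover have "coinvariant_act w (coset inv_ideal p) = (\<lambda>h. h + sym_act w p) ` (sym_act w ` inv_ideal)"
    by (simp add: coinvariant_act_def coset_def image_image sym_act_add)
  ultimately show ?thesis
    by (simp add: coset_def)
qed

lemma coinvariant_act_linear:
  assumes w: "w \<in> W"
  shows "coinvariant_act w \<in> linear_maps (coinv k) (coinv k)"
  unfolding linear_maps_iff coinv_carrier
  using w by (auto simp: coinvariant_act_coset[OF w] coinv_add coinv_smult sym_power_Pol sym_act_add
      sym_act_scale Pol_add Pol_mult intro!: imageI sym_act_degree)

text \<open>
  The map induced by \<^const>\<open>duality\<close> on cosets is well defined and injective because the duality map both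
  preserves and reflects membership in the ideal.
\<close>

lemma coinv_duality:
  assumes km: "k + m = card Refl"
  obtains F where "F \<in> linear_maps (coinv k) (coinv m)"
    "bij_betw F (carrier (coinv k)) (carrier (coinv m))"
    "\<And>i u. i < n \<Longrightarrow> u \<in> carrier (coinv k) \<Longrightarrow>
      F (coinvariant_act (s i) u) = (- 1) \<odot>\<^bsub>coinv m\<^esub> coinvariant_act (s i) (F u)"
proof -
  define F where "F u = coset inv_ideal (duality m (SOME p. p \<in> sym_power n k \<and> u = coset inv_ideal p))" for u
  have diff: "duality m p - duality m q = duality m (p - q)" if "p \<in> sym_power n k" "q \<in> sym_power n k" for p q
    using duality_add[of "p - q" q m] that sym_power_Pol by (simp add: Pol_diff)
  have sdiff: "p - q \<in> sym_power n l" if "p \<in> sym_power n l" "q \<in> sym_power n l" for p q l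
    using sym_power_add[OF that(1) sym_power_uminus[OF that(2)]] by simp
  have eq: "coset inv_ideal (duality m p) = coset inv_ideal (duality m q) \<longleftrightarrow>
      coset inv_ideal p = coset inv_ideal q" if "p \<in> sym_power n k" "q \<in> sym_power n k" for p q
    using duality_inv_ideal_iff[OF sdiff[OF that] km] by (simp add: Q.coset_eq_iff diff[OF that])
  have F: "F (coset inv_ideal p) = coset inv_ideal (duality m p)" if p: "p \<in> sym_power n k" for p
  proof -
    define q where "q = (SOME q. q \<in> sym_power n k \<and> coset inv_ideal p = coset inv_ideal q)"
    have q: "q \<in> sym_power n k \<and> coset inv_ideal p = coset inv_ideal q"
      unfolding q_def by (rule someI_ex) (use p in blast)
    have "F (coset inv_ideal p) = coset inv_ideal (duality m q)"
      by (simp add: F_def q_def)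
    also have "\<dots> = coset inv_ideal (duality m p)"
      using q eq[OF p, of q] by simp
    finally show ?thesis .
  qed
  have linear: "F \<in> linear_maps (coinv k) (coinv m)"
    unfolding linear_maps_iff coinv_carrier
    by (auto simp: F coinv_add coinv_smult sym_power_add sym_power_scale duality_add duality_scale
        sym_power_Pol intro!: imageI duality_degree)
  have "inj_on F (carrier (coinv k))"
    by (rule inj_onI) (auto simp: coinv_carrier F eq)
  moreover have "carrier (coinv m) \<subseteq> F ` carrier (coinv k)"
  proof
    fix u
    assume "u \<in> carrier (coinv m)"
    then obtain p where p: "p \<in> sym_power n m" "u = coset inv_ideal p"
      by (auto simp: coinv_carrier)
    obtain q where q: "q \<in> sym_power n k" "p - duality m q \<in> inv_ideal"
      using duality_surjective[OF km p(1)] by blast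
    then have "u = F (coset inv_ideal q)"
      by (simp add: F p(2) Q.coset_eq_iff)
    then show "u \<in> F ` carrier (coinv k)"
      using q by (simp add: coinv_carrier)
  qed
  ultimately have bij: "bij_betw F (carrier (coinv k)) (carrier (coinv m))"
    using linear_maps_closed[OF linear] by (auto simp: bij_betw_def)
  have sign: "F (coinvariant_act (s i) u) = (- 1) \<odot>\<^bsub>coinv m\<^esub> coinvariant_act (s i) (F u)"
    if i: "i < n" and u: "u \<in> carrier (coinv k)" for i u
  proof -
    obtain p where p: "p \<in> sym_power n k" "u = coset inv_ideal p"
      using u by (auto simp: coinv_carrier)
    note P = sym_power_Pol[OF p(1)] and D = sym_power_Pol[OF duality_degree[of m p]] and S = s_W[OF i]
    have "sym_act (s i) p \<in> sym_power n k"
      using p S by (intro sym_act_degree) auto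
    then show ?thesis
      using p P D S by (simp add: F coinvariant_act_coset coinv_smult duality_sym_act[OF i P] single_uminus)
  qed
  show ?thesis
    by (rule that[OF linear bij sign])
qed

lemma coinv_trivial:
  assumes "k > card Refl"
  shows "carrier (coinv k) = {\<zero>\<^bsub>coinv k\<^esub>}"
proof -
  have "coset inv_ideal p = coset inv_ideal 0" if "p \<in> sym_power n k" for p
    using sym_power_subset_inv_ideal[OF assms] that by (auto simp: Q.coset_eq_iff)
  then have "coset inv_ideal ` sym_power n k = (\<lambda>_. coset inv_ideal 0) ` sym_power n k"
    by (rule image_cong[OF refl])
  also have "\<dots> = {coset inv_ideal 0}"
    using sym_power_zero[of n k] by (intro image_constant)
  finally show ?thesis
    by (simp add: coinv_carrier coinv_zero)
qed

end


section \<open>Spin multiplicities\<close>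

context
  fixes X :: exceptional_type and b :: "complex mat" and B :: "(free set, 'm) supermodule"
    and \<chi> :: "(free set, 'c) supermodule"
  assumes form: "weyl_invariant_form X b"
    and B: "basic_spin_module X b B"
    and simple: "simple_supermodule (spin_algebra X) \<chi>"
begin

interpretation reflection_group "rank X" b "weyl_group X" "simple_refl X"
  by (rule weyl_group_reflection_group[OF form])

lemma coinvariant_part_coinv: "coinvariant_part X k = coinv k"
proof -
  have "coinvariant_ideal X = inv_ideal"
    by (simp add: coinvariant_ideal_def inv_ideal_def invariants_def)
  then show ?thesis
    by (simp add: coinvariant_part_def coinvariant_algebra_def coinv_def)
qed

lemma num_reflections_card: "num_reflections X = card Refl"
  by (simp add: num_reflections_def Refl_def)

abbreviation "target k \<equiv> spin_tensor X B (coinvariant_part X k) coinvariant_act"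

lemma alg_module_chi: "alg_module (spin_algebra X) \<chi>"
  using simple by (simp add: simple_supermodule_def supermodule_def)

lemma target_simps:
  "carrier (target k) = carrier (tensor_space B (coinv k))"
  "\<zero>\<^bsub>target k\<^esub> = \<zero>\<^bsub>tensor_space B (coinv k)\<^esub>"
  "add (target k) = add (tensor_space B (coinv k))"
  "module.smult (target k) = module.smult (tensor_space B (coinv k))"
  "act (target k) = presented_act (tensor_space B (coinv k))
      (\<lambda>i. tensor_hom B (coinv k) (act B (spin_gen X i)) (coinvariant_act (simple_refl X i)))"
  by (simp_all add: spin_tensor_def module.defs alg_module.defs coinvariant_part_coinv
      tensor_map_tensor_hom)

lemma B_vectorspace: "vectorspace \<C> B"
  and act_B_linear: "i < rank X \<Longrightarrow> act B (spin_gen X i) \<in> linear_maps B B"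
  by (rule basic_spin_module_involution[OF B], blast)+

lemma target_vectorspace: "vectorspace \<C> (target k)"
  by (rule vectorspace_cong[OF tensor_space_vectorspace[OF B_vectorspace coinv_vectorspace]])
     (simp_all add: target_simps)

lemma operator_linear:
  "i < rank X \<Longrightarrow> tensor_hom B (coinv k) (act B (spin_gen X i)) (coinvariant_act (simple_refl X i))
    \<in> linear_maps (tensor_space B (coinv k)) (tensor_space B (coinv k))"
  by (intro tensor_hom_linear B_vectorspace coinv_vectorspace act_B_linear coinvariant_act_linear s_W)

lemma spin_algebra_proper_element: "a \<in> carrier (spin_algebra X) \<Longrightarrow> proper_element (rank X) a"
  unfolding spin_algebra_def by (rule presented_proper_element[OF spin_relators_free_algebra])

lemma act_target_linear:
  assumes "a \<in> carrier (spin_algebra X)"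
  shows "act (target k) a \<in> linear_maps (target k) (target k)"
proof -
  have "act (target k) a \<in> linear_maps (tensor_space B (coinv k)) (tensor_space B (coinv k))"
    unfolding target_simps
    by (rule presented_act_linear[where n = "rank X"])
       (intro tensor_space_vectorspace B_vectorspace coinv_vectorspace operator_linear
         spin_algebra_proper_element assms | assumption)+
  then show ?thesis
    by (simp add: linear_maps_iff target_simps(1,3,4))
qed

text \<open>
  The isomorphism of the two tensor products is \<open>d \<otimes> F\<close>, with \<open>d\<close> the parity involution of \<open>B\<close> and
  \<open>F\<close> the duality isomorphism of the coinvariant algebra.
\<close>

lemma spin_multiplicity_symmetric:
  assumes km: "k + m = num_reflections X"
  shows "spin_multiplicity X B \<chi> k = spin_multiplicity X B \<chi> m"
proof -
  obtain d where d: "d \<in> linear_maps B B" "bij_betw d (carrier B) (carrier B)"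
    "\<And>i m. i < rank X \<Longrightarrow> m \<in> carrier B \<Longrightarrow>
      d (act B (spin_gen X i) m) = (- 1) \<odot>\<^bsub>B\<^esub> act B (spin_gen X i) (d m)"
    by (rule basic_spin_module_involution[OF B]) blast
  obtain F where F: "F \<in> linear_maps (coinv k) (coinv m)"
    "bij_betw F (carrier (coinv k)) (carrier (coinv m))"
    "\<And>i u. i < rank X \<Longrightarrow> u \<in> carrier (coinv k) \<Longrightarrow>
      F (coinvariant_act (simple_refl X i) u) = (- 1) \<odot>\<^bsub>coinv m\<^esub> coinvariant_act (simple_refl X i) (F u)"
    by (rule coinv_duality[OF km[unfolded num_reflections_card]]) blast
  let ?H = "tensor_hom B (coinv m) d F"
  note V = B_vectorspace coinv_vectorspace
  have lin: "?H \<in> linear_maps (tensor_space B (coinv k)) (tensor_space B (coinv m))"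
    by (intro tensor_hom_linear V d F)
  have "vectorspace.dim \<C> (hom_space (spin_algebra X) \<chi> (target k)) =
      vectorspace.dim \<C> (hom_space (spin_algebra X) \<chi> (target m))"
  proof (rule hom_space_dim_eq[OF alg_module_chi target_vectorspace target_vectorspace
        act_target_linear act_target_linear])
    show "?H \<in> linear_maps (target k) (target m)"
      using lin by (simp add: linear_maps_iff target_simps)
    show "bij_betw ?H (carrier (target k)) (carrier (target m))"
      unfolding target_simps by (intro tensor_hom_bij V d F)
    show "?H (act (target k) a v) = act (target m) a (?H v)"
      if "a \<in> carrier (spin_algebra X)" "v \<in> carrier (target k)" for a v
      unfolding target_simps
    proof (rule presented_act_intertwine[OF _ _ operator_linear lin _ spin_algebra_proper_element])
      show "?H (tensor_hom B (coinv k) (act B (spin_gen X i)) (coinvariant_act (simple_refl X i)) v) =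
          tensor_hom B (coinv m) (act B (spin_gen X i)) (coinvariant_act (simple_refl X i)) (?H v)"
        if "i < rank X" "v \<in> carrier (tensor_space B (coinv k))" for i v
        using that
        by (intro tensor_hom_intertwine V act_B_linear coinvariant_act_linear s_W d F)
    qed (use that in \<open>auto simp: target_simps tensor_space_vectorspace V\<close>)
  qed
  then show ?thesis
    by (simp add: spin_multiplicity_def)
qed

lemma spin_multiplicity_vanishes:
  assumes "k > num_reflections X"
  shows "spin_multiplicity X B \<chi> k = 0"
proof -
  have "carrier (target k) = {\<zero>\<^bsub>target k\<^esub>}"
    using assms unfolding target_simps num_reflections_card
    by (intro tensor_space_trivial B_vectorspace coinv_vectorspace coinv_trivial)
  then show ?thesis
    unfolding spin_multiplicity_def
    by (intro hom_space_dim_zero alg_module_chi target_vectorspace act_target_linear)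
qed

end

lemma poly_Abs_poly_bounded:
  assumes zero: "\<And>k. k > N \<Longrightarrow> f k = (0::complex)"
  shows "poly (Abs_poly f) t = (\<Sum>k\<le>N. f k * t ^ k)"
proof -
  have "eventually (\<lambda>k. f k = 0) cofinite"
    unfolding eventually_cofinite
    by (rule finite_subset[of _ "{..N}"]) (use zero not_le in auto)
  then have coeff: "coeff (Abs_poly f) = f"
    by (simp add: Abs_poly_inverse)
  have "degree (Abs_poly f) \<le> N"
    by (rule degree_le) (simp add: coeff zero)
  moreover have "f k = 0" if "k > degree (Abs_poly f)" for k
    using coeff_eq_0[OF that] by (simp add: coeff)
  ultimately show ?thesis
    unfolding poly_altdef coeff by (intro sum.mono_neutral_left) auto
qed

theorem proposition4p4:
  fixes X :: exceptional_type
    and b :: "complex mat"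
    and B :: "(free set, 'm) supermodule"
    and \<chi> :: "(free set, 'c) supermodule"
    and t :: complex
  assumes "weyl_invariant_form X b"
    and "basic_spin_module X b B"
    and "simple_supermodule (spin_algebra X) \<chi>"
    and "t \<noteq> 0"
  shows "poly (spin_fake_degree X B \<chi>) t =
    t ^ num_reflections X * poly (spin_fake_degree X B \<chi>) (inverse t)"
proof -
  define N where "N = num_reflections X"
  define f where "f k = (of_nat (spin_multiplicity X B \<chi> k) :: complex)" for k
  have zero: "f k = 0" if "k > N" for k
    using spin_multiplicity_vanishes[OF assms(1-3)] that by (simp add: f_def N_def)
  have sym: "f (N - k) = f k" if "k \<le> N" for k
    using spin_multiplicity_symmetric[OF assms(1-3), of "N - k" k] that by (simp add: f_def N_def)
  have eval: "poly (spin_fake_degree X B \<chi>) x = (\<Sum>k\<le>N. f k * x ^ k)" for x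
    unfolding spin_fake_degree_def f_def[symmetric] by (rule poly_Abs_poly_bounded[OF zero])
  have "t ^ N * poly (spin_fake_degree X B \<chi>) (inverse t) = (\<Sum>k\<le>N. f k * t ^ (N - k))"
    unfolding eval sum_distrib_left
    using assms(4) by (intro sum.cong) (simp_all add: power_diff power_inverse field_simps)
  also have "\<dots> = (\<Sum>k\<le>N. f (N - k) * t ^ k)"
    by (rule sum.reindex_bij_witness[of _ "\<lambda>k. N - k" "\<lambda>k. N - k"]) auto
  also have "\<dots> = poly (spin_fake_degree X B \<chi>) t"
    unfolding eval by (intro sum.cong) (simp_all add: sym)
  finally show ?thesis
    by (simp add: N_def)
qed

end
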